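(* Let $\lambda>0$, $\lambda\ne1$, be an algebraic number with minimal polynomial $f(t)=t^d+a_{d-1}t^{d-1}+\dots+a_0$ with integer coefficients. Let $\Lambda_\lambda=\langle\lambda\rangle$, $\Gamma_\lambda=\mathbb{Z}[\lambda,\lambda^{-1}]$, and let $\ell\in\Gamma_\lambda$ with $\ell>0$. Write $V_{ab}$ for the abelianisation of $V=V(\Gamma_\lambda,\Lambda_\lambda,\ell)$. (i) If $d=1$, then $V_{ab}\cong\mathbb{Z}_2$ if $f(1)$ is even, and $V_{ab}=0$ if $f(1)$ is odd. (ii) If $d=2$, $a_0=1$ and $a_1$ is odd, then $V_{ab}\cong\mathbb{Z}$. (iii) If $d=2$ and $a_0\neq1$, then $V_{ab}\cong\mathbb{Z}_2\oplus\mathbb{Z}/(1-a_0)\mathbb{Z}$ if $f(1)$ is even, and $V_{ab}\cong\mathbb{Z}/(1-a_0)\mathbb{Z}$ if $f(1)$ is odd. (iv) If $d=3$, $a_0=-1$ and $a_2+a_1$ is odd, then $V_{ab}\cong\mathbb{Z}/(a_1+a_2)\mathbb{Z}$.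
   Context: $\mathbb{Z}_2=\mathbb{Z}/2\mathbb{Z}$, and $\langle\lambda\rangle$ is the multiplicative subgroup of $(0,\infty)$ generated by $\lambda$. For a subgroup $\Lambda$ of $(\mathbb{R}_{>0},\cdot)$, an additive subgroup $\Gamma\subset\mathbb{R}$ with $\Lambda\cdot\Gamma=\Gamma$, and $0<\ell\in\Gamma$, $V(\Gamma,\Lambda,\ell)$ is the group, under composition, of right-continuous bijections $f:[0,\ell]\to[0,\ell]$ for which there are points $0=x_0<x_1<\dots<x_n=\ell$ in $\Gamma$ such that on each $[x_i,x_{i+1})$ the map $f$ is affine with slope in $\Lambda$. *)

theory Defs
  imports
    Complex_Main
    "HOL-Computational_Algebra.Polynomial"
    "HOL-Algebra.Bij"
    "HOL-Algebra.Elementary_Groups"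
begin

definition minimal_polynomial :: "real \<Rightarrow> rat poly \<Rightarrow> bool" where
  "minimal_polynomial x p \<longleftrightarrow>
     lead_coeff p = 1 \<and> poly (map_poly of_rat p) x = 0 \<and>
     (\<forall>q :: rat poly. q \<noteq> 0 \<longrightarrow> poly (map_poly of_rat q) x = 0 \<longrightarrow> degree p \<le> degree q)"

definition pos_real_group :: "real monoid" where
  "pos_real_group = \<lparr>carrier = {0<..}, monoid.mult = (*), one = 1\<rparr>"

definition slope_group :: "real \<Rightarrow> real set" where
  "slope_group lam = generate pos_real_group {lam}"

(* Z[lam, 1/lam], as the set of values at lam of integral Laurent polynomials *)
definition laurent_ring :: "real \<Rightarrow> real set" where
  "laurent_ring lam =
     {x. \<exists>(c :: int \<Rightarrow> int) K. finite K \<and> x = (\<Sum>k\<in>K. of_int (c k) * lam powi k)}"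

definition pw_affine :: "real set \<Rightarrow> real set \<Rightarrow> real \<Rightarrow> (real \<Rightarrow> real) \<Rightarrow> bool" where
  "pw_affine \<Gamma> \<Lambda> l f \<longleftrightarrow>
     (\<exists>(n :: nat) (x :: nat \<Rightarrow> real).
        x 0 = 0 \<and> x n = l \<and> (\<forall>i<n. x i < x (Suc i)) \<and> (\<forall>i\<le>n. x i \<in> \<Gamma>) \<and>
        (\<forall>i<n. \<exists>s\<in>\<Lambda>. \<exists>c. \<forall>t\<in>{x i..<x (Suc i)}. f t = s * t + c))"

(* Bijections of [0, l] are represented, as in BijGroup, by functions that are undefined
   outside [0, l].  This is why right-continuity is taken within {t..l}; at t = l it is void. *)
definition V_carrier :: "real set \<Rightarrow> real set \<Rightarrow> real \<Rightarrow> (real \<Rightarrow> real) set" where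
  "V_carrier \<Gamma> \<Lambda> l =
     {f \<in> Bij {0..l}. (\<forall>t\<in>{0..l}. continuous (at t within {t..l}) f) \<and> pw_affine \<Gamma> \<Lambda> l f}"

definition V_group :: "real set \<Rightarrow> real set \<Rightarrow> real \<Rightarrow> (real \<Rightarrow> real) monoid" where
  "V_group \<Gamma> \<Lambda> l = (BijGroup {0..l})\<lparr>carrier := V_carrier \<Gamma> \<Lambda> l\<rparr>"

definition abelianisation :: "('a, 'b) monoid_scheme \<Rightarrow> 'a set monoid" where
  "abelianisation G = G Mod derived G (carrier G)"

(* Z/mZ for an integer m of either sign (Z itself for m = 0) *)
definition Z_mod :: "int \<Rightarrow> int monoid" where
  "Z_mod m = integer_mod_group (nat \<bar>m\<bar>)"

end

theory Submission
  imports Defs "HOL-Library.Z2" "HOL-Number_Theory.Cong"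
begin

text \<open>
  Conjugation by swaps of intervals shows that the class in the abelianisation of the rotation exchanging
  adjacent intervals of lengths \<open>x\<close> and \<open>y\<close> depends only on \<open>(x, y)\<close>. As a function of the lengths it is
  biadditive, antisymmetric and invariant under scaling by \<open>\<lambda>\<close>, so it is given by an additive function
  \<open>\<psi>\<close> on \<open>\<Gamma>\<close>, whose kernel is a \<open>\<Lambda>\<close>-submodule containing \<open>\<lambda>\<^sup>n + \<lambda>\<^sup>-\<^sup>n\<close> and \<open>f(\<lambda>\<^sup>-\<^sup>1) \<Gamma>\<close>.

  Rotations generate modulo commutators. Interval exchanges are products of rotations; a swap is
  conjugate to a swap without change of slope; an element of small support can be multiplied by swaps
  until its slopes lie in \<open>{\<lambda>\<^sup>-\<^sup>1, 1, \<lambda>}\<close>, and it is then an interval exchange times a single swap.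

  That \<open>\<psi>\<close> has no further kernel is detected by two invariants: a generalised Sah-Arnoux-Fathi
  invariant, comparing the sum of a suitable interval function over the pieces with its sum over their
  images, and a sign that counts inversions with weights in \<open>\<int>/2\<close>.
\<close>

section \<open>Partitions into half-open intervals\<close>

text \<open>The class of 1 under \<open>psi\<close> has order at most two, because 2 =
  \<open>lam\<close>^0 + \<open>lam\<close>^0 lies in the kernel. This is where the parity of f(1)
  enters: in the cases treated, if f(1) is odd the relations from f(1/\<open>lam\<close>) put an odd
  integer into the kernel and the class dies; if f(1) is even, sending every power of
  \<open>lam\<close> to 1 is well defined modulo 2, and the sign detects the class. In degrees two
  and three the rest of the image is generated by the class of \<open>lam\<close>. Its order comes
  from a factor t^2 + s t + 1 of f modulo m: for m = 1 - a_0 in degree two it is f itself, for m =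
  a_1 + a_2 in degree three it is the cofactor of t - 1. Multiplication by t modulo such a factor
  has determinant one, so the determinant of two coordinate vectors is a pairing of lengths
  invariant under \<open>lam\<close>. The obstacle is a factor 2. Built on this antisymmetric
  pairing directly, the additive invariant of a rotation would be twice the determinant, which loses
  information for even m. A bilinear form whose antisymmetrisation is the determinant itself is
  therefore sought, and the interval functions are allowed a non-additive part to restore
  invariance.\<close>

definition part :: "real \<Rightarrow> real \<Rightarrow> (real \<times> real) set \<Rightarrow> bool" where
  "part c d P \<longleftrightarrow> finite P \<and> (\<forall>p\<in>P. fst p < snd p) \<and> (\<Union>p\<in>P. {fst p..<snd p}) = {c..<d} \<and>
     (\<forall>p\<in>P. \<forall>q\<in>P. \<forall>t. t \<in> {fst p..<snd p} \<longrightarrow> t \<in> {fst q..<snd q} \<longrightarrow> p = q)"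

lemma partI:
  assumes "finite P" "\<And>p. p \<in> P \<Longrightarrow> fst p < snd p"
    "\<And>t. c \<le> t \<Longrightarrow> t < d \<Longrightarrow> \<exists>p\<in>P. fst p \<le> t \<and> t < snd p"
    "\<And>p t. p \<in> P \<Longrightarrow> fst p \<le> t \<Longrightarrow> t < snd p \<Longrightarrow> c \<le> t \<and> t < d"
    "\<And>p q t. p \<in> P \<Longrightarrow> q \<in> P \<Longrightarrow> fst p \<le> t \<Longrightarrow> t < snd p \<Longrightarrow> fst q \<le> t \<Longrightarrow> t < snd q \<Longrightarrow> p = q"
  shows "part c d P"
  unfolding part_def using assms by (auto simp: set_eq_iff; blast)

lemma
  assumes "part c d P"
  shows part_finite: "finite P"
    and part_less: "p \<in> P \<Longrightarrow> fst p < snd p"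
    and part_cover: "c \<le> t \<Longrightarrow> t < d \<Longrightarrow> \<exists>p\<in>P. fst p \<le> t \<and> t < snd p"
    and part_inside: "p \<in> P \<Longrightarrow> fst p \<le> t \<Longrightarrow> t < snd p \<Longrightarrow> c \<le> t \<and> t < d"
    and part_unique: "p \<in> P \<Longrightarrow> q \<in> P \<Longrightarrow> fst p \<le> t \<Longrightarrow> t < snd p \<Longrightarrow> fst q \<le> t \<Longrightarrow> t < snd q \<Longrightarrow> p = q"
proof -
  have un: "\<And>t. (\<exists>p\<in>P. fst p \<le> t \<and> t < snd p) \<longleftrightarrow> c \<le> t \<and> t < d"
    using assms unfolding part_def set_eq_iff by (metis (no_types, lifting) UN_iff atLeastLessThan_iff)
  show "finite P" "p \<in> P \<Longrightarrow> fst p < snd p" using assms unfolding part_def by auto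
  show "c \<le> t \<Longrightarrow> t < d \<Longrightarrow> \<exists>p\<in>P. fst p \<le> t \<and> t < snd p" using un by blast
  show "p \<in> P \<Longrightarrow> fst p \<le> t \<Longrightarrow> t < snd p \<Longrightarrow> c \<le> t \<and> t < d" using un by blast
  show "p \<in> P \<Longrightarrow> q \<in> P \<Longrightarrow> fst p \<le> t \<Longrightarrow> t < snd p \<Longrightarrow> fst q \<le> t \<Longrightarrow> t < snd q \<Longrightarrow> p = q"
    using assms unfolding part_def by auto
qed

lemma part_bounds:
  assumes "part c d P" "p \<in> P"
  shows "c \<le> fst p" "snd p \<le> d"
proof -
  have l: "fst p < snd p" using part_less assms by blast
  show "c \<le> fst p" using part_inside[OF assms, of "fst p"] l by simp
  show "snd p \<le> d"
  proof (rule ccontr)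
    assume "\<not> snd p \<le> d"
    then show False using part_inside[OF assms, of "max (fst p) d"] l by auto
  qed
qed

lemma part_order:
  assumes "part c d P" "p \<in> P" "q \<in> P" "fst p < fst q"
  shows "snd p \<le> fst q"
  using part_unique[OF assms(1,2,3), of "fst q"] part_less[OF assms(1,2)] part_less[OF assms(1,3)] assms(4)
  by fastforce

lemma part_fst_inj:
  assumes "part c d P" "p \<in> P" "q \<in> P" "fst p = fst q"
  shows "p = q"
  using part_unique[OF assms(1,2,3), of "fst p"] part_less[OF assms(1,2)] part_less[OF assms(1,3)] assms(4) by simp

lemma part_snd_inj:
  assumes "part c d P" "p \<in> P" "q \<in> P" "snd p = snd q"
  shows "p = q"
proof -
  have "fst p < snd p" "fst q < snd q" using part_less[OF assms(1)] assms(2,3) by auto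
  then show ?thesis
    using part_unique[OF assms(1,2,3), of "max (fst p) (fst q)"] assms(4) by auto
qed

lemma part_right_end:
  assumes "part c d P" "p \<in> P" "snd p < d"
  shows "\<exists>q\<in>P. fst q = snd p"
proof -
  have l: "fst p < snd p" "c \<le> fst p" using part_less[OF assms(1,2)] part_bounds[OF assms(1,2)] by auto
  obtain q where q: "q \<in> P" "fst q \<le> snd p" "snd p < snd q"
    using part_cover[OF assms(1), of "snd p"] assms l by auto
  have "fst q = snd p"
  proof (rule ccontr)
    assume "fst q \<noteq> snd p"
    then have "p = q" using part_unique[OF assms(1,2) q(1), of "max (fst p) (fst q)"] q l by auto
    then show False using q by simp
  qed
  then show ?thesis using q by blast
qed

lemma part_left_end:
  assumes "part c d P" and a: "c < a" "a \<le> d" "a = d \<or> (\<exists>p\<in>P. fst p = a)"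
  shows "\<exists>q\<in>P. snd q = a"
proof -
  \<comment> \<open>The largest point of \<open>M\<close> is a: otherwise the piece containing it
    would run past a, which is impossible where a piece starts or the partition ends. The point c
    makes \<open>M\<close> nonempty.\<close>
  define M where "M = insert c (snd ` {q\<in>P. snd q \<le> a})"
  have fin: "finite M" unfolding M_def using part_finite[OF assms(1)] by auto
  define m where "m = Max M"
  have mM: "m \<in> M" unfolding m_def using fin by (rule Max_in) (simp add: M_def)
  have mle: "m \<le> a" using mM a by (auto simp: M_def)
  have "m = a"
  proof (rule ccontr)
    assume "m \<noteq> a"
    then have lt: "m < a" using mle by simp
    have "c \<le> m" unfolding m_def using fin by (auto simp: M_def)
    then obtain q where q: "q \<in> P" "fst q \<le> m" "m < snd q"
      using part_cover[OF assms(1), of m] lt a by auto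
    have gt: "snd q > a"
    proof (rule ccontr)
      assume "\<not> snd q > a"
      then have "snd q \<in> M" using q by (auto simp: M_def)
      then have "snd q \<le> m" unfolding m_def using fin by auto
      then show False using q by simp
    qed
    show False
    proof (cases "a = d")
      case True
      then show False using part_bounds[OF assms(1) q(1)] gt by simp
    next
      case False
      then obtain p where p: "p \<in> P" "fst p = a" using a by blast
      then have "p = q" using part_unique[OF assms(1) p(1) q(1), of a] part_less[OF assms(1) p(1)] gt q lt by auto
      then show False using p q lt by simp
    qed
  qed
  then show ?thesis using mM a by (auto simp: M_def)
qed

text \<open>Pieces form an unordered set, so that images under a piecewise affine bijection need no
  sorting. Equality of these two sets of division points takes the place of an enumeration when sums
  telescope.\<close>

lemma part_endpoints:
  assumes "part c d P" "c \<le> d"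
  shows "insert d (fst ` P) = insert c (snd ` P)"
proof (rule Set.set_eqI)
  fix a
  show "a \<in> insert d (fst ` P) \<longleftrightarrow> a \<in> insert c (snd ` P)"
  proof
    assume a: "a \<in> insert d (fst ` P)"
    show "a \<in> insert c (snd ` P)"
    proof (cases "a = c")
      case False
      have "c \<le> a" using a assms(2) part_bounds[OF assms(1)] by auto
      moreover have "a \<le> d" 
      using a
    proof
      assume "a \<in> fst ` P"
      then obtain p where "p \<in> P" "a = fst p" by blast
      then show "a \<le> d" using part_bounds(2)[OF assms(1), of p] part_less[OF assms(1), of p] by simp
    qed simp
      moreover have "a = d \<or> (\<exists>p\<in>P. fst p = a)" using a by auto
      ultimately show ?thesis using part_left_end[OF assms(1), of a] False by force
    qed simp
  next
    assume a: "a \<in> insert c (snd ` P)"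
    show "a \<in> insert d (fst ` P)"
    proof (cases "a = d")
      case False
      show ?thesis
      proof (cases "a = c")
        case True
        then obtain p where p: "p \<in> P" "fst p \<le> c" "c < snd p"
          using part_cover[OF assms(1), of c] False assms(2) by auto
        then have "fst p = c" using part_bounds(1)[OF assms(1), of p] by simp
        then show ?thesis using p True by force
      next
        case c: False
        then obtain p where p: "p \<in> P" "snd p = a" using a by auto
        then obtain q where "q \<in> P" "fst q = a"
          using part_right_end[OF assms(1) p(1)] part_bounds(2)[OF assms(1) p(1)] False by auto
        then show ?thesis by blast
      qed
    qed simp
  qed
qed

lemma part_telescope:
  fixes h :: "real \<Rightarrow> 'a::ab_group_add"
  assumes "part c d P" "c \<le> d"
  shows "(\<Sum>p\<in>P. h (snd p) - h (fst p)) = h d - h c"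
proof -
  have fin: "finite P" using part_finite assms by blast
  have i1: "inj_on fst P" and i2: "inj_on snd P"
    using part_fst_inj[OF assms(1)] part_snd_inj[OF assms(1)] by (auto simp: inj_on_def)
  have d: "d \<notin> fst ` P" 
  proof
    assume "d \<in> fst ` P"
    then obtain p where "p \<in> P" "d = fst p" by blast
    then show False using part_bounds(2)[OF assms(1), of p] part_less[OF assms(1), of p] by simp
  qed
  have c: "c \<notin> snd ` P" 
  proof
    assume "c \<in> snd ` P"
    then obtain p where "p \<in> P" "c = snd p" by blast
    then show False using part_bounds(1)[OF assms(1), of p] part_less[OF assms(1), of p] by simp
  qed
  have "(\<Sum>p\<in>P. h (fst p)) + h d = (\<Sum>x\<in>insert d (fst ` P). h x)"
    using d fin i1 by (simp add: sum.reindex add.commute)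
  also have "\<dots> = (\<Sum>x\<in>insert c (snd ` P). h x)" using part_endpoints[OF assms] by simp
  also have "\<dots> = (\<Sum>p\<in>P. h (snd p)) + h c"
    using c fin i2 by (simp add: sum.reindex add.commute)
  finally show ?thesis by (simp add: sum_subtractf algebra_simps)
qed

definition meet :: "(real \<times> real) set \<Rightarrow> (real \<times> real) set \<Rightarrow> (real \<times> real) set" where
  "meet P Q = {r. \<exists>p\<in>P. \<exists>q\<in>Q. r = (max (fst p) (fst q), min (snd p) (snd q)) \<and> fst r < snd r}"

lemma part_meet:
  assumes "part c d P" "part c d Q"
  shows "part c d (meet P Q)"
proof (rule partI)
  have "meet P Q \<subseteq> (\<lambda>(p,q). (max (fst p) (fst q), min (snd p) (snd q))) ` (P \<times> Q)"
    unfolding meet_def by auto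
  then show "finite (meet P Q)" using part_finite assms by (meson finite_SigmaI finite_imageI finite_subset)
next
  fix t assume "c \<le> t" "t < d"
  then obtain p q where "p \<in> P" "fst p \<le> t \<and> t < snd p" "q \<in> Q" "fst q \<le> t \<and> t < snd q"
    using part_cover[OF assms(1)] part_cover[OF assms(2)] by metis
  then show "\<exists>r\<in>meet P Q. fst r \<le> t \<and> t < snd r"
    unfolding meet_def by (intro bexI[of _ "(max (fst p) (fst q), min (snd p) (snd q))"]) auto
next
  fix r t assume "r \<in> meet P Q" "fst r \<le> t" "t < snd r"
  then show "c \<le> t \<and> t < d"
    unfolding meet_def using part_inside[OF assms(1)] by auto
next
  fix r s t assume r: "r \<in> meet P Q" "s \<in> meet P Q" "fst r \<le> t" "t < snd r" "fst s \<le> t" "t < snd s"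
  obtain p q p' q' where h: "p \<in> P" "q \<in> Q" "r = (max (fst p) (fst q), min (snd p) (snd q))"
    "p' \<in> P" "q' \<in> Q" "s = (max (fst p') (fst q'), min (snd p') (snd q'))"
    using r unfolding meet_def by blast
  have "p = p'" using part_unique[OF assms(1) h(1) h(4), of t] r h by auto
  moreover have "q = q'" using part_unique[OF assms(2) h(2) h(5), of t] r h by auto
  ultimately show "r = s" using h by simp
qed (auto simp: meet_def)

lemma meet_sub:
  assumes "r \<in> meet P Q"
  shows "\<exists>p\<in>P. fst p \<le> fst r \<and> snd r \<le> snd p" "\<exists>q\<in>Q. fst q \<le> fst r \<and> snd r \<le> snd q"
  using assms unfolding meet_def by force+

lemma meet_ends:
  assumes "r \<in> meet P Q"
  shows "fst r \<in> fst ` P \<union> fst ` Q" "snd r \<in> snd ` P \<union> snd ` Q"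
  using assms unfolding meet_def by (force simp: max_def min_def)+


section \<open>Laurent polynomials in the slope\<close>

locale pl =
  fixes lam l :: real
  assumes lam_pos: "lam > 0" and lam_ne1: "lam \<noteq> 1"
    and l_pos: "l > 0" and l_in: "l \<in> laurent_ring lam"
begin

abbreviation "\<Gamma> \<equiv> laurent_ring lam"

definition pw :: "int \<Rightarrow> real" where "pw k = lam powi k"

lemma pw_pos [simp]: "pw k > 0" using lam_pos by (simp add: pw_def)
lemma pw_nz [simp]: "pw k \<noteq> 0" using pw_pos[of k] by linarith
lemma pw_ge [simp]: "pw k \<ge> 0" using pw_pos[of k] by linarith
lemma pw_0 [simp]: "pw 0 = 1" by (simp add: pw_def)
lemma pw_1 [simp]: "pw 1 = lam" by (simp add: pw_def)
lemma pw_add: "pw (j + k) = pw j * pw k" using lam_pos by (simp add: pw_def power_int_add)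
lemma pw_minus: "pw (- k) = 1 / pw k" using lam_pos by (simp add: pw_def power_int_minus_divide)
lemma pw_nat: "pw (int n) = lam ^ n" by (simp add: pw_def)
lemma pw_m1: "pw (-1) = 1 / lam" by (simp add: pw_minus)
lemma pw_cancel [simp]: "pw k * pw (- k) = 1" "pw (- k) * pw k = 1"
  "pw k * (pw (- k) * x) = x" "pw (- k) * (pw k * x) = x"
  by (simp_all add: pw_minus)

lemma pw_eq1: "pw k = 1 \<Longrightarrow> k = 0"
proof -
  assume h: "pw k = 1"
  then have "k * ln lam = 0"
    using lam_pos ln_powr[of lam "real_of_int k"] by (simp add: pw_def powr_real_of_int'[symmetric])
  then show "k = 0" using lam_pos lam_ne1 by simp
qed

text \<open>This rests on \<open>lam\<close> being different from 1: a slope determines its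
  exponent, so slopes are recorded as integers throughout.\<close>

lemma pw_inj: "pw j = pw k \<longleftrightarrow> j = k"
proof
  assume "pw j = pw k"
  then have "pw (j - k) = 1" using pw_add[of "j-k" k] by simp
  then show "j = k" using pw_eq1 by force
qed simp

lemma pw_small: "e > 0 \<Longrightarrow> \<exists>k. pw k < e"
proof -
  assume e: "e > 0"
  have "\<exists>n. \<bar>x\<bar> ^ n < e" if "0 < x" "x < 1" for x :: real
    using real_arch_pow_inv[OF e, of x] that by auto
  then have *: "\<exists>n. x ^ n < e" if "0 < x" "x < 1" for x :: real using that by fastforce
  show ?thesis
  proof (cases "lam < 1")
    case True
    then obtain n where "lam ^ n < e" using *[of lam] lam_pos by auto
    then show ?thesis using pw_nat by metis
  next
    case False
    then have "0 < 1/lam" "1/lam < 1" using lam_ne1 lam_pos by auto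
    then obtain n where "(1/lam) ^ n < e" using * by blast
    then have "pw (- int n) < e" by (simp add: pw_minus pw_nat power_one_over)
    then show ?thesis by blast
  qed
qed

lemma pw_small_mult: "e > 0 \<Longrightarrow> x \<ge> 0 \<Longrightarrow> \<exists>k. pw k * x < e"
proof -
  assume h: "e > 0" "x \<ge> 0"
  then obtain k where k: "pw k < e / (x + 1)" using pw_small[of "e/(x+1)"] by auto
  have "pw k * x \<le> pw k * (x + 1)" by simp
  also have "\<dots> < e" using k h by (simp add: field_simps)
  finally show ?thesis by blast
qed

lemma G_def: "x \<in> \<Gamma> \<longleftrightarrow> (\<exists>(c :: int \<Rightarrow> int) K. finite K \<and> x = (\<Sum>k\<in>K. of_int (c k) * pw k))"
  by (simp add: laurent_ring_def pw_def)

lemma G_pw [simp]: "pw k \<in> \<Gamma>"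
  unfolding G_def by (intro exI[of _ "\<lambda>_. 1"] exI[of _ "{k}"]) simp

lemma G_0 [simp]: "0 \<in> \<Gamma>"
  unfolding G_def by (intro exI[of _ "\<lambda>_. 1"] exI[of _ "{}"]) simp

lemma G_1 [simp]: "1 \<in> \<Gamma>" using G_pw[of 0] by simp
lemma G_lam [simp]: "lam \<in> \<Gamma>" using G_pw[of 1] by simp

lemma G_add [simp]: assumes "x \<in> \<Gamma>" "y \<in> \<Gamma>" shows "x + y \<in> \<Gamma>"
proof -
  obtain c K d J where h: "finite K" "x = (\<Sum>k\<in>K. of_int (c k) * pw k)"
    "finite J" "y = (\<Sum>k\<in>J. of_int (d k) * pw k)"
    using assms unfolding G_def by blast
  have "x = (\<Sum>k\<in>K \<union> J. of_int (if k \<in> K then c k else 0) * pw k)"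
    unfolding h(2) by (rule sum.mono_neutral_cong_left) (use h in auto)
  moreover have "y = (\<Sum>k\<in>K \<union> J. of_int (if k \<in> J then d k else 0) * pw k)"
    unfolding h(4) by (rule sum.mono_neutral_cong_left) (use h in auto)
  ultimately have "x + y = (\<Sum>k\<in>K \<union> J. of_int ((if k \<in> K then c k else 0) + (if k \<in> J then d k else 0)) * pw k)"
    by (simp add: sum.distrib[symmetric] algebra_simps)
  then show ?thesis unfolding G_def using h
    by (intro exI[of _ "\<lambda>k. (if k \<in> K then c k else 0) + (if k \<in> J then d k else 0)"] exI[of _ "K \<union> J"]) auto
qed

lemma G_minus [simp]: assumes "x \<in> \<Gamma>" shows "- x \<in> \<Gamma>"
proof -
  obtain c K where h: "finite K" "x = (\<Sum>k\<in>K. of_int (c k) * pw k)"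
    using assms unfolding G_def by blast
  then have "- x = (\<Sum>k\<in>K. of_int (- c k) * pw k)" by (simp add: sum_negf)
  then show ?thesis unfolding G_def using h(1) by (intro exI[of _ "\<lambda>k. - c k"] exI[of _ K]) auto
qed

lemma G_diff [simp]: assumes "x \<in> \<Gamma>" "y \<in> \<Gamma>" shows "x - y \<in> \<Gamma>"
  using G_add[OF assms(1) G_minus[OF assms(2)]] by simp

lemma G_scale [simp]: assumes "x \<in> \<Gamma>" shows "pw j * x \<in> \<Gamma>"
proof -
  obtain c K where h: "finite K" "x = (\<Sum>k\<in>K. of_int (c k) * pw k)"
    using assms unfolding G_def by blast
  then have "pw j * x = (\<Sum>k\<in>K. of_int (c k) * pw (j + k))"
    by (simp add: sum_distrib_left pw_add algebra_simps)
  also have "\<dots> = (\<Sum>k\<in>(\<lambda>k. j + k) ` K. of_int (c (k - j)) * pw k)"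
    by (subst sum.reindex) (auto simp: inj_on_def)
  finally show ?thesis unfolding G_def using h(1)
    by (intro exI[of _ "\<lambda>k. c (k - j)"] exI[of _ "(\<lambda>k. j + k) ` K"]) auto
qed

lemma G_of_int [simp]: "of_int n * x \<in> \<Gamma>" if "x \<in> \<Gamma>"
proof (induction n rule: int_induct[where k = 0])
  case base show ?case by simp
next
  case (step1 n) then show ?case using G_add[OF step1(2) that] by (simp add: algebra_simps)
next
  case (step2 n) then show ?case using G_diff[OF step2(2) that] by (simp add: algebra_simps)
qed

lemma G_int [simp]: "of_int n \<in> \<Gamma>" using G_of_int[OF G_1] by simp

lemma G_sum: "finite K \<Longrightarrow> (\<And>k. k \<in> K \<Longrightarrow> g k \<in> \<Gamma>) \<Longrightarrow> (\<Sum>k\<in>K. g k) \<in> \<Gamma>"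
  by (induction K rule: finite_induct) auto

text \<open>Powers of \<open>lam\<close> generate the ring additively, so identities between
  additive functions are checked on powers alone.\<close>

lemma G_induct [consumes 1, case_names zero add sub]:
  assumes "x \<in> \<Gamma>" and "Q 0"
    and add: "\<And>x k. x \<in> \<Gamma> \<Longrightarrow> Q x \<Longrightarrow> Q (x + pw k)"
    and sub: "\<And>x k. x \<in> \<Gamma> \<Longrightarrow> Q x \<Longrightarrow> Q (x - pw k)"
  shows "Q x"
proof -
  obtain c K where h: "finite K" "x = (\<Sum>k\<in>K. of_int (c k) * pw k)"
    using assms unfolding G_def by blast
  have step: "Q (y + of_int n * pw k)" if "y \<in> \<Gamma>" "Q y" for y n k
  proof (induction n rule: int_induct[where k = 0])
    case base show ?case using that by simp
  next
    case (step1 n) then show ?case using add[OF _ step1(2), of k] that by (simp add: algebra_simps)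
  next
    case (step2 n) then show ?case using sub[OF _ step2(2), of k] that by (simp add: algebra_simps)
  qed
  have "Q (\<Sum>k\<in>K. of_int (c k) * pw k) \<and> (\<Sum>k\<in>K. of_int (c k) * pw k) \<in> \<Gamma>" using h(1)
  proof (induction K rule: finite_induct)
    case (insert k F)
    then show ?case using step[of "\<Sum>k\<in>F. of_int (c k) * pw k" "c k" k] G_add
      by (simp add: add.commute)
  qed (simp add: assms(2))
  then show ?thesis using h(2) by simp
qed

end

section \<open>Partitions from finite sets of break points\<close>

definition brk :: "real set \<Rightarrow> (real \<times> real) set" where
  "brk B = {p. fst p \<in> B \<and> snd p \<in> B \<and> fst p < snd p \<and> (\<forall>b\<in>B. b \<le> fst p \<or> snd p \<le> b)}"

lemma part_brk:
  assumes "finite B" "c \<in> B" "d \<in> B" "B \<subseteq> {c..d}"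
  shows "part c d (brk B)"
proof (rule partI)
  have "brk B \<subseteq> B \<times> B" unfolding brk_def by auto
  then show "finite (brk B)" using assms(1) by (meson finite_SigmaI finite_subset)
next
  fix t assume t: "c \<le> t" "t < d"
  define a where "a = Max {b\<in>B. b \<le> t}"
  define b where "b = Min {b\<in>B. t < b}"
  have fin: "finite {b\<in>B. b \<le> t}" "finite {b\<in>B. t < b}" using assms(1) by auto
  have a: "a \<in> {b\<in>B. b \<le> t}" unfolding a_def by (rule Max_in) (use fin assms t in auto)
  have b: "b \<in> {b\<in>B. t < b}" unfolding b_def by (rule Min_in) (use fin assms t in auto)
  have "z \<le> a \<or> b \<le> z" if "z \<in> B" for z
  proof (cases "z \<le> t")
    case True then show ?thesis unfolding a_def using fin that by (intro disjI1 Max_ge) auto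
  next
    case False then show ?thesis unfolding b_def using fin that by (intro disjI2 Min_le) auto
  qed
  then have "(a, b) \<in> brk B" using a b unfolding brk_def by auto
  then show "\<exists>p\<in>brk B. fst p \<le> t \<and> t < snd p" using a b by (intro bexI[of _ "(a, b)"]) auto
next
  fix p t assume "p \<in> brk B" "fst p \<le> t" "t < snd p"
  moreover from this have "fst p \<in> {c..d}" "snd p \<in> {c..d}" using assms unfolding brk_def by auto
  ultimately show "c \<le> t \<and> t < d" by auto
next
  fix p q t assume h: "p \<in> brk B" "q \<in> brk B" "fst p \<le> t" "t < snd p" "fst q \<le> t" "t < snd q"
  have "fst q \<le> fst p \<or> snd p \<le> fst q" "fst p \<le> fst q \<or> snd q \<le> fst p"
    "snd p \<le> fst q \<or> snd q \<le> snd p" "snd q \<le> fst p \<or> snd p \<le> snd q"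
    using h(1,2) unfolding brk_def mem_Collect_eq by blast+
  then show "p = q" using h by (intro prod_eqI) auto
qed (auto simp: brk_def)

abbreviation finv :: "(real \<Rightarrow> real) \<Rightarrow> real \<Rightarrow> real" where
  "finv \<equiv> inv_into UNIV"

context pl
begin

section \<open>The group of piecewise affine bijections\<close>

definition aff :: "(real \<Rightarrow> real) \<Rightarrow> real \<times> real \<Rightarrow> bool" where
  "aff f p \<longleftrightarrow> (\<exists>k. \<forall>t. fst p \<le> t \<longrightarrow> t < snd p \<longrightarrow> f t = f (fst p) + pw k * (t - fst p))"

text \<open>Asking for left values in \<open>\<Gamma>\<close> suffices: slopes preserve
  \<open>\<Gamma>\<close>, hence the right ends of the image intervals lie there as well.\<close>

definition adapted :: "(real \<Rightarrow> real) \<Rightarrow> (real \<times> real) set \<Rightarrow> bool" where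
  "adapted f P \<longleftrightarrow> part 0 l P \<and> (\<forall>p\<in>P. fst p \<in> \<Gamma> \<and> snd p \<in> \<Gamma> \<and> f (fst p) \<in> \<Gamma> \<and> aff f p)"

text \<open>The group V transported to bijections of the whole line that are the identity outside
  [0, l). Total functions make composition and inverse the ordinary ones, and half-open pieces match
  right-continuity.\<close>

definition W :: "(real \<Rightarrow> real) set" where
  "W = {f. bij f \<and> (\<forall>t. \<not> (0 \<le> t \<and> t < l) \<longrightarrow> f t = t) \<and> (\<exists>P. adapted f P)}"

text \<open>The right end of the image of \<open>p\<close>; evaluating at the midpoint avoids naming the slope.\<close>
definition rt :: "(real \<Rightarrow> real) \<Rightarrow> real \<times> real \<Rightarrow> real" where
  "rt f p = 2 * f ((fst p + snd p) / 2) - f (fst p)"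

definition img :: "(real \<Rightarrow> real) \<Rightarrow> real \<times> real \<Rightarrow> real \<times> real" where
  "img f p = (f (fst p), rt f p)"

lemma rt_eq:
  assumes "\<And>t. a \<le> t \<Longrightarrow> t < b \<Longrightarrow> f t = f a + s * (t - a)" "a < b"
  shows "rt f (a, b) = f a + s * (b - a)"
proof -
  have "f ((a + b) / 2) = f a + s * ((a + b) / 2 - a)" using assms(2) by (intro assms(1)) auto
  then show ?thesis by (simp add: rt_def field_simps)
qed

lemma
  assumes "f \<in> W"
  shows W_bij: "bij f" and W_out: "\<not> (0 \<le> t \<and> t < l) \<Longrightarrow> f t = t"
    and W_eq: "f x = f y \<longleftrightarrow> x = y"
    and W_range: "0 \<le> f t \<and> f t < l \<longleftrightarrow> 0 \<le> t \<and> t < l"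
    and W_inv_f: "finv f (f t) = t" and W_f_inv: "f (finv f t) = t"
proof -
  show b: "bij f" using assms unfolding W_def by auto
  show o: "\<not> (0 \<le> t \<and> t < l) \<Longrightarrow> f t = t" for t using assms unfolding W_def by auto
  show e: "f x = f y \<longleftrightarrow> x = y" for x y using b by (auto dest: bij_is_inj injD)
  show "finv f (f t) = t" using b by (simp add: bij_is_inj)
  show fi: "f (finv f t) = t" for t using b by (simp add: bij_is_surj surj_f_inv_f)
  show "0 \<le> f t \<and> f t < l \<longleftrightarrow> 0 \<le> t \<and> t < l"
  proof
    assume "0 \<le> f t \<and> f t < l" then show "0 \<le> t \<and> t < l" using o by fastforce
  next
    assume t: "0 \<le> t \<and> t < l"
    show "0 \<le> f t \<and> f t < l"
    proof (rule ccontr)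
      assume "\<not> ?thesis"
      then have "f (f t) = f t" using o by blast
      then have "f t = t" using e by blast
      then show False using t \<open>\<not> _\<close> by simp
    qed
  qed
qed

lemma adaptedE:
  assumes "adapted f P" "p \<in> P"
  obtains k where "fst p < snd p" "fst p \<in> \<Gamma>" "snd p \<in> \<Gamma>" "f (fst p) \<in> \<Gamma>"
    "\<And>t. fst p \<le> t \<Longrightarrow> t < snd p \<Longrightarrow> f t = f (fst p) + pw k * (t - fst p)"
    "img f p = (f (fst p), f (fst p) + pw k * (snd p - fst p))" "0 \<le> fst p" "snd p \<le> l"
proof -
  have P: "part 0 l P" and p: "fst p \<in> \<Gamma>" "snd p \<in> \<Gamma>" "f (fst p) \<in> \<Gamma>" "aff f p"
    using assms unfolding adapted_def by auto
  have l: "fst p < snd p" using part_less[OF P assms(2)] .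
  obtain k where k: "\<And>t. fst p \<le> t \<Longrightarrow> t < snd p \<Longrightarrow> f t = f (fst p) + pw k * (t - fst p)"
    using p(4) unfolding aff_def by blast
  have "rt f p = f (fst p) + pw k * (snd p - fst p)"
    using rt_eq[OF k l] by simp
  then have "img f p = (f (fst p), f (fst p) + pw k * (snd p - fst p))" by (simp add: img_def)
  then show ?thesis using that[OF l p(1-3) k] part_bounds[OF P assms(2)] by blast
qed

text \<open>Bijectivity turns the image intervals into a partition of [0, l), on which the inverse
  is affine with the inverse slopes. Closure under inverses and the reindexing of later sums rest on
  this.\<close>

lemma adapted_inv:
  assumes f: "f \<in> W" and P: "adapted f P"
  shows "adapted (finv f) (img f ` P)" "inj_on (img f) P" "\<And>p. p \<in> P \<Longrightarrow> img (finv f) (img f p) = p"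
proof -
  have pt: "part 0 l P" using P unfolding adapted_def by simp
  have key: "\<exists>k. img f p = (f (fst p), f (fst p) + pw k * (snd p - fst p)) \<and>
     (\<forall>u. f (fst p) \<le> u \<longrightarrow> u < snd (img f p) \<longrightarrow>
        finv f u = fst p + pw (- k) * (u - f (fst p)) \<and> fst p \<le> finv f u \<and> finv f u < snd p) \<and>
     (\<forall>t. fst p \<le> t \<longrightarrow> t < snd p \<longrightarrow> f (fst p) \<le> f t \<and> f t < snd (img f p))"
    if p: "p \<in> P" for p
  proof -
    obtain k where k: "fst p < snd p" "\<And>t. fst p \<le> t \<Longrightarrow> t < snd p \<Longrightarrow> f t = f (fst p) + pw k * (t - fst p)"
      "img f p = (f (fst p), f (fst p) + pw k * (snd p - fst p))"
      using adaptedE[OF P p] by metis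
    show ?thesis
    proof (intro exI[of _ k] conjI allI impI)
      show "img f p = (f (fst p), f (fst p) + pw k * (snd p - fst p))" by (fact k)
      fix u assume u: "f (fst p) \<le> u" "u < snd (img f p)"
      define t where "t = fst p + pw (- k) * (u - f (fst p))"
      have t1: "fst p \<le> t" using u by (simp add: t_def)
      have "pw (- k) * (u - f (fst p)) < pw (- k) * (pw k * (snd p - fst p))"
        using u k(3) by (intro mult_strict_left_mono) auto
      then have t2: "t < snd p" by (simp add: t_def)
      have "f t = u" using k(2)[OF t1 t2] by (simp add: t_def)
      then have "finv f u = t" using W_inv_f[OF f, of t] by simp
      then show "finv f u = fst p + pw (- k) * (u - f (fst p))" "fst p \<le> finv f u" "finv f u < snd p"
        using t1 t2 t_def by auto
    next
      fix t assume t: "fst p \<le> t" "t < snd p"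
      then show "f (fst p) \<le> f t" using k(2)[OF t] by simp
      show "f t < snd (img f p)" using k(2)[OF t] k(3) t by simp
    qed
  qed
  have fst_img: "fst (img f p) = f (fst p)" for p by (simp add: img_def)
  show inj: "inj_on (img f) P"
  proof (rule inj_onI)
    fix p q assume "p \<in> P" "q \<in> P" "img f p = img f q"
    then show "p = q" using part_fst_inj[OF pt] W_eq[OF f] fst_img by metis
  qed
  have pi: "part 0 l (img f ` P)"
  proof (rule partI)
    show "finite (img f ` P)" using part_finite[OF pt] by simp
  next
    fix r assume "r \<in> img f ` P"
    then obtain p where p: "p \<in> P" "r = img f p" by blast
    obtain k where "img f p = (f (fst p), f (fst p) + pw k * (snd p - fst p))" using key[OF p(1)] by blast
    then show "fst r < snd r" using p part_less[OF pt p(1)] by simp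
  next
    fix t assume t: "0 \<le> t" "t < l"
    then have "0 \<le> finv f t \<and> finv f t < l" using W_range[OF f, of "finv f t"] W_f_inv[OF f] by simp
    then obtain p where p: "p \<in> P" "fst p \<le> finv f t" "finv f t < snd p" using part_cover[OF pt] by blast
    then have "f (fst p) \<le> t \<and> t < snd (img f p)" using key[OF p(1)] W_f_inv[OF f, of t] by metis
    then show "\<exists>r\<in>img f ` P. fst r \<le> t \<and> t < snd r" using p fst_img by (intro bexI[of _ "img f p"]) auto
  next
    fix r t assume r: "r \<in> img f ` P" "fst r \<le> t" "t < snd r"
    then obtain p where p: "p \<in> P" "r = img f p" by blast
    then have "fst p \<le> finv f t" "finv f t < snd p" using key[OF p(1)] r fst_img by auto
    then have "0 \<le> finv f t \<and> finv f t < l" using part_inside[OF pt p(1)] by blast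
    then show "0 \<le> t \<and> t < l" using W_range[OF f, of "finv f t"] W_f_inv[OF f] by simp
  next
    fix r s t assume r: "r \<in> img f ` P" "s \<in> img f ` P" "fst r \<le> t" "t < snd r" "fst s \<le> t" "t < snd s"
    then obtain p q where p: "p \<in> P" "r = img f p" "q \<in> P" "s = img f q" by blast
    then have "fst p \<le> finv f t" "finv f t < snd p" "fst q \<le> finv f t" "finv f t < snd q"
      using key[OF p(1)] key[OF p(3)] r fst_img by auto
    then show "r = s" using part_unique[OF pt p(1) p(3)] p by blast
  qed
  have aff': "fst r \<in> \<Gamma> \<and> snd r \<in> \<Gamma> \<and> finv f (fst r) \<in> \<Gamma> \<and> aff (finv f) r \<and> img (finv f) r = p"
    if p: "p \<in> P" "r = img f p" for p r
  proof -
    obtain j where j: "fst p \<in> \<Gamma>" "snd p \<in> \<Gamma>" "f (fst p) \<in> \<Gamma>" "fst p < snd p" using adaptedE[OF P p(1)] by metis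
    obtain k where k: "img f p = (f (fst p), f (fst p) + pw k * (snd p - fst p))"
      "\<And>u. f (fst p) \<le> u \<Longrightarrow> u < snd (img f p) \<Longrightarrow> finv f u = fst p + pw (- k) * (u - f (fst p))"
      using key[OF p(1)] by blast
    have i: "finv f (f (fst p)) = fst p" using W_inv_f[OF f] .
    have a: "finv f u = finv f (fst r) + pw (- k) * (u - fst r)" if "fst r \<le> u" "u < snd r" for u
      using that k i p(2) by simp
    have "aff (finv f) r" unfolding aff_def using a by blast
    moreover have "rt (finv f) r = snd p"
      using rt_eq[of "fst r" "snd r" "finv f" "pw (-k)", OF a] k(1) p(2) i j by simp
    ultimately show ?thesis using j k p(2) i by (auto simp: img_def intro: prod_eqI)
  qed
  show "adapted (finv f) (img f ` P)" unfolding adapted_def using pi aff' by blast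
  show "\<And>p. p \<in> P \<Longrightarrow> img (finv f) (img f p) = p" using aff' by blast
qed

lemma W_adapted: "f \<in> W \<Longrightarrow> \<exists>P. adapted f P"
  by (simp add: W_def)

lemma W_inv: assumes "f \<in> W" shows "finv f \<in> W"
proof -
  obtain P where "adapted f P" using W_adapted[OF assms] by blast
  then have "adapted (finv f) (img f ` P)" using adapted_inv assms by blast
  moreover have "finv f t = t" if "\<not> (0 \<le> t \<and> t < l)" for t
    using W_inv_f[OF assms, of t] W_out[OF assms that] by simp
  ultimately show ?thesis unfolding W_def using bij_imp_bij_inv[OF W_bij[OF assms]] by blast
qed

lemma finv_finv: "f \<in> W \<Longrightarrow> finv (finv f) = f"
  using W_bij inv_inv_eq by blast

lemma adapted_sub:
  assumes "adapted f P" "part 0 l R"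
    "\<And>r. r \<in> R \<Longrightarrow> fst r \<in> \<Gamma> \<and> snd r \<in> \<Gamma> \<and> (\<exists>p\<in>P. fst p \<le> fst r \<and> snd r \<le> snd p)"
  shows "adapted f R"
  unfolding adapted_def
proof (intro conjI ballI)
  fix r assume r: "r \<in> R"
  obtain p where p: "p \<in> P" "fst p \<le> fst r" "snd r \<le> snd p" using assms(3)[OF r] by blast
  obtain k where k: "fst p \<in> \<Gamma>" "f (fst p) \<in> \<Gamma>"
    "\<And>t. fst p \<le> t \<Longrightarrow> t < snd p \<Longrightarrow> f t = f (fst p) + pw k * (t - fst p)"
    using adaptedE[OF assms(1) p(1)] by metis
  have lt: "fst r < snd r" using part_less[OF assms(2) r] .
  have fr: "f (fst r) = f (fst p) + pw k * (fst r - fst p)" using k(3)[of "fst r"] p lt by simp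
  show "f (fst r) \<in> \<Gamma>" using fr k assms(3)[OF r] by simp
  have "f t = f (fst r) + pw k * (t - fst r)" if "fst r \<le> t" "t < snd r" for t
    using k(3)[of t] p that fr by (simp add: algebra_simps)
  then show "aff f r" unfolding aff_def by blast
qed (use assms in auto)

lemma adapted_part: "adapted f P \<Longrightarrow> part 0 l P"
  by (simp add: adapted_def)

lemma adapted_ends: "adapted f P \<Longrightarrow> p \<in> P \<Longrightarrow> fst p \<in> \<Gamma> \<and> snd p \<in> \<Gamma>"
  by (simp add: adapted_def)

lemma adapted_meet:
  assumes "adapted f P" "adapted g Q"
  shows "adapted f (meet P Q)" "adapted g (meet P Q)"
proof -
  have m: "part 0 l (meet P Q)" using part_meet assms adapted_part by blast
  have e: "fst r \<in> \<Gamma> \<and> snd r \<in> \<Gamma>" if "r \<in> meet P Q" for r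
    using meet_ends[OF that] adapted_ends[OF assms(1)] adapted_ends[OF assms(2)] by auto
  show "adapted f (meet P Q)" using adapted_sub[OF assms(1) m] e meet_sub(1) by blast
  show "adapted g (meet P Q)" using adapted_sub[OF assms(2) m] e meet_sub(2) by blast
qed

text \<open>The image partition of \<open>f\<close> is refined by a partition for \<open>g\<close>,
  and the refinement is pulled back along \<open>f\<close>.\<close>

lemma common_adapted:
  assumes "f \<in> W" "g \<in> W"
  obtains P where "adapted f P" "adapted g (img f ` P)"
proof -
  obtain P Q where P: "adapted f P" and Q: "adapted g Q" using W_adapted assms by metis
  have P': "adapted (finv f) (img f ` P)" using adapted_inv assms(1) P by blast
  let ?R = "meet (img f ` P) Q"
  have R: "adapted (finv f) ?R" "adapted g ?R" using adapted_meet[OF P' Q] by auto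
  have S: "adapted f (img (finv f) ` ?R)" "\<And>r. r \<in> ?R \<Longrightarrow> img f (img (finv f) r) = r"
    using adapted_inv[OF W_inv[OF assms(1)] R(1)] finv_finv[OF assms(1)] by auto
  have "img f ` img (finv f) ` ?R = ?R" using S(2) by force
  then show ?thesis using that[of "img (finv f) ` ?R"] S R by simp
qed

lemma img_comp:
  assumes "adapted f P" "adapted g (img f ` P)" "p \<in> P"
  shows "img (g \<circ> f) p = img g (img f p)" "aff (g \<circ> f) p"
proof -
  obtain k where k: "fst p < snd p"
    "\<And>t. fst p \<le> t \<Longrightarrow> t < snd p \<Longrightarrow> f t = f (fst p) + pw k * (t - fst p)"
    "img f p = (f (fst p), f (fst p) + pw k * (snd p - fst p))"
    using adaptedE[OF assms(1,3)] by metis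
  have ip: "img f p \<in> img f ` P" using assms(3) by blast
  obtain j where j: "\<And>t. f (fst p) \<le> t \<Longrightarrow> t < snd (img f p) \<Longrightarrow> g t = g (f (fst p)) + pw j * (t - f (fst p))"
    "img g (img f p) = (g (f (fst p)), g (f (fst p)) + pw j * (snd (img f p) - f (fst p)))"
    using adaptedE[OF assms(2) ip] by (metis fst_conv k(3))
  have c: "(g \<circ> f) t = (g \<circ> f) (fst p) + pw (j + k) * (t - fst p)" if "fst p \<le> t" "t < snd p" for t
  proof -
    have "f (fst p) \<le> f t" "f t < snd (img f p)" using that k(2)[OF that] k(3) by auto
    then have "g (f t) = g (f (fst p)) + pw j * (f t - f (fst p))" by (rule j(1))
    moreover have "f t - f (fst p) = pw k * (t - fst p)" using k(2)[OF that] by simp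
    ultimately show ?thesis by (simp add: pw_add)
  qed
  then show "aff (g \<circ> f) p" unfolding aff_def by blast
  have "rt (g \<circ> f) p = (g \<circ> f) (fst p) + pw (j + k) * (snd p - fst p)"
    using rt_eq[of "fst p" "snd p" "g \<circ> f" "pw (j+k)", OF c k(1)] by simp
  then show "img (g \<circ> f) p = img g (img f p)" unfolding j(2) using k(3) by (simp add: img_def pw_add)
qed

lemma comp_adapted:
  assumes "adapted f P" "adapted g (img f ` P)"
  shows "adapted (g \<circ> f) P"
  unfolding adapted_def
proof (intro conjI ballI)
  fix p assume p: "p \<in> P"
  show "aff (g \<circ> f) p" using img_comp[OF assms p] by blast
  have "img f p \<in> img f ` P" using p by blast
  then show "(g \<circ> f) (fst p) \<in> \<Gamma>" using assms(2) unfolding adapted_def by (auto simp: img_def)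
qed (use assms in \<open>auto simp: adapted_def\<close>)

lemma W_comp: assumes "f \<in> W" "g \<in> W" shows "g \<circ> f \<in> W"
proof -
  obtain P where "adapted f P" "adapted g (img f ` P)" using common_adapted[OF assms] .
  then have "adapted (g \<circ> f) P" by (rule comp_adapted)
  then show ?thesis unfolding W_def
    using bij_comp[OF W_bij[OF assms(1)] W_bij[OF assms(2)]] W_out[OF assms(1)] W_out[OF assms(2)] by auto
qed

text \<open>Membership from an unordered set of break points: on a gap between neighbours, comparing
  its ends with the break points decides which affine formula applies.\<close>

lemma W_I:
  assumes "bij f" "\<And>t. \<not> (0 \<le> t \<and> t < l) \<Longrightarrow> f t = t" "finite B" "0 \<in> B" "l \<in> B" "B \<subseteq> {0..l}" "B \<subseteq> \<Gamma>"
    "\<And>p q. p \<in> B \<Longrightarrow> q \<in> B \<Longrightarrow> p < q \<Longrightarrow> (\<And>b. b \<in> B \<Longrightarrow> b \<le> p \<or> q \<le> b) \<Longrightarrow>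
      f p \<in> \<Gamma> \<and> (\<exists>k. \<forall>t. p \<le> t \<longrightarrow> t < q \<longrightarrow> f t = f p + pw k * (t - p))"
  shows "f \<in> W"
proof -
  have "adapted f (brk B)" unfolding adapted_def
  proof (intro conjI ballI)
    show "part 0 l (brk B)" using part_brk assms by blast
  next
    fix p assume "p \<in> brk B"
    then have p: "fst p \<in> B" "snd p \<in> B" "fst p < snd p" "\<And>b. b \<in> B \<Longrightarrow> b \<le> fst p \<or> snd p \<le> b"
      unfolding brk_def by auto
    show "fst p \<in> \<Gamma>" "snd p \<in> \<Gamma>" "f (fst p) \<in> \<Gamma>" "aff f p"
      unfolding aff_def using assms(8)[OF p] p assms(7) by auto
  qed
  then show ?thesis unfolding W_def using assms by blast
qed

lemma W_id: "id \<in> W"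
  by (rule W_I[of _ "{0, l}"]) (use l_pos l_in in \<open>auto intro: exI[of _ 0]\<close>)

section \<open>Rotations and swaps\<close>

definition rot :: "real \<Rightarrow> real \<Rightarrow> real \<Rightarrow> real \<Rightarrow> real" where
  "rot a x y t = (if a \<le> t \<and> t < a + x then t + y else if a + x \<le> t \<and> t < a + x + y then t - x else t)"

text \<open>An exchange of two intervals whose lengths differ by the factor \<open>lam\<close>^k,
  the basic element with non-trivial slopes. For disjoint intervals it is an involution, so it
  serves as its own inverse in conjugations.\<close>

definition swp :: "real \<Rightarrow> real \<Rightarrow> real \<Rightarrow> int \<Rightarrow> real \<Rightarrow> real" where
  "swp a b w k t = (if a \<le> t \<and> t < a + w then b + pw k * (t - a)
     else if b \<le> t \<and> t < b + pw k * w then a + pw (- k) * (t - b) else t)"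

lemma rot_rot: "x \<ge> 0 \<Longrightarrow> y \<ge> 0 \<Longrightarrow> rot a y x (rot a x y t) = t"
  by (auto simp: rot_def)

lemma rot_bij: "x \<ge> 0 \<Longrightarrow> y \<ge> 0 \<Longrightarrow> bij (rot a x y)"
  by (rule o_bij[of "rot a y x"]) (auto simp: rot_rot)

lemma rot_inv: "x \<ge> 0 \<Longrightarrow> y \<ge> 0 \<Longrightarrow> finv (rot a x y) = rot a y x"
  by (rule inv_equality) (auto simp: rot_rot)

lemma rot_W:
  assumes "a \<in> \<Gamma>" "x \<in> \<Gamma>" "y \<in> \<Gamma>" "0 \<le> a" "0 \<le> x" "0 \<le> y" "a + x + y \<le> l"
  shows "rot a x y \<in> W"
proof (rule W_I[of _ "{0, a, a + x, a + x + y, l}"])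
  fix p q assume h: "p \<in> {0, a, a + x, a + x + y, l}" "q \<in> {0, a, a + x, a + x + y, l}" "p < q"
    "\<And>b. b \<in> {0, a, a + x, a + x + y, l} \<Longrightarrow> b \<le> p \<or> q \<le> b"
  have pG: "p \<in> \<Gamma>" using h(1) assms l_in by auto
  have c: "q \<le> a \<or> (a \<le> p \<and> q \<le> a + x) \<or> (a + x \<le> p \<and> q \<le> a + x + y) \<or> a + x + y \<le> p"
    using h(4)[of a] h(4)[of "a+x"] h(4)[of "a+x+y"] by auto
  then consider "q \<le> a \<or> a + x + y \<le> p" | "a \<le> p" "q \<le> a + x" | "a + x \<le> p" "q \<le> a + x + y" by blast
  then obtain d where d: "d \<in> \<Gamma>" "\<And>t. p \<le> t \<Longrightarrow> t < q \<Longrightarrow> rot a x y t = t + d"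
  proof cases
    case 1
    then have "rot a x y t = t + 0" if "p \<le> t" "t < q" for t using that assms by (auto simp: rot_def)
    then show ?thesis using that[of 0] by simp
  next
    case 2
    then have "rot a x y t = t + y" if "p \<le> t" "t < q" for t using that by (auto simp: rot_def)
    then show ?thesis using that[of y] assms by simp
  next
    case 3
    then have "rot a x y t = t + (- x)" if "p \<le> t" "t < q" for t using that by (auto simp: rot_def)
    then show ?thesis using that[of "- x"] assms by simp
  qed
  have p: "rot a x y p = p + d" using d(2)[of p] h(3) by simp
  show "rot a x y p \<in> \<Gamma> \<and> (\<exists>k. \<forall>t. p \<le> t \<longrightarrow> t < q \<longrightarrow> rot a x y t = rot a x y p + pw k * (t - p))"
    using p pG d(1) d(2) by (intro conjI exI[of _ 0]) auto
next
  fix t assume "\<not> (0 \<le> t \<and> t < l)"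
  then show "rot a x y t = t" using assms by (auto simp: rot_def)
next
  show "bij (rot a x y)" using rot_bij assms by blast
qed (use assms l_in l_pos in auto)

definition swp_ok :: "real \<Rightarrow> real \<Rightarrow> real \<Rightarrow> int \<Rightarrow> bool" where
  "swp_ok a b w k \<longleftrightarrow> a \<in> \<Gamma> \<and> b \<in> \<Gamma> \<and> w \<in> \<Gamma> \<and> 0 \<le> a \<and> 0 \<le> b \<and> 0 \<le> w \<and> a + w \<le> l \<and> b + pw k * w \<le> l \<and>
     (a + w \<le> b \<or> b + pw k * w \<le> a)"

lemma swp_1: "a \<le> t \<Longrightarrow> t < a + w \<Longrightarrow> swp a b w k t = b + pw k * (t - a)"
  by (simp add: swp_def)

lemma swp_2:
  assumes "swp_ok a b w k" "b \<le> t" "t < b + pw k * w"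
  shows "swp a b w k t = a + pw (- k) * (t - b)"
  using assms unfolding swp_ok_def by (auto simp: swp_def)

lemma swp_3: "\<not> (a \<le> t \<and> t < a + w) \<Longrightarrow> \<not> (b \<le> t \<and> t < b + pw k * w) \<Longrightarrow> swp a b w k t = t"
  by (simp only: swp_def if_False)

lemma swp_inside1: "a \<le> t \<Longrightarrow> t < a + w \<Longrightarrow> b \<le> b + pw k * (t - a) \<and> b + pw k * (t - a) < b + pw k * w"
  by simp

lemma swp_inside2:
  assumes "b \<le> t" "t < b + pw k * w"
  shows "a \<le> a + pw (- k) * (t - b) \<and> a + pw (- k) * (t - b) < a + w"
proof -
  have "pw (- k) * (t - b) < pw (- k) * (pw k * w)" using assms by (intro mult_strict_left_mono) auto
  then show ?thesis using assms by simp
qed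

lemma swp_swp: assumes "swp_ok a b w k" shows "swp a b w k (swp a b w k t) = t"
proof -
  consider "a \<le> t \<and> t < a + w" | "b \<le> t \<and> t < b + pw k * w" | "\<not> (a \<le> t \<and> t < a + w)" "\<not> (b \<le> t \<and> t < b + pw k * w)"
    by blast
  then show ?thesis
  proof cases
    case 1
    then show ?thesis using swp_1[of a t w b k] swp_2[OF assms] swp_inside1[of a t w b k] by simp
  next
    case 2
    then show ?thesis using swp_2[OF assms, of t] swp_1 swp_inside2[of b t k w a] by simp
  next
    case 3
    from swp_3[OF 3] show ?thesis by simp
  qed
qed

lemma swp_bij: assumes "swp_ok a b w k" shows "bij (swp a b w k)"
proof -
  have "swp a b w k \<circ> swp a b w k = id" by (rule ext) (simp add: swp_swp[OF assms])
  then show ?thesis using o_bij by blast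
qed

lemma swp_inv: "swp_ok a b w k \<Longrightarrow> finv (swp a b w k) = swp a b w k"
  by (rule inv_equality; rule swp_swp)

lemma swp_W:
  assumes ok: "swp_ok a b w k"
  shows "swp a b w k \<in> W"
proof (rule W_I[of _ "{0, a, a + w, b, b + pw k * w, l}"])
  note h0 = ok[unfolded swp_ok_def]
  fix p q assume h: "p \<in> {0, a, a + w, b, b + pw k * w, l}" "q \<in> {0, a, a + w, b, b + pw k * w, l}" "p < q"
    "\<And>z. z \<in> {0, a, a + w, b, b + pw k * w, l} \<Longrightarrow> z \<le> p \<or> q \<le> z"
  have pG: "p \<in> \<Gamma>" using h(1) h0 l_in by auto
  have c: "q \<le> a \<or> (a \<le> p \<and> q \<le> a + w) \<or> a + w \<le> p" "q \<le> b \<or> (b \<le> p \<and> q \<le> b + pw k * w) \<or> b + pw k * w \<le> p"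
    using h(4)[of a] h(4)[of "a+w"] h(4)[of b] h(4)[of "b + pw k * w"] by auto
  then consider "a \<le> p" "q \<le> a + w" | "b \<le> p" "q \<le> b + pw k * w" |
    "q \<le> a \<or> a + w \<le> p" "q \<le> b \<or> b + pw k * w \<le> p" by blast
  then obtain c d j where d: "c \<in> \<Gamma>" "d \<in> \<Gamma>" "\<And>t. p \<le> t \<Longrightarrow> t < q \<Longrightarrow> swp a b w k t = c + pw j * (t - d)"
  proof cases
    case 1
    then have "swp a b w k t = b + pw k * (t - a)" if "p \<le> t" "t < q" for t using swp_1 that by simp
    then show ?thesis using that h0 by blast
  next
    case 2
    then have "swp a b w k t = a + pw (- k) * (t - b)" if "p \<le> t" "t < q" for t using swp_2[OF ok] that by simp
    then show ?thesis using that h0 by blast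
  next
    case 3
    then have "swp a b w k t = 0 + pw 0 * (t - 0)" if "p \<le> t" "t < q" for t using swp_3[of a t w b k] that by auto
    then show ?thesis using that G_0 by blast
  qed
  have p: "swp a b w k p = c + pw j * (p - d)" using d(3)[of p] h(3) by simp
  show "swp a b w k p \<in> \<Gamma> \<and> (\<exists>j. \<forall>t. p \<le> t \<longrightarrow> t < q \<longrightarrow> swp a b w k t = swp a b w k p + pw j * (t - p))"
  proof (intro conjI exI[of _ j] allI impI)
    show "swp a b w k p \<in> \<Gamma>" unfolding p using d pG by simp
    fix t assume "p \<le> t" "t < q"
    then show "swp a b w k t = swp a b w k p + pw j * (t - p)" unfolding p using d(3)[of t] by (simp add: algebra_simps)
  qed
next
  fix t assume "\<not> (0 \<le> t \<and> t < l)"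
  then show "swp a b w k t = t" using ok swp_3[of a t w b k] unfolding swp_ok_def by auto
next
  note h = ok[unfolded swp_ok_def]
  have "0 \<le> pw k * w" using h by simp
  then have "b \<le> l" using h by linarith
  then show "{0, a, a + w, b, b + pw k * w, l} \<subseteq> {0..l}" using h l_pos \<open>0 \<le> pw k * w\<close> \<open>b \<le> l\<close> by auto
qed (use ok[unfolded swp_ok_def] l_in l_pos swp_bij[OF ok] in auto)

text \<open>The swap carries the support of the rotation affinely to the interval at b and takes the
  rotation along. A rotation can thus change place and scale within its conjugacy class.\<close>

lemma swp_conj_rot:
  assumes ok: "swp_ok a b (x + y) k" and xy: "0 \<le> x" "0 \<le> y"
  shows "swp a b (x + y) k \<circ> rot a x y \<circ> swp a b (x + y) k = rot b (pw k * x) (pw k * y)"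
proof
  let ?s = "swp a b (x + y) k"
  fix t
  consider "a \<le> t \<and> t < a + (x + y)" | "b \<le> t \<and> t < b + pw k * (x + y)"
    | "\<not> (a \<le> t \<and> t < a + (x + y))" "\<not> (b \<le> t \<and> t < b + pw k * (x + y))"
    by blast
  then show "(?s \<circ> rot a x y \<circ> ?s) t = rot b (pw k * x) (pw k * y) t"
  proof cases
    case 1
    define u where "u = ?s t"
    have u: "u = b + pw k * (t - a)" using 1 swp_1 by (simp add: u_def)
    have ub: "b \<le> u \<and> u < b + pw k * (x + y)" using swp_inside1[of a t "x + y" b k] 1 u by simp
    have r: "rot a x y u = u" using ub ok xy unfolding swp_ok_def rot_def by auto
    have "0 \<le> pw k * x" "0 \<le> pw k * y" "pw k * (x + y) = pw k * x + pw k * y" using xy by (auto simp: algebra_simps)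
    then have r2: "rot b (pw k * x) (pw k * y) t = t" using 1 ok unfolding swp_ok_def rot_def by auto
    show ?thesis using r r2 swp_swp[OF ok, of t] by (simp add: u_def)
  next
    case 2
    define u where "u = a + pw (- k) * (t - b)"
    have su: "?s t = u" using 2 swp_2[OF ok, of t] by (simp add: u_def)
    have ub: "a \<le> u \<and> u < a + (x + y)" using swp_inside2[of b t k "x + y" a] 2 u_def by simp
    have tu: "t = b + pw k * (u - a)" by (simp add: u_def)
    show ?thesis
    proof (cases "u < a + x")
      case True
      then have r1: "rot a x y u = u + y" using ub by (simp add: rot_def)
      have r2: "?s (u + y) = b + pw k * (u + y - a)" using swp_1 True ub xy by simp
      have r3: "rot b (pw k * x) (pw k * y) t = t + pw k * y"
        using ub True tu by (simp add: rot_def)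
      have "b + pw k * (u + y - a) = t + pw k * y" by (subst tu) (simp add: algebra_simps)
      then show ?thesis by (simp only: o_apply su r1 r2 r3)
    next
      case False
      then have r1: "rot a x y u = u - x" using ub by (simp add: rot_def)
      have r2: "?s (u - x) = b + pw k * (u - x - a)" using swp_1 False ub xy by simp
      have "pw k * x \<le> pw k * (u - a)" using False by (intro mult_left_mono) auto
      then have "b + pw k * x \<le> t" using tu by linarith
      moreover have "t < b + pw k * x + pw k * y" using 2 by (simp add: algebra_simps)
      ultimately have r3: "rot b (pw k * x) (pw k * y) t = t - pw k * x" by (simp add: rot_def)
      have "b + pw k * (u - x - a) = t - pw k * x" by (subst tu) (simp add: algebra_simps)
      then show ?thesis by (simp only: o_apply su r1 r2 r3)
    qed
  next
    case 3
    from swp_3[OF 3] have "?s t = t" .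
    moreover have "rot a x y t = t" using 3 xy by (auto simp: rot_def)
    moreover have "0 \<le> pw k * x" "0 \<le> pw k * y" "pw k * (x + y) = pw k * x + pw k * y"
      using xy by (auto simp: algebra_simps)
    then have "rot b (pw k * x) (pw k * y) t = t" using 3 unfolding rot_def by auto
    ultimately show ?thesis by simp
  qed
qed

text \<open>The interval of length x passes the two others one after the other. This is the source
  of additivity in the second length.\<close>

lemma rot_split: "x \<ge> 0 \<Longrightarrow> y1 \<ge> 0 \<Longrightarrow> y2 \<ge> 0 \<Longrightarrow> rot a x (y1 + y2) = rot (a + y1) x y2 \<circ> rot a x y1"
  by (rule ext) (auto simp: rot_def)

text \<open>Conjugating by the swap of \<open>[b, b + \<lambda>\<^sup>k w)\<close> with \<open>[c, c + w)\<close> removes the slope.\<close>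
lemma swp_conj_swp:
  assumes ok: "swp_ok a b w k" and ok': "swp_ok c b w k" and d: "a + w \<le> c \<or> c + w \<le> a"
  shows "swp c b w k \<circ> swp a b w k \<circ> swp c b w k = swp a c w 0"
proof
  let ?h = "swp c b w k" and ?s = "swp a b w k"
  fix t
  have dis: "a + w \<le> b \<or> b + pw k * w \<le> a" "c + w \<le> b \<or> b + pw k * w \<le> c" "0 \<le> w"
    using ok ok' unfolding swp_ok_def by auto
  consider "a \<le> t \<and> t < a + w" | "b \<le> t \<and> t < b + pw k * w" | "c \<le> t \<and> t < c + w"
    | "\<not> (a \<le> t \<and> t < a + w)" "\<not> (b \<le> t \<and> t < b + pw k * w)" "\<not> (c \<le> t \<and> t < c + w)"
    by blast
  then show "(?h \<circ> ?s \<circ> ?h) t = swp a c w 0 t"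
  proof cases
    case 1
    have "?h t = t" by (rule swp_3) (use 1 dis d in auto)
    moreover have "?s t = b + pw k * (t - a)" using 1 swp_1 by simp
    moreover have "?h (b + pw k * (t - a)) = c + pw (- k) * (b + pw k * (t - a) - b)"
      using swp_inside1[of a t w b k] 1 by (intro swp_2[OF ok']) auto
    moreover have "swp a c w 0 t = c + pw 0 * (t - a)" using 1 swp_1 by simp
    ultimately show ?thesis by simp
  next
    case 2
    define u where "u = c + pw (- k) * (t - b)"
    have hu: "?h t = u" using swp_2[OF ok', of t] 2 by (simp add: u_def)
    have u: "c \<le> u \<and> u < c + w" using swp_inside2[of b t k w c] 2 u_def by simp
    have "?s u = u" by (rule swp_3) (use u dis d in auto)
    moreover have "swp a c w 0 t = t" by (rule swp_3) (use 2 dis d in auto)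
    ultimately show ?thesis using hu swp_swp[OF ok', of t] by simp
  next
    case 3
    define u where "u = b + pw k * (t - c)"
    have hu: "?h t = u" using swp_1 3 by (simp add: u_def)
    have u: "b \<le> u \<and> u < b + pw k * w" using swp_inside1[of c t w b k] 3 u_def by simp
    have su: "?s u = a + (t - c)" using swp_2[OF ok, of u] u by (simp add: u_def)
    have "?h (a + (t - c)) = a + (t - c)" by (rule swp_3) (use 3 dis d in auto)
    moreover have "swp a c w 0 t = a + pw (- 0) * (t - c)"
      by (rule swp_2) (use 3 ok ok' d in \<open>auto simp: swp_ok_def\<close>)
    ultimately show ?thesis using hu su by simp
  next
    case 4
    then have "?h t = t" "?s t = t" using swp_3 by blast+
    moreover have "swp a c w 0 t = t" by (rule swp_3) (use 4 in auto)
    ultimately show ?thesis by simp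
  qed
qed

section \<open>Germs of slopes\<close>

text \<open>The exponent of the slope immediately to the right of t. Exponents add under composition
  pointwise, so slopes can be followed through products without choosing partitions.\<close>

definition germ :: "(real \<Rightarrow> real) \<Rightarrow> real \<Rightarrow> int \<Rightarrow> bool" where
  "germ f t k \<longleftrightarrow> (\<exists>v>t. \<forall>u. t \<le> u \<longrightarrow> u < v \<longrightarrow> f u = f t + pw k * (u - t))"

lemma germ_unique: assumes "germ f t j" "germ f t k" shows "j = k"
proof -
  obtain v where v: "v > t" "\<And>u. t \<le> u \<Longrightarrow> u < v \<Longrightarrow> f u = f t + pw j * (u - t)"
    using assms(1) unfolding germ_def by blast
  obtain w where w: "w > t" "\<And>u. t \<le> u \<Longrightarrow> u < w \<Longrightarrow> f u = f t + pw k * (u - t)"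
    using assms(2) unfolding germ_def by blast
  define u where "u = (t + min v w) / 2"
  have "u > t" "u < v" "u < w" using v(1) w(1) by (auto simp: u_def min_def)
  then have "pw j * (u - t) = pw k * (u - t)" using v(2)[of u] w(2)[of u] by simp
  then show ?thesis using \<open>u > t\<close> pw_inj by simp
qed

lemma germI:
  assumes "\<And>t. a \<le> t \<Longrightarrow> t < b \<Longrightarrow> f t = f a + pw k * (t - a)" "a \<le> t" "t < b"
  shows "germ f t k"
  unfolding germ_def
proof (intro exI[of _ b] conjI allI impI)
  fix u assume "t \<le> u" "u < b"
  then show "f u = f t + pw k * (u - t)" using assms(1)[of u] assms(1)[of t] assms(2,3) by (simp add: algebra_simps)
qed (use assms in auto)

lemma germI':
  assumes "\<And>t. a \<le> t \<Longrightarrow> t < b \<Longrightarrow> f t = c + pw k * (t - a)" "a \<le> t" "t < b"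
  shows "germ f t k"
proof (rule germI[OF _ assms(2,3)])
  have "f a = c" using assms(1)[of a] assms(2,3) by simp
  then show "\<And>t. a \<le> t \<Longrightarrow> t < b \<Longrightarrow> f t = f a + pw k * (t - a)" using assms(1) by simp
qed

lemma germ_comp: assumes "germ f t k" "germ g (f t) j" shows "germ (g \<circ> f) t (k + j)"
proof -
  obtain v where v: "v > t" "\<And>u. t \<le> u \<Longrightarrow> u < v \<Longrightarrow> f u = f t + pw k * (u - t)"
    using assms(1) unfolding germ_def by blast
  obtain w where w: "w > f t" "\<And>u. f t \<le> u \<Longrightarrow> u < w \<Longrightarrow> g u = g (f t) + pw j * (u - f t)"
    using assms(2) unfolding germ_def by blast
  \<comment> \<open>Short enough that \<open>f\<close> keeps [t, z) inside the interval on which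
    \<open>g\<close> is affine.\<close>
  define z where "z = min v (t + pw (- k) * (w - f t))"
  show ?thesis unfolding germ_def
  proof (intro exI[of _ z] conjI allI impI)
    show "z > t" using v(1) w(1) by (simp add: z_def)
    fix u assume u: "t \<le> u" "u < z"
    have fu: "f u = f t + pw k * (u - t)" by (rule v(2)) (use u in \<open>auto simp: z_def\<close>)
    have "pw k * (u - t) < pw k * (pw (- k) * (w - f t))" using u by (intro mult_strict_left_mono) (auto simp: z_def)
    then have "f u < w" using fu by simp
    then show "(g \<circ> f) u = (g \<circ> f) t + pw (k + j) * (u - t)" using w(2)[of "f u"] fu u by (simp add: pw_add)
  qed
qed

lemma germ_inv: assumes "bij f" "germ f t k" shows "germ (finv f) (f t) (- k)"
proof -
  obtain v where v: "v > t" "\<And>u. t \<le> u \<Longrightarrow> u < v \<Longrightarrow> f u = f t + pw k * (u - t)"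
    using assms(2) unfolding germ_def by blast
  show ?thesis unfolding germ_def
  proof (intro exI[of _ "f t + pw k * (v - t)"] conjI allI impI)
    show "f t + pw k * (v - t) > f t" using v(1) by simp
    fix u assume u: "f t \<le> u" "u < f t + pw k * (v - t)"
    define s where "s = t + pw (- k) * (u - f t)"
    have "pw (- k) * (u - f t) < pw (- k) * (pw k * (v - t))" using u by (intro mult_strict_left_mono) auto
    then have "t \<le> s" "s < v" using u by (auto simp: s_def)
    then have "f s = u" using v(2)[of s] by (simp add: s_def)
    then have "finv f u = s" using assms(1) by (metis bij_is_inj inv_f_f)
    then show "finv f u = finv f (f t) + pw (- k) * (u - f t)" using assms(1) by (simp add: s_def bij_is_inj)
  qed
qed

lemma germ_out: assumes "f \<in> W" "\<not> (0 \<le> t \<and> t < l)" shows "germ f t 0"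
proof (cases "t < 0")
  case True
  show ?thesis by (rule germI'[of t 0 _ t]) (use True W_out[OF assms(1)] in auto)
next
  case False
  show ?thesis by (rule germI'[of t "t + 1" _ t]) (use False assms(2) W_out[OF assms(1)] in auto)
qed

lemma W_germ: assumes "f \<in> W" shows "\<exists>k. germ f t k"
proof (cases "0 \<le> t \<and> t < l")
  case True
  obtain P where P: "adapted f P" using W_adapted assms by blast
  then obtain p where p: "p \<in> P" "fst p \<le> t" "t < snd p" using part_cover[OF adapted_part] True by metis
  obtain k where "\<And>t. fst p \<le> t \<Longrightarrow> t < snd p \<Longrightarrow> f t = f (fst p) + pw k * (t - fst p)"
    using adaptedE[OF P p(1)] by metis
  then show ?thesis using germI[of "fst p" "snd p" f k t] p by blast
qed (use germ_out[OF assms] in blast)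

lemma germ_rot:
  assumes "0 \<le> x" "0 \<le> y" shows "germ (rot a x y) t 0"
proof -
  consider "t < a" | "a \<le> t" "t < a + x" | "a + x \<le> t" "t < a + x + y" | "a + x + y \<le> t" by linarith
  then show ?thesis
  proof cases
    case 1 then show ?thesis using assms by (intro germI'[of t a _ t]) (auto simp: rot_def)
  next
    case 2 then show ?thesis by (intro germI'[of a "a + x" _ "a + y"]) (auto simp: rot_def)
  next
    case 3 then show ?thesis by (intro germI'[of "a + x" "a + x + y" _ "a"]) (auto simp: rot_def)
  next
    case 4 then show ?thesis using assms by (intro germI'[of t "t + 1" _ "t"]) (auto simp: rot_def)
  qed
qed

lemma germ_swp1: "a \<le> t \<Longrightarrow> t < a + w \<Longrightarrow> germ (swp a b w k) t k"
  by (rule germI'[of a "a + w" _ b]) (auto simp: swp_1)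

lemma germ_swp2: "swp_ok a b w k \<Longrightarrow> b \<le> t \<Longrightarrow> t < b + pw k * w \<Longrightarrow> germ (swp a b w k) t (- k)"
  by (rule germI'[of b "b + pw k * w" _ a]) (auto simp: swp_2)

lemma germ_fix:
  assumes "f \<in> W" "a \<le> t" "t < b" "\<And>u. a \<le> u \<Longrightarrow> u < b \<Longrightarrow> f u = u"
  shows "germ f t 0"
  by (rule germI'[of a b _ a]) (use assms in auto)

lemma germ_swp3:
  assumes "swp_ok a b w k" "\<not> (a \<le> t \<and> t < a + w)" "\<not> (b \<le> t \<and> t < b + pw k * w)"
  shows "germ (swp a b w k) t 0"
proof -
  \<comment> \<open>As t lies outside both half-open intervals, only a left end ahead of t can
    change the map; t + 1 is the default when there is none.\<close>
  define v where "v = Min ({t + 1} \<union> {z \<in> {a, b}. z > t})"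
  have v: "v > t" "z \<in> {a, b} \<Longrightarrow> z > t \<Longrightarrow> v \<le> z" for z unfolding v_def by auto
  have o: "swp a b w k u = u" if "t \<le> u" "u < v" for u
  proof (rule swp_3)
    show "\<not> (a \<le> u \<and> u < a + w)" using that assms(2) v(2)[of a] by auto
    show "\<not> (b \<le> u \<and> u < b + pw k * w)" using that assms(3) v(2)[of b] by auto
  qed
  show ?thesis by (rule germI'[of t v _ t]) (use v o in auto)
qed

end

section \<open>Homomorphisms to commutative groups\<close>

text \<open>The calculus of rotations and the generation theorem are proved for an arbitrary
  homomorphism to a commutative group and later applied to the class map of the abelianisation.
  Conjugation acts trivially on values, so commutators never appear explicitly.\<close>

locale pl_hom = pl lam l + A: comm_group A
  for lam l :: real and A :: "('g, 'm) monoid_scheme" (structure) +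
  fixes \<phi> :: "(real \<Rightarrow> real) \<Rightarrow> 'g"
  assumes phi_closed [simp]: "f \<in> W \<Longrightarrow> \<phi> f \<in> carrier A"
    and phi_mult: "f \<in> W \<Longrightarrow> g \<in> W \<Longrightarrow> \<phi> (f \<circ> g) = \<phi> f \<otimes> \<phi> g"
begin

lemma idem: "a \<in> carrier A \<Longrightarrow> a \<otimes> a = a \<Longrightarrow> a = \<one>"
  using A.l_cancel_one[of a a] by simp

lemma phi_id: "\<phi> id = \<one>"
  using phi_mult[OF W_id W_id] phi_closed[OF W_id] by (intro idem) simp_all

lemma finv_comp: assumes "f \<in> W" shows "finv f \<circ> f = id" "f \<circ> finv f = id"
  using W_inv_f[OF assms] W_f_inv[OF assms] by (auto simp: fun_eq_iff)

lemma phi_inv: assumes "f \<in> W" shows "\<phi> (finv f) = inv (\<phi> f)"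
proof -
  have "\<phi> (finv f) \<otimes> \<phi> f = \<one>"
    using phi_mult[OF W_inv[OF assms] assms] finv_comp[OF assms] phi_id by simp
  then show ?thesis using A.inv_equality[of "\<phi> (finv f)" "\<phi> f"] assms W_inv by simp
qed

lemma phi_conj: assumes "f \<in> W" "h \<in> W" shows "\<phi> (h \<circ> f \<circ> finv h) = \<phi> f"
proof -
  have "\<phi> (h \<circ> f \<circ> finv h) = \<phi> h \<otimes> \<phi> f \<otimes> inv (\<phi> h)"
    using assms by (simp add: phi_mult phi_inv W_inv W_comp)
  also have "\<dots> = \<phi> f \<otimes> (\<phi> h \<otimes> inv (\<phi> h))"
    using assms by (metis A.inv_closed A.m_assoc A.m_comm phi_closed)
  finally show ?thesis using assms by simp
qed

lemma phi_conj_swp: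
  assumes "f \<in> W" "swp_ok a b w k"
  shows "\<phi> (swp a b w k \<circ> f \<circ> swp a b w k) = \<phi> f"
  using phi_conj[OF assms(1) swp_W[OF assms(2)]] swp_inv[OF assms(2)] by simp

section \<open>The pairing of lengths given by rotations\<close>

definition rok :: "real \<Rightarrow> real \<Rightarrow> real \<Rightarrow> bool" where
  "rok a x y \<longleftrightarrow> a \<in> \<Gamma> \<and> x \<in> \<Gamma> \<and> y \<in> \<Gamma> \<and> 0 \<le> a \<and> 0 \<le> x \<and> 0 \<le> y \<and> a + x + y \<le> l"

lemma rok_W: "rok a x y \<Longrightarrow> rot a x y \<in> W"
  unfolding rok_def by (intro rot_W) auto

lemma phi_rot_closed [simp]: "rok a x y \<Longrightarrow> \<phi> (rot a x y) \<in> carrier A"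
  using rok_W by simp

lemma rot_move:
  assumes "rok a x y" "swp_ok a b (x + y) k"
  shows "\<phi> (rot a x y) = \<phi> (rot b (pw k * x) (pw k * y))"
  using phi_conj_swp[OF rok_W[OF assms(1)] assms(2)] swp_conj_rot[OF assms(2)] assms(1)
  unfolding rok_def by simp

text \<open>A rotation that leaves one end of \<open>[0, l)\<close> free can be moved there and shrunk.\<close>
lemma rot_shrink:
  assumes r: "rok a x y" and pr: "a + x + y < l \<or> 0 < a"
  shows "\<exists>e>0. \<forall>k. pw k * (x + y) < e \<longrightarrow> \<phi> (rot a x y) = \<phi> (rot 0 (pw k * x) (pw k * y))"
proof (cases "a + x + y < l")
  case True
  \<comment> \<open>The first bound leaves room for a copy at the right end; the bound l / 2 keeps
    that copy disjoint from one at 0, to which a second swap moves it.\<close>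
  define e where "e = min (l - (a + x + y)) (l / 2)"
  have "e > 0" using True l_pos by (simp add: e_def)
  moreover have "\<phi> (rot a x y) = \<phi> (rot 0 (pw k * x) (pw k * y))" if k: "pw k * (x + y) < e" for k
  proof -
    define d where "d = pw k * (x + y)"
    have d: "0 \<le> d" "d < l - (a + x + y)" "d < l / 2" "d \<in> \<Gamma>" "d = pw k * x + pw k * y"
      using k r unfolding rok_def by (auto simp: d_def e_def distrib_left)
    have "swp_ok a (l - d) (x + y) k" using r d(1,2,4) l_in unfolding rok_def swp_ok_def d_def[symmetric] by auto
    then have 1: "\<phi> (rot a x y) = \<phi> (rot (l - d) (pw k * x) (pw k * y))" using rot_move r by blast
    have "swp_ok 0 (l - d) (pw k * x + pw k * y) 0"
      using d(1,3,4) l_in unfolding swp_ok_def d(5)[symmetric] by simp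
    moreover have "rok 0 (pw k * x) (pw k * y)" using r d unfolding rok_def by auto
    ultimately have "\<phi> (rot 0 (pw k * x) (pw k * y)) = \<phi> (rot (l - d) (pw k * x) (pw k * y))"
      using rot_move[of 0 "pw k * x" "pw k * y" "l - d" 0] by simp
    then show ?thesis using 1 by simp
  qed
  ultimately show ?thesis by blast
next
  case False
  then have a: "0 < a" using pr by simp
  have "\<phi> (rot a x y) = \<phi> (rot 0 (pw k * x) (pw k * y))" if k: "pw k * (x + y) < a" for k
  proof -
    have "swp_ok a 0 (x + y) k" using r k unfolding rok_def swp_ok_def by auto
    then show ?thesis using rot_move r by blast
  qed
  then show ?thesis using a by blast
qed

text \<open>Both rotations have the value of one common small rotation at 0.\<close>

lemma rot_scale_indep:
  assumes "rok a x y" "a + x + y < l \<or> 0 < a"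
    "rok b (pw j * x) (pw j * y)" "b + pw j * x + pw j * y < l \<or> 0 < b"
  shows "\<phi> (rot a x y) = \<phi> (rot b (pw j * x) (pw j * y))"
proof -
  obtain e where e: "e > 0" "\<And>k. pw k * (x + y) < e \<Longrightarrow> \<phi> (rot a x y) = \<phi> (rot 0 (pw k * x) (pw k * y))"
    using rot_shrink[OF assms(1,2)] by blast
  obtain e' where e': "e' > 0" "\<And>k. pw k * (pw j * x + pw j * y) < e' \<Longrightarrow>
      \<phi> (rot b (pw j * x) (pw j * y)) = \<phi> (rot 0 (pw k * (pw j * x)) (pw k * (pw j * y)))"
    using rot_shrink[OF assms(3,4)] by blast
  have "0 \<le> x + y" using assms(1) unfolding rok_def by simp
  then obtain k where k: "pw k * (x + y) < min e e'" using pw_small_mult[of "min e e'" "x + y"] e(1) e'(1) by auto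
  have c: "pw (k - j) * (pw j * z) = pw k * z" for z
    using pw_add[of "k - j" j] by (simp add: mult.assoc[symmetric])
  have "pw (k - j) * (pw j * x + pw j * y) = pw k * (x + y)" by (simp add: distrib_left c)
  then show ?thesis using e(2)[of k] e'(2)[of "k - j"] k by (simp add: c)
qed

text \<open>The value of a rotation with lengths of any size, both scaled down until it fits with
  room to spare. By \<open>rho_eq\<close> the exponent and the position are immaterial.\<close>

definition rho :: "real \<Rightarrow> real \<Rightarrow> 'g" where
  "rho x y = (let k = (SOME k. pw k * (x + y) < l) in \<phi> (rot 0 (pw k * x) (pw k * y)))"

definition pos :: "real \<Rightarrow> bool" where "pos x \<longleftrightarrow> x \<in> \<Gamma> \<and> 0 \<le> x"

lemma pos_add [simp]: "pos x \<Longrightarrow> pos y \<Longrightarrow> pos (x + y)" by (simp add: pos_def)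
lemma pos_scale [simp]: "pos x \<Longrightarrow> pos (pw k * x)" by (simp add: pos_def)
lemma pos_pw [simp]: "pos (pw k)" by (simp add: pos_def)
lemma pos_0 [simp]: "pos 0" and pos_1 [simp]: "pos 1" by (simp_all add: pos_def)
lemma pos_G: "pos x \<Longrightarrow> x \<in> \<Gamma>" by (simp add: pos_def)

lemma rok_0: "pos x \<Longrightarrow> pos y \<Longrightarrow> pw k * (x + y) < l \<Longrightarrow> rok 0 (pw k * x) (pw k * y)"
  unfolding rok_def pos_def by (auto simp: distrib_left)

lemma rho_eq:
  assumes "pos x" "pos y" "rok a (pw j * x) (pw j * y)" "a + pw j * x + pw j * y < l \<or> 0 < a"
  shows "\<phi> (rot a (pw j * x) (pw j * y)) = rho x y"
proof -
  have "0 \<le> x + y" using assms unfolding pos_def by simp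
  then have "\<exists>k. pw k * (x + y) < l" using pw_small_mult[OF l_pos] by blast
  then have k: "pw (SOME k. pw k * (x + y) < l) * (x + y) < l" by (rule someI_ex)
  define k where "k = (SOME k. pw k * (x + y) < l)"
  have k: "pw k * (x + y) < l" using k by (simp add: k_def)
  have c: "pw (k - j) * (pw j * z) = pw k * z" for z
    using pw_add[of "k - j" j] by (simp add: mult.assoc[symmetric])
  have "rok 0 (pw k * x) (pw k * y)" using rok_0 assms k by simp
  moreover have "0 + pw k * x + pw k * y < l" using k by (simp add: algebra_simps)
  ultimately have "\<phi> (rot a (pw j * x) (pw j * y)) = \<phi> (rot 0 (pw k * x) (pw k * y))"
    using rot_scale_indep[OF assms(3,4), of 0 "k - j"] by (simp add: c)
  then show ?thesis by (simp add: rho_def k_def Let_def)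
qed

lemma rho_eq_0:
  assumes "pos x" "pos y" "pw k * (x + y) < l"
  shows "\<phi> (rot 0 (pw k * x) (pw k * y)) = rho x y"
  using assms rok_0 by (intro rho_eq) (auto simp: algebra_simps)

lemma pos_small: "pos x \<Longrightarrow> \<exists>k. pw k * x < l"
  using pw_small_mult[OF l_pos] unfolding pos_def by blast

lemma rho_closed [simp]: assumes "pos x" "pos y" shows "rho x y \<in> carrier A"
proof -
  obtain k where "pw k * (x + y) < l" using pos_small[of "x + y"] assms by auto
  then show ?thesis using rho_eq_0[OF assms] rok_0[OF assms] phi_rot_closed by metis
qed

lemma rho_add2:
  assumes "pos x" "pos y" "pos z"
  shows "rho x (y + z) = rho x y \<otimes> rho x z"
proof -
  obtain k where k: "pw k * (x + (y + z)) < l" using pos_small[of "x + (y + z)"] assms by auto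
  let ?X = "pw k * x" and ?Y = "pw k * y" and ?Z = "pw k * z"
  have le: "0 \<le> ?X" "0 \<le> ?Y" "0 \<le> ?Z" "?X + ?Y + ?Z < l" "?X \<in> \<Gamma>" "?Y \<in> \<Gamma>" "?Z \<in> \<Gamma>"
    using assms k unfolding pos_def by (auto simp: distrib_left)
  have r: "rok 0 ?X ?Y" "rok ?Y ?X ?Z" "rok 0 ?X (?Y + ?Z)" using le unfolding rok_def by auto
  have "rho x (y + z) = \<phi> (rot 0 ?X (?Y + ?Z))"
    using rho_eq_0[OF assms(1) pos_add[OF assms(2,3)] k] by (simp add: algebra_simps)
  also have "rot 0 ?X (?Y + ?Z) = rot ?Y ?X ?Z \<circ> rot 0 ?X ?Y" using rot_split[of ?X ?Y ?Z 0] le by simp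
  also have "\<phi> \<dots> = \<phi> (rot ?Y ?X ?Z) \<otimes> \<phi> (rot 0 ?X ?Y)" using phi_mult r rok_W by blast
  also have "\<phi> (rot ?Y ?X ?Z) = rho x z" by (rule rho_eq) (use assms r le in auto)
  also have "\<phi> (rot 0 ?X ?Y) = rho x y" by (rule rho_eq) (use assms r le in auto)
  finally show ?thesis using assms by (simp add: A.m_comm)
qed

lemma rho_swap:
  assumes "pos x" "pos y"
  shows "rho y x = inv (rho x y)"
proof -
  obtain k where k: "pw k * (x + y) < l" using pos_small[of "x + y"] assms by auto
  let ?X = "pw k * x" and ?Y = "pw k * y"
  have r: "rok 0 ?X ?Y" using rok_0 assms k by blast
  have le: "0 \<le> ?X" "0 \<le> ?Y" using r unfolding rok_def by auto
  have "rho y x = \<phi> (rot 0 ?Y ?X)" using rho_eq_0[OF assms(2,1)] k by (simp add: add.commute)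
  also have "rot 0 ?Y ?X = finv (rot 0 ?X ?Y)" using rot_inv le by simp
  also have "\<phi> \<dots> = inv (\<phi> (rot 0 ?X ?Y))" using phi_inv r rok_W by blast
  finally show ?thesis using rho_eq_0[OF assms k] by simp
qed

lemma rho_add1:
  assumes "pos x" "pos y" "pos z"
  shows "rho (x + y) z = rho x z \<otimes> rho y z"
  using assms rho_swap[of z "x + y"] rho_swap[of z x] rho_swap[of z y] rho_add2[of z x y]
  by (simp add: A.inv_mult)

lemma rho_scale:
  assumes "pos x" "pos y"
  shows "rho (pw j * x) (pw j * y) = rho x y"
proof -
  obtain k where k: "pw k * (pw j * x + pw j * y) < l"
    using pos_small[of "pw j * x + pw j * y"] assms by auto
  have "rho (pw j * x) (pw j * y) = \<phi> (rot 0 (pw (k + j) * x) (pw (k + j) * y))"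
    using rho_eq_0[OF _ _ k] assms by (simp add: pw_add mult.assoc)
  also have "\<dots> = rho x y" using rho_eq_0[OF assms, of "k + j"] k by (simp add: pw_add algebra_simps)
  finally show ?thesis .
qed

text \<open>Extension from the positive cone to \<open>\<Gamma>\<close> through differences, since
  lengths are non-negative but the relations are linear.\<close>

definition ex :: "(real \<Rightarrow> 'g) \<Rightarrow> real \<Rightarrow> 'g" where
  "ex g y = g (max y 0) \<otimes> inv (g (max (- y) 0))"

definition padd :: "(real \<Rightarrow> 'g) \<Rightarrow> bool" where
  "padd g \<longleftrightarrow> (\<forall>x. pos x \<longrightarrow> g x \<in> carrier A) \<and> (\<forall>x y. pos x \<longrightarrow> pos y \<longrightarrow> g (x + y) = g x \<otimes> g y)"

definition hadd :: "(real \<Rightarrow> 'g) \<Rightarrow> bool" where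
  "hadd h \<longleftrightarrow> (\<forall>x\<in>\<Gamma>. h x \<in> carrier A) \<and> (\<forall>x\<in>\<Gamma>. \<forall>y\<in>\<Gamma>. h (x + y) = h x \<otimes> h y)"

lemma ex_diff:
  assumes g: "padd g" and u: "pos u" and v: "pos v"
  shows "ex g (u - v) = g u \<otimes> inv (g v)"
proof -
  let ?p = "max (u - v) 0" and ?n = "max (- (u - v)) 0"
  have pn: "pos ?p" "pos ?n" using u v by (auto simp: pos_def max_def)
  have "u + ?n = v + ?p" by auto
  then have e: "g u \<otimes> g ?n = g v \<otimes> g ?p" using g u v pn unfolding padd_def by metis
  have c: "g u \<in> carrier A" "g v \<in> carrier A" "g ?p \<in> carrier A" "g ?n \<in> carrier A"
    using g u v pn unfolding padd_def by auto
  have "g ?p \<otimes> inv (g ?n) = inv (g v) \<otimes> (g v \<otimes> g ?p) \<otimes> inv (g ?n)"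
    using c by (simp add: A.m_assoc[symmetric])
  also have "\<dots> = inv (g v) \<otimes> (g u \<otimes> g ?n) \<otimes> inv (g ?n)" by (simp only: e)
  also have "\<dots> = inv (g v) \<otimes> g u" using c by (simp add: A.m_assoc)
  also have "\<dots> = g u \<otimes> inv (g v)" using c by (simp add: A.m_comm)
  finally show ?thesis by (simp add: ex_def)
qed

lemma G_decomp: "y \<in> \<Gamma> \<Longrightarrow> pos (max y 0) \<and> pos (max (- y) 0) \<and> y = max y 0 - max (- y) 0"
  by (auto simp: pos_def max_def)

lemma ex_hadd: assumes g: "padd g" shows "hadd (ex g)"
proof -
  have c: "ex g x \<in> carrier A" if "x \<in> \<Gamma>" for x
    using G_decomp[OF that] g unfolding ex_def padd_def by auto
  have "ex g (x + y) = ex g x \<otimes> ex g y" if x: "x \<in> \<Gamma>" and y: "y \<in> \<Gamma>" for x y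
  proof -
    let ?a = "max x 0" and ?b = "max (- x) 0" and ?c = "max y 0" and ?d = "max (- y) 0"
    have p: "pos ?a" "pos ?b" "pos ?c" "pos ?d" using G_decomp x y by auto
    have "ex g (x + y) = ex g ((?a + ?c) - (?b + ?d))" by (rule arg_cong[of _ _ "ex g"]) auto
    also have "\<dots> = g (?a + ?c) \<otimes> inv (g (?b + ?d))" using ex_diff g p by simp
    also have "\<dots> = (g ?a \<otimes> g ?c) \<otimes> (inv (g ?b) \<otimes> inv (g ?d))"
      using g p unfolding padd_def by (simp add: A.inv_mult)
    also have "\<dots> = (g ?a \<otimes> inv (g ?b)) \<otimes> (g ?c \<otimes> inv (g ?d))"
      using g p unfolding padd_def by (simp add: A.m_ac)
    finally show ?thesis by (simp add: ex_def)
  qed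
  then show ?thesis using c unfolding hadd_def by blast
qed

lemma padd_0: assumes "padd g" shows "g 0 = \<one>"
proof -
  have "g (0 + 0) = g 0 \<otimes> g 0" and c: "g 0 \<in> carrier A" using assms pos_0 unfolding padd_def by blast+
  then have "g 0 \<otimes> g 0 = g 0" by (simp only: add_0_left)
  then show ?thesis using idem[OF c] by blast
qed

lemma ex_pos: assumes "padd g" "pos y" shows "ex g y = g y"
  using ex_diff[OF assms pos_0] padd_0[OF assms(1)] assms unfolding padd_def by simp

lemma hadd_0: assumes "hadd h" shows "h 0 = \<one>"
proof -
  have "h (0 + 0) = h 0 \<otimes> h 0" and c: "h 0 \<in> carrier A" using assms G_0 unfolding hadd_def by blast+
  then have "h 0 \<otimes> h 0 = h 0" by (simp only: add_0_left)
  then show ?thesis using idem[OF c] by blast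
qed

lemma hadd_minus: assumes "hadd h" "x \<in> \<Gamma>" shows "h (- x) = inv (h x)"
proof -
  have "h (- x + x) = h (- x) \<otimes> h x" "h (- x) \<in> carrier A" "h x \<in> carrier A"
    using assms G_minus[OF assms(2)] unfolding hadd_def by blast+
  then show ?thesis using A.inv_equality[of "h (- x)" "h x"] hadd_0[OF assms(1)] by simp
qed

lemma hadd_int: assumes "hadd h" "x \<in> \<Gamma>" shows "h (of_int n * x) = h x [^] n"
proof (induction n rule: int_induct[where k = 0])
  case base then show ?case using hadd_0[OF assms(1)] by simp
next
  case (step1 i)
  have "h (of_int (i + 1) * x) = h (of_int i * x + x)" by (simp add: algebra_simps)
  also have "\<dots> = h (of_int i * x) \<otimes> h x" using assms G_of_int[OF assms(2)] unfolding hadd_def by blast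
  also have "\<dots> = h x [^] i \<otimes> h x" using step1 by simp
  finally show ?case using assms unfolding hadd_def by (simp add: A.int_pow_mult)
next
  case (step2 i)
  have "h (of_int (i - 1) * x) = h (of_int i * x + (- x))" by (simp add: algebra_simps)
  also have "\<dots> = h (of_int i * x) \<otimes> h (- x)"
    using assms G_of_int[OF assms(2)] G_minus[OF assms(2)] unfolding hadd_def by blast
  also have "\<dots> = h x [^] i \<otimes> inv (h x)" using step2 hadd_minus[OF assms] by simp
  finally show ?case using assms unfolding hadd_def by (simp add: A.int_pow_diff)
qed

text \<open>First length 1 is enough: scaling moves a power of \<open>lam\<close> from the first
  length to the second, and powers generate \<open>\<Gamma>\<close>.\<close>

definition psi :: "real \<Rightarrow> 'g" where "psi = ex (rho 1)"

lemma padd_rho2: "pos x \<Longrightarrow> padd (rho x)" unfolding padd_def by (simp add: rho_add2)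
lemma padd_rho1: "pos y \<Longrightarrow> padd (\<lambda>x. rho x y)" unfolding padd_def by (simp add: rho_add1)

lemma psi_hadd: "hadd psi" unfolding psi_def by (intro ex_hadd padd_rho2) simp

lemma psi_pos: "pos y \<Longrightarrow> psi y = rho 1 y"
  unfolding psi_def by (intro ex_pos padd_rho2) auto

lemma psi_closed [simp]: "y \<in> \<Gamma> \<Longrightarrow> psi y \<in> carrier A" using psi_hadd unfolding hadd_def by blast
lemma psi_add: "x \<in> \<Gamma> \<Longrightarrow> y \<in> \<Gamma> \<Longrightarrow> psi (x + y) = psi x \<otimes> psi y" using psi_hadd unfolding hadd_def by blast

lemma rho_pw: assumes "pos y" shows "rho (pw k) y = psi (pw (- k) * y)"
proof -
  have "rho (pw k * 1) (pw k * (pw (- k) * y)) = rho 1 (pw (- k) * y)" using rho_scale assms pos_1 pos_scale by blast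
  then show ?thesis using psi_pos assms by simp
qed

text \<open>The pairing is \<open>rho x y = psi (x' y)\<close>, where \<open>x \<mapsto> x'\<close> replaces \<open>\<lambda>\<close> by \<open>\<lambda>\<^sup>-\<^sup>1\<close>. Here \<open>x'\<close> depends on the
  Laurent polynomial representing \<open>x\<close>, whereas \<open>rho x y\<close> does not: this gives relations.\<close>
lemma rho_ex_sum:
  assumes y: "pos y" and "finite K"
  shows "ex (\<lambda>x. rho x y) (\<Sum>k\<in>K. of_int (c k) * pw k) = psi (\<Sum>k\<in>K. of_int (c k) * (pw (- k) * y))"
  using assms(2)
proof (induction K rule: finite_induct)
  case empty
  then show ?case using hadd_0[OF psi_hadd] hadd_0[OF ex_hadd[OF padd_rho1[OF y]]] by simp
next
  case (insert k K)
  let ?h = "ex (\<lambda>x. rho x y)"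
  have h: "hadd ?h" using ex_hadd[OF padd_rho1[OF y]] .
  have G: "(\<Sum>k\<in>K. of_int (c k) * pw k) \<in> \<Gamma>" "(\<Sum>k\<in>K. of_int (c k) * (pw (- k) * y)) \<in> \<Gamma>"
    using insert y by (auto intro!: G_sum simp: pos_G)
  have "?h (of_int (c k) * pw k) = ?h (pw k) [^] c k" using hadd_int[OF h] by simp
  also have "?h (pw k) = psi (pw (- k) * y)" using ex_pos[OF padd_rho1[OF y], of "pw k"] rho_pw[OF y] by simp
  also have "psi (pw (- k) * y) [^] c k = psi (of_int (c k) * (pw (- k) * y))"
    using hadd_int[OF psi_hadd, of "pw (- k) * y"] y by (simp add: pos_G)
  finally have "?h (of_int (c k) * pw k) = psi (of_int (c k) * (pw (- k) * y))" .
  then have "?h (of_int (c k) * pw k + (\<Sum>k\<in>K. of_int (c k) * pw k))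
     = psi (of_int (c k) * (pw (- k) * y)) \<otimes> psi (\<Sum>k\<in>K. of_int (c k) * (pw (- k) * y))"
    using h G(1) insert.IH G_of_int[OF G_pw, of "c k" k] unfolding hadd_def by (metis (no_types, lifting))
  also have "\<dots> = psi (of_int (c k) * (pw (- k) * y) + (\<Sum>k\<in>K. of_int (c k) * (pw (- k) * y)))"
    using psi_add G G_of_int G_scale pos_G[OF y] by simp
  finally show ?case using insert by simp
qed

section \<open>Kernel and image of \<open>psi\<close>\<close>

definition Ker :: "real set" where "Ker = {y \<in> \<Gamma>. psi y = \<one>}"

lemma Ker_G: "y \<in> Ker \<Longrightarrow> y \<in> \<Gamma>" by (simp add: Ker_def)
lemma Ker_0: "0 \<in> Ker" using hadd_0[OF psi_hadd] by (simp add: Ker_def)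
lemma Ker_add: "x \<in> Ker \<Longrightarrow> y \<in> Ker \<Longrightarrow> x + y \<in> Ker" by (simp add: Ker_def psi_add)
lemma Ker_int: "x \<in> Ker \<Longrightarrow> of_int n * x \<in> Ker" using hadd_int[OF psi_hadd, of x n] by (simp add: Ker_def)
lemma Ker_minus: "x \<in> Ker \<Longrightarrow> - x \<in> Ker" using Ker_int[of x "-1"] by simp
lemma Ker_diff: "x \<in> Ker \<Longrightarrow> y \<in> Ker \<Longrightarrow> x - y \<in> Ker" using Ker_add[of x "- y"] Ker_minus[of y] by simp

text \<open>The two terms contribute \<open>rho 1 (pw n)\<close> and \<open>rho (pw n) 1\<close>,
  which are inverse to each other by antisymmetry.\<close>

lemma Ker_sym: "pw n + pw (- n) \<in> Ker"
proof -
  have "psi (pw n) = rho 1 (pw n)" using psi_pos by simp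
  moreover have "psi (pw (- n)) = rho (pw n) 1" using rho_pw[of 1 n] by simp
  ultimately have "psi (pw n + pw (- n)) = rho 1 (pw n) \<otimes> rho (pw n) 1" using psi_add by simp
  also have "\<dots> = \<one>" using rho_swap[of 1 "pw n"] by simp
  finally show ?thesis by (simp add: Ker_def)
qed

text \<open>A vanishing sum represents the first length 0, whose pairing is trivial, while
  \<open>rho_ex_sum\<close> evaluates the same pairing with \<open>lam\<close> replaced by
  1/\<open>lam\<close>.\<close>

lemma Ker_rel:
  assumes K: "finite K" and 0: "(\<Sum>k\<in>K. of_int (c k) * pw k) = 0" and y: "y \<in> \<Gamma>"
  shows "(\<Sum>k\<in>K. of_int (c k) * pw (- k)) * y \<in> Ker"
proof -
  let ?S = "\<Sum>k\<in>K. of_int (c k) * pw (- k)"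
  have p: "?S * z \<in> Ker" if z: "pos z" for z
  proof -
    have e: "?S * z = (\<Sum>k\<in>K. of_int (c k) * (pw (- k) * z))"
      by (simp add: sum_distrib_right mult.assoc)
    moreover have "psi (\<Sum>k\<in>K. of_int (c k) * (pw (- k) * z)) = ex (\<lambda>x. rho x z) 0"
      using rho_ex_sum[OF z K, of c] 0 by simp
    moreover have "\<dots> = \<one>" using hadd_0[OF ex_hadd[OF padd_rho1[OF z]]] .
    moreover have "(\<Sum>k\<in>K. of_int (c k) * (pw (- k) * z)) \<in> \<Gamma>" using K z by (auto intro!: G_sum simp: pos_G)
    ultimately show ?thesis by (simp add: Ker_def)
  qed
  have d: "pos (max y 0)" "pos (max (- y) 0)" "y = max y 0 - max (- y) 0" using G_decomp[OF y] by auto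
  have "?S * y = ?S * max y 0 - ?S * max (- y) 0" by (subst d(3)) (simp only: right_diff_distrib)
  then show ?thesis using Ker_diff[OF p[OF d(1)] p[OF d(2)]] by (simp only:)
qed

definition Img :: "'g set" where "Img = psi ` \<Gamma>"

lemma Img_mult: "a \<in> Img \<Longrightarrow> b \<in> Img \<Longrightarrow> a \<otimes> b \<in> Img"
  unfolding Img_def by (auto simp: psi_add[symmetric])
lemma Img_inv: "a \<in> Img \<Longrightarrow> inv a \<in> Img"
  unfolding Img_def by (auto simp: hadd_minus[OF psi_hadd, symmetric])
lemma Img_one: "\<one> \<in> Img" using imageI[OF G_0, of psi] hadd_0[OF psi_hadd] by (simp add: Img_def)
lemma rho_Img: assumes "pos x" "pos y" shows "rho x y \<in> Img"
proof -
  obtain c K where h: "finite K" "x = (\<Sum>k\<in>K. of_int (c k) * pw k)"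
    using assms unfolding G_def pos_def by blast
  have "rho x y = ex (\<lambda>x. rho x y) x" using ex_pos[OF padd_rho1[OF assms(2)] assms(1)] by simp
  also have "\<dots> = psi (\<Sum>k\<in>K. of_int (c k) * (pw (- k) * y))" using rho_ex_sum[OF assms(2) h(1), of c] h(2) by simp
  finally show ?thesis unfolding Img_def using h(1) assms(2)
    by (auto intro!: image_eqI G_sum simp: pos_G)
qed

text \<open>A rotation of the whole of [0, l) has no free room to be moved. Cutting a short piece
  off y splits it into two rotations, each of which misses one end of [0, l).\<close>

lemma rot_Img: assumes r: "rok a x y" shows "\<phi> (rot a x y) \<in> Img"
proof -
  have proper: "\<phi> (rot b u v) \<in> Img" if "rok b u v" "b + u + v < l \<or> 0 < b" for b u v
  proof -
    have "pos u" "pos v" using that unfolding rok_def pos_def by auto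
    then show ?thesis using rho_eq[of u v b 0] rho_Img that by simp
  qed
  show ?thesis
  proof (cases "y = 0")
    case True
    then have "rot a x y = id" by (auto simp: rot_def fun_eq_iff)
    then show ?thesis using phi_id Img_one by simp
  next
    case False
    then have y: "0 < y" using r unfolding rok_def by simp
    then obtain k where k: "pw k < y" using pw_small by blast
    have r': "rok a x (pw k)" "rok (a + pw k) x (y - pw k)" using r k unfolding rok_def by auto
    have "rot a x y = rot (a + pw k) x (y - pw k) \<circ> rot a x (pw k)"
      using rot_split[of x "pw k" "y - pw k" a] r k unfolding rok_def by simp
    then have "\<phi> (rot a x y) = \<phi> (rot (a + pw k) x (y - pw k)) \<otimes> \<phi> (rot a x (pw k))"
      using phi_mult rok_W r' by simp
    moreover have "\<phi> (rot (a + pw k) x (y - pw k)) \<in> Img"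
      using proper[OF r'(2)] r by (simp add: rok_def add_nonneg_pos)
    moreover have "\<phi> (rot a x (pw k)) \<in> Img"
      using proper[OF r'(1)] r k unfolding rok_def by simp
    ultimately show ?thesis using Img_mult by simp
  qed
qed

end

section \<open>Rotations representing the values of \<open>psi\<close>\<close>

context pl
begin

text \<open>A concrete element with value \<open>psi y\<close>. The 2 in the bound counts the first
  length and the offset \<open>pw k\<close>; the offset keeps the rotation away from both ends, as
  the later formulas for invariants of rotations require.\<close>

definition mid :: "real \<Rightarrow> real \<Rightarrow> real" where
  "mid y = (let k = (SOME k. pw k * (2 + y) < l) in rot (pw k) (pw k) (pw k * y))"

text \<open>Negative y are reached through inverses. These elements do not depend on the
  homomorphism, so explicit invariants can be evaluated on the same representatives.\<close>

definition gel :: "real \<Rightarrow> real \<Rightarrow> real" where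
  "gel y = mid (max y 0) \<circ> finv (mid (max (- y) 0))"

lemma midE:
  assumes "0 \<le> y"
  obtains k where "mid y = rot (pw k) (pw k) (pw k * y)" "pw k + pw k + pw k * y < l"
proof -
  have "\<exists>k. pw k * (2 + y) < l" using pw_small_mult[OF l_pos] assms by simp
  then have "pw (SOME k. pw k * (2 + y) < l) * (2 + y) < l" by (rule someI_ex)
  then show ?thesis using that[of "SOME k. pw k * (2 + y) < l"] by (simp add: mid_def Let_def algebra_simps)
qed

lemma mid_W: assumes "0 \<le> y" "y \<in> \<Gamma>" shows "mid y \<in> W"
proof -
  obtain k where k: "mid y = rot (pw k) (pw k) (pw k * y)" "pw k + pw k + pw k * y < l" using midE[OF assms(1)] .
  show ?thesis unfolding k(1) using assms k(2) by (intro rot_W) auto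
qed

lemma gel_W: assumes "y \<in> \<Gamma>" shows "gel y \<in> W"
  unfolding gel_def using assms by (intro W_comp W_inv mid_W) (auto simp: max_def)

end

context pl_hom
begin

lemma phi_mid: assumes "pos y" shows "\<phi> (mid y) = psi y"
proof -
  have y: "0 \<le> y" "y \<in> \<Gamma>" using assms by (auto simp: pos_def)
  obtain k where k: "mid y = rot (pw k) (pw k) (pw k * y)" "pw k + pw k + pw k * y < l" using midE[OF y(1)] .
  have "rok (pw k) (pw k * 1) (pw k * y)" using y k unfolding rok_def by auto
  then have "\<phi> (rot (pw k) (pw k * 1) (pw k * y)) = rho 1 y" using assms by (intro rho_eq) auto
  then show ?thesis using k psi_pos[OF assms] by simp
qed

lemma phi_gel: assumes "y \<in> \<Gamma>" shows "\<phi> (gel y) = psi y"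
proof -
  let ?p = "max y 0" and ?n = "max (- y) 0"
  have d: "pos ?p" "pos ?n" "y = ?p - ?n" using G_decomp[OF assms] by auto
  have "\<phi> (gel y) = \<phi> (mid ?p) \<otimes> inv (\<phi> (mid ?n))" unfolding gel_def
    using d mid_W by (simp add: pos_def phi_mult phi_inv W_inv)
  also have "\<dots> = psi y" unfolding psi_def ex_def using phi_mid d psi_pos by simp
  finally show ?thesis .
qed

end

section \<open>Generation by rotations modulo commutators\<close>

text \<open>The position of q after p has been pulled to the left end: pieces that p jumps over move
  right by its width.\<close>

definition shft :: "real \<times> real \<Rightarrow> real \<times> real \<Rightarrow> real \<times> real" where
  "shft p q = (if fst q < fst p then (fst q + (snd p - fst p), snd q + (snd p - fst p)) else q)"

lemma part_sides:
  assumes P: "part c d P" and p: "p \<in> P" and q: "q \<in> P - {p}"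
  shows "(fst q < fst p \<and> snd q \<le> fst p) \<or> (fst p < fst q \<and> snd p \<le> fst q)"
proof (cases "fst q < fst p")
  case True
  then show ?thesis using part_order[OF P _ p True] q by simp
next
  case False
  moreover have "fst p \<noteq> fst q" using part_fst_inj[OF P p, of q] q by blast
  ultimately have "fst p < fst q" by linarith
  then show ?thesis using part_order[OF P p, of q] q by simp
qed

lemma shft_cases:
  assumes "part c d P" "p \<in> P" "q \<in> P - {p}"
  obtains "fst q < fst p" "snd q \<le> fst p" "shft p q = (fst q + (snd p - fst p), snd q + (snd p - fst p))"
  | "fst p < fst q" "snd p \<le> fst q" "shft p q = q"
  using part_sides[OF assms] by (auto simp: shft_def)

lemma part_shft:
  assumes P: "part c d P" and p: "p \<in> P"
  shows "part (c + (snd p - fst p)) d (shft p ` (P - {p}))" "inj_on (shft p) (P - {p})"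
proof -
  let ?w = "snd p - fst p"
  have pl: "fst p < snd p" and pb: "c \<le> fst p" "snd p \<le> d" using part_less[OF P p] part_bounds[OF P p] by auto
  show "inj_on (shft p) (P - {p})"
  proof (rule inj_onI)
    fix q q' assume q: "q \<in> P - {p}" "q' \<in> P - {p}" "shft p q = shft p q'"
    have l: "fst q < snd q" "fst q' < snd q'" using part_less[OF P] q by auto
    show "q = q'"
      by (rule shft_cases[OF P p q(1)]; rule shft_cases[OF P p q(2)]) (use q(3) l in \<open>auto simp: prod_eq_iff\<close>)
  qed
  show "part (c + ?w) d (shft p ` (P - {p}))"
  proof (rule partI)
    show "finite (shft p ` (P - {p}))" using part_finite[OF P] by simp
  next
    fix r assume "r \<in> shft p ` (P - {p})"
    then obtain q where q: "q \<in> P - {p}" "r = shft p q" by blast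
    have "fst q < snd q" using part_less[OF P] q by simp
    then show "fst r < snd r" using q(2) by (simp add: shft_def)
  next
    fix t assume t: "c + ?w \<le> t" "t < d"
    show "\<exists>r\<in>shft p ` (P - {p}). fst r \<le> t \<and> t < snd r"
    proof (cases "t < snd p")
      case True
      then obtain q where q: "q \<in> P" "fst q \<le> t - ?w" "t - ?w < snd q"
        using part_cover[OF P, of "t - ?w"] t pl pb by auto
      then have "q \<in> P - {p}" "fst q < fst p" using True by auto
      then have "shft p q \<in> shft p ` (P - {p})" "shft p q = (fst q + ?w, snd q + ?w)" by (auto simp: shft_def)
      then show ?thesis using q by (intro bexI[of _ "shft p q"]) auto
    next
      case False
      then obtain q where q: "q \<in> P" "fst q \<le> t" "t < snd q"
        using part_cover[OF P, of t] t pl pb by auto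
      then have q': "q \<in> P - {p}" using False by auto
      have "shft p q = q" by (rule shft_cases[OF P p q']) (use q False pl in auto)
      moreover have "shft p q \<in> shft p ` (P - {p})" using q' by (rule imageI)
      ultimately show ?thesis using q by (intro bexI[of _ "shft p q"]) auto
    qed
  next
    fix r t assume r: "r \<in> shft p ` (P - {p})" "fst r \<le> t" "t < snd r"
    then obtain q where q: "q \<in> P - {p}" "r = shft p q" by blast
    have b: "c \<le> fst q" "snd q \<le> d" using part_bounds[OF P] q by auto
    show "c + ?w \<le> t \<and> t < d"
      by (rule shft_cases[OF P p q(1)]) (use b q(2) r pb pl in auto)
  next
    fix r s t assume r: "r \<in> shft p ` (P - {p})" "s \<in> shft p ` (P - {p})" "fst r \<le> t" "t < snd r" "fst s \<le> t" "t < snd s"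
    then obtain q q' where q: "q \<in> P - {p}" "r = shft p q" "q' \<in> P - {p}" "s = shft p q'" by blast
    have u: "fst q \<le> u \<Longrightarrow> u < snd q \<Longrightarrow> fst q' \<le> u \<Longrightarrow> u < snd q' \<Longrightarrow> q = q'" for u
      using part_unique[OF P, of q q' u] q by blast
    have "q = q'"
      by (rule shft_cases[OF P p q(1)]; rule shft_cases[OF P p q(3)])
        (use u[of t] u[of "t - ?w"] q(2,4) r pl in auto)
    then show "r = s" using q by simp
  qed
qed

text \<open>The listed pieces are translated, in the order of the list, onto consecutive intervals
  that start at c.\<close>

fun placed :: "(real \<Rightarrow> real) \<Rightarrow> real \<Rightarrow> (real \<times> real) list \<Rightarrow> bool" where
  "placed \<alpha> c [] = True"
| "placed \<alpha> c (p # ps) = ((\<forall>t. fst p \<le> t \<longrightarrow> t < snd p \<longrightarrow> \<alpha> t = c + (t - fst p)) \<and> placed \<alpha> (c + (snd p - fst p)) ps)"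

definition len :: "(real \<times> real) list \<Rightarrow> real" where
  "len ps = (\<Sum>p\<leftarrow>ps. snd p - fst p)"

lemma len_simps [simp]: "len [] = 0" "len (p # ps) = snd p - fst p + len ps" "len (ps @ qs) = len ps + len qs"
  by (simp_all add: len_def)

lemma len_nonneg: "(\<And>p. p \<in> set ps \<Longrightarrow> fst p < snd p) \<Longrightarrow> 0 \<le> len ps"
  by (induction ps) force+

lemma len_sum: "distinct ps \<Longrightarrow> len ps = (\<Sum>p\<in>set ps. snd p - fst p)"
  by (simp add: len_def sum_list_distinct_conv_sum_set)

lemma placed_append: "placed \<alpha> c (ps @ qs) \<longleftrightarrow> placed \<alpha> c ps \<and> placed \<alpha> (c + len ps) qs"
  by (induction ps arbitrary: c) (auto simp: add.assoc)

lemma placed_in: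
  assumes "placed \<alpha> c ps" "p \<in> set ps" "fst p \<le> t" "t < snd p" "\<And>p. p \<in> set ps \<Longrightarrow> fst p < snd p"
  shows "c \<le> \<alpha> t \<and> \<alpha> t < c + len ps"
  using assms
proof (induction ps arbitrary: c)
  case (Cons q ps)
  have n: "0 \<le> len ps" using len_nonneg[of ps] Cons.prems(5) by auto
  have q: "fst q < snd q" using Cons.prems(5) by simp
  show ?case
  proof (cases "p = q")
    case True
    then have "\<alpha> t = c + (t - fst q)" using Cons.prems by simp
    then show ?thesis using Cons.prems(3,4) True n by simp
  next
    case False
    then have "c + (snd q - fst q) \<le> \<alpha> t \<and> \<alpha> t < c + (snd q - fst q) + len ps"
      using Cons.prems by (intro Cons.IH) auto
    then show ?thesis using q by simp
  qed
qed simp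

lemma placed_onto:
  assumes "placed \<alpha> c ps" "c \<le> u" "u < c + len ps"
  shows "\<exists>p\<in>set ps. \<exists>t. fst p \<le> t \<and> t < snd p \<and> \<alpha> t = u"
  using assms
proof (induction ps arbitrary: c)
  case (Cons q ps)
  show ?case
  proof (cases "u < c + (snd q - fst q)")
    case True
    define t where "t = u - c + fst q"
    have "fst q \<le> t" "t < snd q" using True Cons.prems(2) by (auto simp: t_def)
    moreover from this have "\<alpha> t = u" using Cons.prems(1) by (simp add: t_def)
    ultimately show ?thesis by auto
  next
    case False
    then have "\<exists>p\<in>set ps. \<exists>t. fst p \<le> t \<and> t < snd p \<and> \<alpha> t = u"
      using Cons.prems by (intro Cons.IH[of "c + (snd q - fst q)"]) auto
    then show ?thesis by auto
  qed
qed simp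

lemma placed_map:
  assumes "placed \<alpha> c (map g ps)"
    "\<And>p. p \<in> set ps \<Longrightarrow> snd (g p) - fst (g p) = snd p - fst p"
    "\<And>p t. p \<in> set ps \<Longrightarrow> fst p \<le> t \<Longrightarrow> t < snd p \<Longrightarrow> r t - fst (g p) = t - fst p"
  shows "placed (\<alpha> \<circ> r) c ps"
  using assms
proof (induction ps arbitrary: c)
  case (Cons p ps)
  have w: "snd (g p) - fst (g p) = snd p - fst p" using Cons.prems(2) by simp
  have "(\<alpha> \<circ> r) t = c + (t - fst p)" if t: "fst p \<le> t" "t < snd p" for t
  proof -
    have e: "r t - fst (g p) = t - fst p" using Cons.prems(3)[of p t] t by simp
    then have "fst (g p) \<le> r t" "r t < snd (g p)" using t w by linarith+
    then show ?thesis using Cons.prems(1) e by simp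
  qed
  moreover have "placed (\<alpha> \<circ> r) (c + (snd p - fst p)) ps"
    using Cons.prems w by (intro Cons.IH) auto
  ultimately show ?case unfolding placed.simps by blast
qed simp

context pl_hom
begin

lemma Img_cancel:
  assumes "f \<in> W" "g \<in> W" "\<phi> g \<in> Img" "\<phi> (g \<circ> f) \<in> Img"
  shows "\<phi> f \<in> Img"
proof -
  have c: "\<phi> g \<in> carrier A" "\<phi> f \<in> carrier A" using assms by auto
  have "\<phi> f = inv (\<phi> g) \<otimes> \<phi> (g \<circ> f)" using phi_mult assms c by (simp add: A.m_assoc[symmetric])
  then show ?thesis using Img_mult Img_inv assms by simp
qed

lemma Img_comp: "f \<in> W \<Longrightarrow> g \<in> W \<Longrightarrow> \<phi> f \<in> Img \<Longrightarrow> \<phi> g \<in> Img \<Longrightarrow> \<phi> (f \<circ> g) \<in> Img"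
  by (simp add: phi_mult Img_mult)

lemma front_rot:
  assumes P: "part c l P" and c: "c \<in> \<Gamma>" "0 \<le> c" and E: "\<And>p. p \<in> P \<Longrightarrow> fst p \<in> \<Gamma> \<and> snd p \<in> \<Gamma>" and p: "p \<in> P"
  shows "rok c (fst p - c) (snd p - fst p)"
  using part_bounds[OF P p] part_less[OF P p] E[OF p] c unfolding rok_def by auto

lemma shft_G:
  assumes E: "\<And>p. p \<in> P \<Longrightarrow> fst p \<in> \<Gamma> \<and> snd p \<in> \<Gamma>" and p: "p \<in> P" and r: "r \<in> shft p ` (P - {p})"
  shows "fst r \<in> \<Gamma> \<and> snd r \<in> \<Gamma>"
proof -
  obtain q where q: "q \<in> P" "r = shft p q" using r by blast
  show ?thesis using E[OF p] E[OF q(1)] q(2) by (simp add: shft_def)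
qed

text \<open>Induction on the number of pieces. Rotating the piece that \<open>f\<close> sends to the
  left end c into that place splits off one rotation; the remaining interval exchange fixes a longer
  initial segment and has one piece fewer.\<close>

lemma iet_Img_aux:
  "card P = n \<Longrightarrow> f \<in> W \<Longrightarrow> part c l P \<Longrightarrow> c \<in> \<Gamma> \<Longrightarrow> 0 \<le> c \<Longrightarrow> c \<le> l \<Longrightarrow> (\<And>t. t < c \<Longrightarrow> f t = t) \<Longrightarrow>
    (\<And>p. p \<in> P \<Longrightarrow> fst p \<in> \<Gamma> \<and> snd p \<in> \<Gamma>) \<Longrightarrow>
    (\<And>p. p \<in> P \<Longrightarrow> \<exists>e. \<forall>t. fst p \<le> t \<longrightarrow> t < snd p \<longrightarrow> f t = t + e) \<Longrightarrow> \<phi> f \<in> Img"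
proof (induction n arbitrary: P c f)
  case 0
  have fin: "finite P" using part_finite 0 by blast
  then have P: "P = {}" using 0 by simp
  have "c = l"
  proof (rule ccontr)
    assume "c \<noteq> l"
    then show False using part_cover[OF 0(3), of c] 0(6) P by auto
  qed
  have "f t = t" for t
  proof (cases "t < c")
    case False then show ?thesis using W_out[OF 0(2), of t] \<open>c = l\<close> by auto
  qed (use 0(7) in auto)
  then have e: "f = id" by auto
  show ?case unfolding e phi_id by (rule Img_one)
next
  case (Suc n)
  note P = Suc.prems(3) and f = Suc.prems(2)
  have "P \<noteq> {}" using Suc.prems(1) by auto
  then obtain q where q: "q \<in> P" by blast
  have cl: "c < l" using part_bounds[OF P q] part_less[OF P q] by linarith
  \<comment> \<open>The piece containing \<open>s\<close> must begin at \<open>s\<close>: it is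
    translated, and its left end cannot be sent below c, where everything is already fixed.\<close>
  define s where "s = finv f c"
  have fs: "f s = c" using W_f_inv[OF f] by (simp add: s_def)
  have s0: "0 \<le> s" "s < l" using W_range[OF f, of s] fs cl Suc.prems(5) by auto
  have "c \<le> s" using Suc.prems(7)[of s] fs by linarith
  then obtain p where p: "p \<in> P" "fst p \<le> s" "s < snd p" using part_cover[OF P] s0 by blast
  obtain e where e: "\<And>t. fst p \<le> t \<Longrightarrow> t < snd p \<Longrightarrow> f t = t + e" using Suc.prems(9)[OF p(1)] by blast
  have pl: "fst p < snd p" "c \<le> fst p" "snd p \<le> l" using part_less[OF P p(1)] part_bounds[OF P p(1)] by auto
  have "c \<le> f (fst p)"
  proof (rule ccontr)
    assume n: "\<not> c \<le> f (fst p)"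
    then have "f (f (fst p)) = f (fst p)" using Suc.prems(7) by simp
    then have "f (fst p) = fst p" using W_eq[OF f] by blast
    then show False using n pl by simp
  qed
  then have ps: "e = c - fst p" using e[of "fst p"] e[of s] fs p pl by simp
  let ?w = "snd p - fst p" and ?x = "fst p - c"
  have rk: "rok c ?x ?w" using front_rot[OF P Suc.prems(4,5,8) p(1)] .
  let ?r = "rot c ?x ?w" and ?g = "rot c ?w ?x"
  have rk': "rok c ?w ?x" using rk unfolding rok_def by auto
  define f' where "f' = f \<circ> ?g"
  have f': "f' \<in> W" unfolding f'_def using W_comp rok_W[OF rk'] f by blast
  have "?g (?r t) = t" for t using rot_rot[of ?x ?w c t] pl by simp
  then have ff: "f = f' \<circ> ?r" by (auto simp: f'_def)
  have "\<phi> f' \<in> Img"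
  proof (rule Suc.IH[of "shft p ` (P - {p})" f' "c + ?w"])
    show "card (shft p ` (P - {p})) = n"
      using card_image[OF part_shft(2)[OF P p(1)]] Suc.prems(1) p(1) part_finite[OF P] by simp
    show "part (c + ?w) l (shft p ` (P - {p}))" using part_shft(1)[OF P p(1)] .
    show "c + ?w \<in> \<Gamma>" using Suc.prems(4,8) p(1) by simp
    show "0 \<le> c + ?w" "c + ?w \<le> l" using Suc.prems(5) pl by auto
    show "fst r \<in> \<Gamma> \<and> snd r \<in> \<Gamma>" if "r \<in> shft p ` (P - {p})" for r using shft_G[OF Suc.prems(8) p(1) that] .
    show "f' t = t" if t: "t < c + ?w" for t
    proof (cases "t < c")
      case True
      then have "?g t = t" using pl by (simp add: rot_def)
      then show ?thesis using Suc.prems(7)[of t] True by (simp add: f'_def)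
    next
      case False
      then have "?g t = t + ?x" using t by (simp add: rot_def)
      moreover have "f (t + ?x) = t + ?x + e" using False t by (intro e) auto
      ultimately show ?thesis using ps by (simp add: f'_def)
    qed
    show "\<exists>e. \<forall>t. fst r \<le> t \<longrightarrow> t < snd r \<longrightarrow> f' t = t + e" if r: "r \<in> shft p ` (P - {p})" for r
    proof -
      obtain q where q: "q \<in> P - {p}" "r = shft p q" using r by blast
      obtain d where d: "\<And>t. fst q \<le> t \<Longrightarrow> t < snd q \<Longrightarrow> f t = t + d" using Suc.prems(9)[of q] q by blast
      have cq: "c \<le> fst q" using part_bounds[OF P] q by auto
      show ?thesis
      proof (rule shft_cases[OF P p(1) q(1)])
        assume h: "fst q < fst p" "snd q \<le> fst p" "shft p q = (fst q + ?w, snd q + ?w)"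
        have "f' t = t + (d - ?w)" if "fst r \<le> t" "t < snd r" for t
        proof -
          have "?g t = t - ?w" using that h q(2) cq by (simp add: rot_def)
          moreover have "f (t - ?w) = t - ?w + d" using that h q(2) by (intro d) auto
          ultimately show ?thesis by (simp add: f'_def)
        qed
        then show ?thesis by blast
      next
        assume h: "fst p < fst q" "snd p \<le> fst q" "shft p q = q"
        have "f' t = t + d" if "fst r \<le> t" "t < snd r" for t
        proof -
          have "?g t = t" using that h q(2) pl by (simp add: rot_def)
          then show ?thesis using d[of t] that h q(2) by (simp add: f'_def)
        qed
        then show ?thesis by blast
      qed
    qed
  qed (rule f')
  then show ?case unfolding ff by (rule Img_comp[OF f' rok_W[OF rk] _ rot_Img[OF rk]])
qed

lemma iet_Img:
  assumes f: "f \<in> W" and g: "\<And>t. germ f t 0"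
  shows "\<phi> f \<in> Img"
proof -
  obtain P where P: "adapted f P" using W_adapted[OF f] by blast
  have "\<exists>e. \<forall>t. fst p \<le> t \<longrightarrow> t < snd p \<longrightarrow> f t = t + e" if p: "p \<in> P" for p
  proof -
    obtain k where k: "fst p < snd p" "\<And>t. fst p \<le> t \<Longrightarrow> t < snd p \<Longrightarrow> f t = f (fst p) + pw k * (t - fst p)"
      using adaptedE[OF P p] by metis
    have "germ f (fst p) k" by (rule germI[OF k(2)]) (use k(1) in auto)
    then have "k = 0" using germ_unique g by blast
    then have "f t = t + (f (fst p) - fst p)" if "fst p \<le> t" "t < snd p" for t using k(2)[OF that] by simp
    then show ?thesis by blast
  qed
  then show ?thesis
    using iet_Img_aux[OF refl f adapted_part[OF P]] l_pos W_out[OF f] adapted_ends[OF P] by auto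
qed

text \<open>Successive rotations pull the listed pieces to the front in the prescribed order. As all
  of them end by \<open>\<sigma>\<close>, nothing beyond \<open>\<sigma>\<close> moves.\<close>

lemma move_front_aux:
  "length xs = n \<Longrightarrow> distinct xs \<Longrightarrow> set xs \<subseteq> P \<Longrightarrow> part c l P \<Longrightarrow> c \<in> \<Gamma> \<Longrightarrow> 0 \<le> c \<Longrightarrow>
    (\<And>p. p \<in> P \<Longrightarrow> fst p \<in> \<Gamma> \<and> snd p \<in> \<Gamma>) \<Longrightarrow> (\<And>p. p \<in> set xs \<Longrightarrow> snd p \<le> \<sigma>) \<Longrightarrow>
    \<exists>\<alpha>\<in>W. \<phi> \<alpha> \<in> Img \<and> (\<forall>t. germ \<alpha> t 0) \<and> (\<forall>t. t < c \<or> \<sigma> \<le> t \<longrightarrow> \<alpha> t = t) \<and> placed \<alpha> c xs"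
proof (induction n arbitrary: xs P c)
  case 0
  have xs: "xs = []" using 0 by simp
  have "\<forall>t. germ id t 0" by (auto intro: germI'[of t "t + 1" id t 0 t for t])
  moreover have "\<phi> id \<in> Img" unfolding phi_id by (rule Img_one)
  moreover have "placed id c xs" "\<forall>t. t < c \<or> \<sigma> \<le> t \<longrightarrow> id t = t" unfolding xs by simp_all
  ultimately show ?case using W_id by blast
next
  case (Suc n ys)
  then obtain p xs where ys: "ys = p # xs" by (cases ys) auto
  note prems = Suc.prems(2-)[unfolded ys]
  note P = prems(3)
  have p: "p \<in> P" using prems(2) by simp
  have pl: "fst p < snd p" "c \<le> fst p" "snd p \<le> l" "snd p \<le> \<sigma>"
    using part_less[OF P p] part_bounds[OF P p] prems(7) by auto
  let ?w = "snd p - fst p" and ?x = "fst p - c"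
  have rk: "rok c ?x ?w" using front_rot[OF P prems(4,5,6) p] .
  let ?r = "rot c ?x ?w"
  have xsP: "set xs \<subseteq> P - {p}" using prems(1,2) by auto
  have "\<exists>\<alpha>\<in>W. \<phi> \<alpha> \<in> Img \<and> (\<forall>t. germ \<alpha> t 0) \<and> (\<forall>t. t < c + ?w \<or> \<sigma> \<le> t \<longrightarrow> \<alpha> t = t) \<and> placed \<alpha> (c + ?w) (map (shft p) xs)"
  proof (rule Suc.IH[of "map (shft p) xs" "shft p ` (P - {p})" "c + ?w"])
    show "length (map (shft p) xs) = n" using Suc.prems(1) ys by simp
    show "distinct (map (shft p) xs)" using prems(1) part_shft(2)[OF P p] xsP
      by (simp add: distinct_map inj_on_subset)
    show "set (map (shft p) xs) \<subseteq> shft p ` (P - {p})" using xsP by auto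
    show "part (c + ?w) l (shft p ` (P - {p}))" using part_shft(1)[OF P p] .
    show "c + ?w \<in> \<Gamma>" using prems(4,6) p by simp
    show "0 \<le> c + ?w" using prems(5) pl by auto
    show "fst r \<in> \<Gamma> \<and> snd r \<in> \<Gamma>" if "r \<in> shft p ` (P - {p})" for r using shft_G[OF prems(6) p that] .
    show "snd r \<le> \<sigma>" if r: "r \<in> set (map (shft p) xs)" for r
    proof -
      obtain q where q: "q \<in> set xs" "r = shft p q" using r by auto
      have q': "q \<in> P - {p}" "snd q \<le> \<sigma>" using q xsP prems(7) by auto
      show ?thesis by (rule shft_cases[OF P p q'(1)]) (use q'(2) q(2) pl in auto)
    qed
  qed
  then obtain \<alpha> where a: "\<alpha> \<in> W" "\<phi> \<alpha> \<in> Img" "\<And>t. germ \<alpha> t 0" "\<And>t. t < c + ?w \<or> \<sigma> \<le> t \<Longrightarrow> \<alpha> t = t"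
    "placed \<alpha> (c + ?w) (map (shft p) xs)" by blast
  have rx: "0 \<le> ?x" "0 \<le> ?w" using pl by auto
  show ?case unfolding ys
  proof (intro bexI[of _ "\<alpha> \<circ> ?r"] conjI allI impI)
    show "\<alpha> \<circ> ?r \<in> W" using W_comp a(1) rok_W[OF rk] by blast
    show "\<phi> (\<alpha> \<circ> ?r) \<in> Img" using Img_comp a rok_W[OF rk] rot_Img[OF rk] by blast
    show "germ (\<alpha> \<circ> ?r) t 0" for t using germ_comp[OF germ_rot[OF rx] a(3)] by simp
    show "(\<alpha> \<circ> ?r) t = t" if "t < c \<or> \<sigma> \<le> t" for t
    proof -
      have "?r t = t" using that pl by (auto simp: rot_def)
      then show ?thesis using a(4)[of t] that pl by auto
    qed
    have "(\<alpha> \<circ> ?r) t = c + (t - fst p)" if "fst p \<le> t" "t < snd p" for t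
    proof -
      have "?r t = t - ?x" using that by (simp add: rot_def)
      then show ?thesis using a(4)[of "t - ?x"] that by simp
    qed
    moreover have "placed (\<alpha> \<circ> ?r) (c + ?w) xs"
    proof (rule placed_map[OF a(5)])
      fix q assume q: "q \<in> set xs"
      then have q': "q \<in> P - {p}" using xsP by auto
      show "snd (shft p q) - fst (shft p q) = snd q - fst q" by (simp add: shft_def)
      fix t assume t: "fst q \<le> t" "t < snd q"
      have cq: "c \<le> fst q" using part_bounds[OF P] q' by auto
      show "?r t - fst (shft p q) = t - fst q"
        by (rule shft_cases[OF P p q']) (use t cq in \<open>auto simp: rot_def\<close>)
    qed
    ultimately show "placed (\<alpha> \<circ> ?r) c (p # xs)" by simp
  qed
qed

lemmas move_front = move_front_aux[OF refl]

section \<open>Swaps and the reduction of slopes\<close>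

lemma germ_swp_0: assumes "swp_ok a b w 0" shows "germ (swp a b w 0) t 0"
proof -
  consider "a \<le> t \<and> t < a + w" | "b \<le> t \<and> t < b + pw 0 * w" | "\<not> (a \<le> t \<and> t < a + w)" "\<not> (b \<le> t \<and> t < b + pw 0 * w)"
    by blast
  then show ?thesis
  proof cases
    case 1 then show ?thesis using germ_swp1[of a t w b 0] by blast
  next
    case 2 then show ?thesis using germ_swp2[OF assms, of t] by simp
  next
    case 3 then show ?thesis using germ_swp3[OF assms] by blast
  qed
qed

text \<open>The number c marks a spare interval of length w, disjoint from the other two; the
  conjugate swaps intervals of equal length and is therefore an interval exchange.\<close>

lemma swp_Img:
  assumes "swp_ok a b w k" "swp_ok c b w k" "a + w \<le> c \<or> c + w \<le> a"
  shows "\<phi> (swp a b w k) \<in> Img"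
proof -
  have ok: "swp_ok a c w 0" using assms unfolding swp_ok_def by auto
  have "\<phi> (swp a c w 0) = \<phi> (swp a b w k)"
    using phi_conj_swp[OF swp_W[OF assms(1)] assms(2)] swp_conj_swp[OF assms] by simp
  then show ?thesis using iet_Img[OF swp_W[OF ok] germ_swp_0[OF ok]] by simp
qed

text \<open>The growth factor of the support bound in one reduction of slopes: the old support
  together with landing intervals stretched by \<open>lam\<close> and by
  1/\<open>lam\<close>.\<close>

definition c0 :: real where "c0 = 1 + lam + 1 / lam"

lemma c0_ge: "c0 \<ge> 2"
proof -
  have "lam + 1 / lam - 2 = (lam - 1)\<^sup>2 / lam" using lam_pos by (simp add: field_simps power2_eq_square)
  moreover have "(lam - 1)\<^sup>2 / lam \<ge> 0" using lam_pos by simp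
  ultimately show ?thesis unfolding c0_def by linarith
qed

lemma germ_piece:
  assumes P: "adapted f P" and p: "p \<in> P" and t: "fst p \<le> t" "t < snd p"
  shows "germ f t k \<longleftrightarrow> germ f (fst p) k"
proof -
  obtain j where j: "fst p < snd p" "\<And>t. fst p \<le> t \<Longrightarrow> t < snd p \<Longrightarrow> f t = f (fst p) + pw j * (t - fst p)"
    using adaptedE[OF P p] by metis
  have "germ f t j" by (rule germI[OF j(2)]) (use t in auto)
  moreover have "germ f (fst p) j" by (rule germI[OF j(2)]) (use j(1) in auto)
  ultimately show ?thesis using germ_unique by blast
qed

text \<open>An interval exchange, whose value is known to lie in \<open>Img\<close>, collects two
  slope classes at the left end as adjacent blocks. The two final equations give the block lengths,
  which are compared when only exponents up to 1 occur.\<close>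

lemma gather:
  assumes f: "f \<in> W" and P: "adapted f P" and \<sigma>: "0 \<le> \<sigma>" "\<And>t. \<sigma> \<le> t \<Longrightarrow> f t = t" and jk: "j \<noteq> 0" "k \<noteq> 0" "j \<noteq> k"
  obtains \<alpha> wa wb where "\<alpha> \<in> W" "\<phi> \<alpha> \<in> Img" "\<And>t. germ \<alpha> t 0" "\<And>t. \<sigma> \<le> t \<Longrightarrow> \<alpha> t = t"
    "wa \<in> \<Gamma>" "wb \<in> \<Gamma>" "0 \<le> wa" "0 \<le> wb" "wa + wb \<le> \<sigma>"
    "\<And>t. 0 \<le> \<alpha> t \<and> \<alpha> t < wa \<longleftrightarrow> germ f t j" "\<And>t. wa \<le> \<alpha> t \<and> \<alpha> t < wa + wb \<longleftrightarrow> germ f t k"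
    "wa = (\<Sum>p\<in>{p\<in>P. germ f (fst p) j}. snd p - fst p)" "wb = (\<Sum>p\<in>{p\<in>P. germ f (fst p) k}. snd p - fst p)"
proof -
  have pt: "part 0 l P" using adapted_part[OF P] .
  have fin: "finite P" using part_finite[OF pt] .
  define X where "X i = {p\<in>P. germ f (fst p) i}" for i
  have fX: "finite (X i)" for i using fin by (simp add: X_def)
  obtain xs where xs: "set xs = X j" "distinct xs" using finite_distinct_list[OF fX] by blast
  obtain ys where ys: "set ys = X k" "distinct ys" using finite_distinct_list[OF fX] by blast
  have out0: "germ f t 0" if "\<sigma> \<le> t" for t
    by (rule germ_fix[OF f, of t t "t + 1"]) (use that \<sigma>(2) in auto)
  have lt: "snd p \<le> \<sigma>" if "p \<in> X i" "i \<noteq> 0" for p i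
  proof (rule ccontr)
    assume n: "\<not> snd p \<le> \<sigma>"
    have p: "p \<in> P" "germ f (fst p) i" using that by (auto simp: X_def)
    define t where "t = max (fst p) \<sigma>"
    have t: "fst p \<le> t" "t < snd p" "\<sigma> \<le> t" using n part_less[OF pt p(1)] by (auto simp: t_def)
    then have "germ f t i" using germ_piece[OF P p(1)] p(2) by blast
    then show False using out0[OF t(3)] germ_unique that(2) by blast
  qed
  have "X j \<inter> X k = {}" using germ_unique jk(3) by (auto simp: X_def)
  then have d: "distinct (xs @ ys)" using xs ys by auto
  have sub: "set (xs @ ys) \<subseteq> P" using xs ys by (auto simp: X_def)
  have "\<exists>\<alpha>\<in>W. \<phi> \<alpha> \<in> Img \<and> (\<forall>t. germ \<alpha> t 0) \<and> (\<forall>t. t < 0 \<or> \<sigma> \<le> t \<longrightarrow> \<alpha> t = t) \<and> placed \<alpha> 0 (xs @ ys)"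
    by (rule move_front[OF d sub pt]) (use adapted_ends[OF P] lt xs ys jk in auto)
  then obtain \<alpha> where a: "\<alpha> \<in> W" "\<phi> \<alpha> \<in> Img" "\<And>t. germ \<alpha> t 0" "\<And>t. \<sigma> \<le> t \<Longrightarrow> \<alpha> t = t" "placed \<alpha> 0 (xs @ ys)"
    by blast
  have pa: "placed \<alpha> 0 xs" "placed \<alpha> (0 + len xs) ys" using a(5) placed_append by auto
  have less: "\<And>p. p \<in> set xs \<Longrightarrow> fst p < snd p" "\<And>p. p \<in> set ys \<Longrightarrow> fst p < snd p"
    using part_less[OF pt] sub by auto
  have n: "0 \<le> len xs" "0 \<le> len ys" using len_nonneg less by blast+
  have G: "len xs \<in> \<Gamma>" "len ys \<in> \<Gamma>" using xs ys fX adapted_ends[OF P]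
    by (auto simp: len_sum X_def intro!: G_sum)
  \<comment> \<open>If the blocks extended beyond \<open>\<sigma>\<close>, a point of a listed piece
    would be sent to \<open>\<sigma>\<close>. But \<open>\<sigma>\<close> is fixed, and the pieces
    end there at the latest.\<close>
  have le: "len xs + len ys \<le> \<sigma>"
  proof (rule ccontr)
    assume "\<not> ?thesis"
    then have "\<exists>p\<in>set (xs @ ys). \<exists>t. fst p \<le> t \<and> t < snd p \<and> \<alpha> t = \<sigma>"
      using placed_onto[OF a(5), of \<sigma>] \<sigma>(1) by simp
    then obtain p t where p: "p \<in> set (xs @ ys)" "t < snd p" "\<alpha> t = \<sigma>" by blast
    have "p \<in> X j \<or> p \<in> X k" using p xs ys by auto
    then have "snd p \<le> \<sigma>" using lt jk by blast
    moreover have "\<alpha> t = \<alpha> \<sigma>" using p(3) a(4)[of \<sigma>] by simp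
    then have "t = \<sigma>" using W_eq[OF a(1)] by blast
    ultimately show False using p by simp
  qed
  have cov: "\<exists>p\<in>X i. fst p \<le> t \<and> t < snd p" if "germ f t i" "i \<noteq> 0" for t i
  proof -
    have "0 \<le> t" "t < l" using germ_out[OF f, of t] germ_unique that by blast+
    then obtain p where p: "p \<in> P" "fst p \<le> t" "t < snd p" using part_cover[OF pt] by blast
    have "p \<in> X i" using germ_piece[OF P p] that p(1) by (simp add: X_def)
    then show ?thesis using p by blast
  qed
  have gX: "germ f t i" if "p \<in> X i" "fst p \<le> t" "t < snd p" for p t i
    using germ_piece[OF P _ that(2,3)] that(1) by (auto simp: X_def)
  have e1: "0 \<le> \<alpha> t \<and> \<alpha> t < len xs \<longleftrightarrow> germ f t j" for t
  proof
    assume "0 \<le> \<alpha> t \<and> \<alpha> t < len xs"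
    then obtain p u where p: "p \<in> set xs" "fst p \<le> u" "u < snd p" "\<alpha> u = \<alpha> t" using placed_onto[OF pa(1), of "\<alpha> t"] unfolding add_0_left by blast
    then have "u = t" using W_eq[OF a(1)] by blast
    then show "germ f t j" using gX p xs(1) by blast
  next
    assume "germ f t j"
    then obtain p where "p \<in> set xs" "fst p \<le> t" "t < snd p" using cov jk xs by blast
    then show "0 \<le> \<alpha> t \<and> \<alpha> t < len xs" using placed_in[OF pa(1) _ _ _ less(1)] unfolding add_0_left by blast
  qed
  have e2: "len xs \<le> \<alpha> t \<and> \<alpha> t < len xs + len ys \<longleftrightarrow> germ f t k" for t
  proof
    assume "len xs \<le> \<alpha> t \<and> \<alpha> t < len xs + len ys"
    then obtain p u where p: "p \<in> set ys" "fst p \<le> u" "u < snd p" "\<alpha> u = \<alpha> t" using placed_onto[OF pa(2), of "\<alpha> t"] unfolding add_0_left by blast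
    then have "u = t" using W_eq[OF a(1)] by blast
    then show "germ f t k" using gX p ys(1) by blast
  next
    assume "germ f t k"
    then obtain p where "p \<in> set ys" "fst p \<le> t" "t < snd p" using cov jk ys by blast
    then show "len xs \<le> \<alpha> t \<and> \<alpha> t < len xs + len ys" using placed_in[OF pa(2) _ _ _ less(2)] unfolding add_0_left by blast
  qed
  have S: "len xs = (\<Sum>p\<in>{p\<in>P. germ f (fst p) j}. snd p - fst p)"
    "len ys = (\<Sum>p\<in>{p\<in>P. germ f (fst p) k}. snd p - fst p)"
    using len_sum[OF xs(2)] len_sum[OF ys(2)] xs(1) ys(1) by (simp_all add: X_def)
  show ?thesis by (rule that[OF a(1-4) G n le e1 e2 S])
qed

end

context pl_hom
begin

lemma part_image_sum:
  assumes f: "f \<in> W" and P: "adapted f P"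
  shows "(\<Sum>p\<in>P. (snd (img f p) - fst (img f p)) - (snd p - fst p)) = 0"
proof -
  have i: "part 0 l (img f ` P)" "inj_on (img f) P" using adapted_inv[OF f P] adapted_part by blast+
  have "(\<Sum>p\<in>P. snd (img f p) - fst (img f p)) = (\<Sum>r\<in>img f ` P. snd r - fst r)"
    by (simp add: sum.reindex[OF i(2)])
  also have "\<dots> = l" using part_telescope[OF i(1), of "\<lambda>x. x"] l_pos by simp
  also have "l = (\<Sum>p\<in>P. snd p - fst p)" using part_telescope[OF adapted_part[OF P], of "\<lambda>x. x"] l_pos by simp
  finally show ?thesis by (simp only: sum_subtractf right_minus_eq)
qed

text \<open>Conservation of total length forces the blocks of slope \<open>lam\<close> and
  1/\<open>lam\<close> to have lengths in the ratio 1 to \<open>lam\<close>. One swap of the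
  gathered blocks then has the same slopes as \<open>f\<close>, and differs from \<open>f\<close> by
  an interval exchange.\<close>

lemma slopes_1_Img:
  assumes f: "f \<in> W" and \<sigma>: "\<sigma> \<in> \<Gamma>" "0 \<le> \<sigma>" "\<sigma> * c0 \<le> l" "\<And>t. \<sigma> \<le> t \<Longrightarrow> f t = t"
    and b: "\<And>t k. germ f t k \<Longrightarrow> \<bar>k\<bar> \<le> 1"
  shows "\<phi> f \<in> Img"
proof -
  obtain P where P: "adapted f P" using W_adapted[OF f] by blast
  obtain \<alpha> wa wb where a: "\<alpha> \<in> W" "\<phi> \<alpha> \<in> Img" "\<And>t. germ \<alpha> t 0"
    "wa \<in> \<Gamma>" "wb \<in> \<Gamma>" "0 \<le> wa" "0 \<le> wb" "wa + wb \<le> \<sigma>"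
    "\<And>t. 0 \<le> \<alpha> t \<and> \<alpha> t < wa \<longleftrightarrow> germ f t 1" "\<And>t. wa \<le> \<alpha> t \<and> \<alpha> t < wa + wb \<longleftrightarrow> germ f t (-1)"
    "wa = (\<Sum>p\<in>{p\<in>P. germ f (fst p) 1}. snd p - fst p)" "wb = (\<Sum>p\<in>{p\<in>P. germ f (fst p) (-1)}. snd p - fst p)"
    using gather[OF f P \<sigma>(2,4), of 1 "-1"] by (metis (no_types, lifting) one_neq_neg_one zero_neq_neg_one zero_neq_one)
  have fin: "finite P" using part_finite[OF adapted_part[OF P]] .
  have ev: "(snd (img f p) - fst (img f p)) - (snd p - fst p) =
      (if germ f (fst p) 1 then (lam - 1) * (snd p - fst p) else 0) +
      (if germ f (fst p) (-1) then (1 / lam - 1) * (snd p - fst p) else 0)" if p: "p \<in> P" for p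
  proof -
    obtain k where k: "fst p < snd p" "\<And>t. fst p \<le> t \<Longrightarrow> t < snd p \<Longrightarrow> f t = f (fst p) + pw k * (t - fst p)"
      "img f p = (f (fst p), f (fst p) + pw k * (snd p - fst p))"
      using adaptedE[OF P p] by metis
    have g: "germ f (fst p) k" by (rule germI[OF k(2)]) (use k(1) in auto)
    have g': "germ f (fst p) i \<longleftrightarrow> i = k" for i using g germ_unique by blast
    have "k = 0 \<or> k = 1 \<or> k = -1" using b[OF g] by auto
    then show ?thesis unfolding g' k(3) by (auto simp: pw_m1 algebra_simps)
  qed
  have "0 = (\<Sum>p\<in>P. (if germ f (fst p) 1 then (lam - 1) * (snd p - fst p) else 0)) +
      (\<Sum>p\<in>P. (if germ f (fst p) (-1) then (1 / lam - 1) * (snd p - fst p) else 0))"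
    unfolding sum.distrib[symmetric] using part_image_sum[OF f P] ev by simp
  also have "(\<Sum>p\<in>P. (if germ f (fst p) 1 then (lam - 1) * (snd p - fst p) else 0)) = (lam - 1) * wa"
    unfolding a(11) sum_distrib_left using fin by (simp add: sum.inter_filter)
  also have "(\<Sum>p\<in>P. (if germ f (fst p) (-1) then (1 / lam - 1) * (snd p - fst p) else 0)) = (1 / lam - 1) * wb"
    unfolding a(12) sum_distrib_left using fin by (simp add: sum.inter_filter)
  also have "(lam - 1) * wa + (1 / lam - 1) * wb = (lam - 1) * (wa - wb / lam)"
    using lam_pos by (simp add: field_simps)
  finally have "wa = wb / lam" using lam_ne1 by simp
  then have wb: "wb = pw 1 * wa" using lam_pos by simp
  \<comment> \<open>This leaves [\<open>\<sigma>\<close>, 2 \<open>\<sigma>\<close>) free for the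
    spare interval that \<open>swp_Img\<close> asks for.\<close>
  have "2 * \<sigma> \<le> \<sigma> * c0" using c0_ge \<sigma>(2) by (simp add: mult.commute mult_left_mono)
  then have s2: "2 * \<sigma> \<le> l" using \<sigma>(3) by simp
  have ok: "swp_ok 0 wa wa 1" unfolding swp_ok_def wb[symmetric] using a(4-8) s2 \<sigma> by auto
  have ok2: "swp_ok \<sigma> wa wa 1" unfolding swp_ok_def wb[symmetric] using a(4-8) s2 \<sigma> by auto
  let ?h = "swp 0 wa wa 1"
  have h: "?h \<in> W" "\<phi> ?h \<in> Img"
    using swp_W[OF ok] swp_Img[OF ok ok2] a(4-8) by auto
  define g where "g = (?h \<circ> \<alpha>) \<circ> finv f"
  have ha: "?h \<circ> \<alpha> \<in> W" "\<phi> (?h \<circ> \<alpha>) \<in> Img" by (intro W_comp Img_comp a(1,2) h)+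
  have gW: "g \<in> W" unfolding g_def using W_comp W_inv[OF f] ha by blast
  have "germ g t 0" for t
  proof -
    define s where "s = finv f t"
    have fs: "f s = t" using W_f_inv[OF f] by (simp add: s_def)
    obtain k where k: "germ f s k" using W_germ[OF f] by blast
    have i: "germ (finv f) t (- k)" using germ_inv[OF W_bij[OF f] k] fs by simp
    have k3: "k = 0 \<or> k = 1 \<or> k = -1" using b[OF k] by auto
    have "germ ?h (\<alpha> s) k"
    proof -
      consider "k = 1" | "k = -1" | "k = 0" using k3 by blast
      then show ?thesis
      proof cases
        case 1
        then have "0 \<le> \<alpha> s" "\<alpha> s < 0 + wa" using a(9)[of s] k by auto
        then show ?thesis using germ_swp1 1 by blast
      next
        case 2
        then have "wa \<le> \<alpha> s" "\<alpha> s < wa + pw 1 * wa" using a(10)[of s] k wb by auto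
        then show ?thesis using germ_swp2[OF ok] 2 by blast
      next
        case 3
        then have n: "\<not> germ f s 1" "\<not> germ f s (-1)" using 3 germ_unique[OF k, of 1] germ_unique[OF k, of "-1"] by auto
        have "\<not> (0 \<le> \<alpha> s \<and> \<alpha> s < 0 + wa)" "\<not> (wa \<le> \<alpha> s \<and> \<alpha> s < wa + pw 1 * wa)"
          using a(9)[of s] a(10)[of s] n wb by auto
        then show ?thesis using germ_swp3[OF ok] 3 by blast
      qed
    qed
    then have "germ (?h \<circ> \<alpha>) s (0 + k)" using germ_comp[OF a(3)] by blast
    then have "germ g t (- k + (0 + k))" unfolding g_def using germ_comp[OF i] s_def by blast
    then show ?thesis by simp
  qed
  then have "\<phi> g \<in> Img" using iet_Img gW by blast
  moreover have "g \<circ> f = ?h \<circ> \<alpha>" unfolding g_def using finv_comp(1)[OF f] by (simp add: comp_assoc)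
  ultimately have "\<phi> f \<in> Img" using Img_cancel[OF f gW] ha by simp
  then show ?thesis .
qed

text \<open>Induction on the largest exponent. After \<open>f\<close>, two swaps send the places
  where \<open>f\<close> has exponent \<open>K\<close> or \<open>-K\<close> to fresh intervals
  beyond the support, weakening these exponents by one. In exchange the fresh intervals, where
  \<open>f\<close> is the identity, acquire exponents 1 and -1.\<close>

lemma small_Img:
  assumes "f \<in> W" "\<sigma> \<in> \<Gamma>" "0 \<le> \<sigma>" "\<sigma> * c0 ^ Suc n \<le> l" "\<And>t. \<sigma> \<le> t \<Longrightarrow> f t = t"
    "\<And>t k. germ f t k \<Longrightarrow> \<bar>k\<bar> \<le> int (Suc n)"
  shows "\<phi> f \<in> Img"
  using assms
proof (induction n arbitrary: f \<sigma>)
  case 0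
  then show ?case by (intro slopes_1_Img[of f \<sigma>]) auto
next
  case (Suc n)
  note f = Suc.prems(1) and \<sigma> = Suc.prems(2,3,5) and le = Suc.prems(4) and b = Suc.prems(6)
  define K where "K = int (Suc (Suc n))"
  have K: "K \<ge> 2" "int (Suc n) = K - 1" by (auto simp: K_def)
  obtain P where P: "adapted f P" using W_adapted[OF f] by blast
  have Kn: "K \<noteq> 0" "- K \<noteq> 0" "K \<noteq> - K" using K by auto
  \<comment> \<open>Gathering is applied to the inverse, since pieces are to be sorted by where
    \<open>f\<close> sends them; exponents change sign accordingly.\<close>
  obtain \<alpha> wa wb where a: "\<alpha> \<in> W" "\<phi> \<alpha> \<in> Img" "\<And>t. germ \<alpha> t 0" "\<And>t. \<sigma> \<le> t \<Longrightarrow> \<alpha> t = t"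
    "wa \<in> \<Gamma>" "wb \<in> \<Gamma>" "0 \<le> wa" "0 \<le> wb" "wa + wb \<le> \<sigma>"
    "\<And>t. 0 \<le> \<alpha> t \<and> \<alpha> t < wa \<longleftrightarrow> germ (finv f) t (- K)" "\<And>t. wa \<le> \<alpha> t \<and> \<alpha> t < wa + wb \<longleftrightarrow> germ (finv f) t K"
  proof -
    have fi: "finv f t = t" if "\<sigma> \<le> t" for t using W_inv_f[OF f, of t] \<sigma>(3)[OF that] by simp
    show ?thesis
      by (rule gather[OF W_inv[OF f] adapted_inv(1)[OF f P] \<sigma>(2) fi Kn(2) Kn(1) Kn(3)[symmetric]])
        (use that in blast)+
  qed
  have gi: "germ (finv f) (f t) (- k) \<longleftrightarrow> germ f t k" for t k
  proof
    assume "germ (finv f) (f t) (- k)"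
    then have "germ (finv (finv f)) (finv f (f t)) (- (- k))" by (rule germ_inv[OF W_bij[OF W_inv[OF f]]])
    then show "germ f t k" using finv_finv[OF f] W_inv_f[OF f] by simp
  qed (rule germ_inv[OF W_bij[OF f]])
  have r1: "0 \<le> \<alpha> (f t) \<and> \<alpha> (f t) < wa \<longleftrightarrow> germ f t K" for t using a(10) gi by simp
  have r2: "wa \<le> \<alpha> (f t) \<and> \<alpha> (f t) < wa + wb \<longleftrightarrow> germ f t (- K)" for t using a(11) gi[of t "- K"] by simp
  define d1 where "d1 = pw (-1) * wa"
  define d2 where "d2 = pw 1 * wb"
  \<comment> \<open>The landing intervals take up at most \<open>\<sigma>\<close> /
    \<open>lam\<close> and \<open>lam\<close> times \<open>\<sigma>\<close>.\<close>
  define \<sigma>' where "\<sigma>' = pw (-1) * \<sigma> + pw 1 * \<sigma> + \<sigma>"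
  have dG: "d1 \<in> \<Gamma>" "d2 \<in> \<Gamma>" "0 \<le> d1" "0 \<le> d2" "\<sigma>' \<in> \<Gamma>"
    using a(5-8) \<sigma> unfolding d1_def d2_def \<sigma>'_def by (auto simp del: pw_1)
  have c0s: "\<sigma>' = \<sigma> * c0" unfolding \<sigma>'_def c0_def by (simp add: pw_m1 algebra_simps)
  have "d1 \<le> pw (-1) * \<sigma>" "d2 \<le> pw 1 * \<sigma>" unfolding d1_def d2_def
    using a(7-9) by (intro mult_left_mono; simp del: pw_1)+
  then have dle: "\<sigma> + d1 + d2 \<le> \<sigma>'" unfolding \<sigma>'_def by linarith
  \<comment> \<open>Beyond the new support there has to be room for the spare interval used by
    \<open>swp_Img\<close>.\<close>
  have c2: "\<sigma>' + \<sigma> \<le> l"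
  proof -
    have "\<sigma> \<le> \<sigma>'" using dle dG by linarith
    then have "\<sigma>' + \<sigma> \<le> \<sigma>' * 2" by simp
    also have "\<dots> \<le> \<sigma>' * c0" using c0_ge \<open>\<sigma> \<le> \<sigma>'\<close> \<sigma>(2) by (intro mult_left_mono) auto
    also have "\<dots> \<le> \<sigma>' * c0 ^ Suc n" using c0_ge \<open>\<sigma> \<le> \<sigma>'\<close> \<sigma>(2)
      by (intro mult_left_mono self_le_power) auto
    also have "\<dots> \<le> l" using le c0s by (simp add: mult.assoc)
    finally show ?thesis .
  qed
  have ok1: "swp_ok 0 \<sigma> wa (-1)" and ok1': "swp_ok \<sigma>' \<sigma> wa (-1)"
    unfolding swp_ok_def d1_def[symmetric] using a(5-9) \<sigma>(1,2) dG dle c2 by auto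
  have ok2: "swp_ok wa (\<sigma> + d1) wb 1" and ok2': "swp_ok \<sigma>' (\<sigma> + d1) wb 1"
    unfolding swp_ok_def d2_def[symmetric] using a(5-9) \<sigma>(1,2) dG dle c2 by auto
  let ?s1 = "swp 0 \<sigma> wa (-1)" and ?s2 = "swp wa (\<sigma> + d1) wb 1"
  have s1: "?s1 \<in> W" "\<phi> ?s1 \<in> Img"
    using swp_W[OF ok1] swp_Img[OF ok1 ok1'] a(5-9) dG dle \<sigma>(2) by auto
  have s2: "?s2 \<in> W" "\<phi> ?s2 \<in> Img"
    using swp_W[OF ok2] swp_Img[OF ok2 ok2'] a(5-9) dG dle \<sigma>(2) by auto
  define g where "g = ?s2 \<circ> (?s1 \<circ> \<alpha>)"
  have g: "g \<in> W" "\<phi> g \<in> Img" unfolding g_def by (intro W_comp Img_comp a(1,2) s1 s2)+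
  have dd: "pw (-1) * wa = d1" "pw 1 * wb = d2" by (simp_all only: d1_def d2_def)
  have s1_fix: "?s1 u = u" if "\<not> (0 \<le> u \<and> u < wa)" "\<not> (\<sigma> \<le> u \<and> u < \<sigma> + d1)" for u
    by (rule swp_3) (use that dd in auto)
  have s2_fix: "?s2 u = u" if "\<not> (wa \<le> u \<and> u < wa + wb)" "\<not> (\<sigma> + d1 \<le> u \<and> u < \<sigma> + d1 + d2)" for u
    by (rule swp_3) (use that dd in auto)
  have s2_germ0: "germ ?s2 u 0" if "\<not> (wa \<le> u \<and> u < wa + wb)" "\<not> (\<sigma> + d1 \<le> u \<and> u < \<sigma> + d1 + d2)" for u
    by (rule germ_swp3[OF ok2]) (use that dd in auto)
  have fix0: "germ f t 0" "f t = t" if "\<alpha> (f t) = u" "\<sigma> \<le> u" for t u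
  proof -
    have "\<alpha> (f t) = \<alpha> u" using a(4)[OF that(2)] that(1) by simp
    then have "f t = u" using W_eq[OF a(1)] by blast
    then have "f t = f u" using \<sigma>(3)[OF that(2)] by simp
    then have "t = u" using W_eq[OF f] by blast
    then show "f t = t" "germ f t 0" using \<open>f t = u\<close> that(2) \<sigma>(3)
      by (simp, intro germ_fix[OF f, of t t "t + 1"]) auto
  qed
  have bound: "\<exists>j. germ (g \<circ> f) t j \<and> \<bar>j\<bar> \<le> K - 1" for t
  proof -
    obtain k where k: "germ f t k" using W_germ[OF f] by blast
    define u where "u = \<alpha> (f t)"
    have kb: "\<bar>k\<bar> \<le> K" using b[OF k] by (simp add: K_def)
    have gk: "germ (g \<circ> f) t (k + (0 + i + j))" if "germ ?s1 u i" "germ ?s2 (?s1 u) j" for i j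
    proof -
      have "germ (?s1 \<circ> \<alpha>) (f t) (0 + i)" by (rule germ_comp[OF a(3)]) (use that(1) u_def in simp)
      then have "germ g (f t) (0 + i + j)" unfolding g_def by (rule germ_comp) (use that(2) u_def in simp)
      then show ?thesis by (rule germ_comp[OF k])
    qed
    \<comment> \<open>A and B are the extreme exponents being lowered, C and D the points that
      arrive from the fresh intervals, E the points that both swaps leave alone.\<close>
    consider (A) "k = K" | (B) "k = - K" | (C) "k \<noteq> K" "k \<noteq> - K" "\<sigma> \<le> u \<and> u < \<sigma> + d1"
      | (D) "k \<noteq> K" "k \<noteq> - K" "\<sigma> + d1 \<le> u \<and> u < \<sigma> + d1 + d2"
      | (E) "k \<noteq> K" "k \<noteq> - K" "\<not> (\<sigma> \<le> u \<and> u < \<sigma> + d1)" "\<not> (\<sigma> + d1 \<le> u \<and> u < \<sigma> + d1 + d2)"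
      by blast
    then show ?thesis
    proof cases
      case A
      then have u: "0 \<le> u" "u < 0 + wa" using r1[of t] k by (auto simp: u_def)
      have "germ ?s1 u (-1)" using germ_swp1[OF u] .
      moreover have s: "\<sigma> \<le> ?s1 u \<and> ?s1 u < \<sigma> + d1"
        using swp_1[OF u, of \<sigma> "-1"] swp_inside1[OF u, of \<sigma> "-1"] dd by simp
      then have "germ ?s2 (?s1 u) 0" using s2_germ0[of "?s1 u"] a(7-9) by auto
      ultimately have "germ (g \<circ> f) t (k + (0 + -1 + 0))" by (rule gk)
      then show ?thesis using A K by (intro exI[of _ "K - 1"]) auto
    next
      case B
      then have u: "wa \<le> u" "u < wa + wb" using r2[of t] k by (auto simp: u_def)
      have nu: "\<not> (0 \<le> u \<and> u < wa)" "\<not> (\<sigma> \<le> u \<and> u < \<sigma> + d1)" using u a(7-9) by auto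
      have "germ ?s1 u 0" by (rule germ_swp3[OF ok1]) (use nu dd in auto)
      moreover have "germ ?s2 (?s1 u) 1" unfolding s1_fix[OF nu] by (rule germ_swp1[OF u])
      ultimately have "germ (g \<circ> f) t (k + (0 + 0 + 1))" by (rule gk)
      then show ?thesis using B K by (intro exI[of _ "1 - K"]) auto
    next
      case C
      have u: "\<sigma> \<le> u" "u < \<sigma> + pw (-1) * wa" using C(3) dd by auto
      have "k = 0" using fix0(1)[OF u_def[symmetric] u(1)] k germ_unique by blast
      have "germ ?s1 u (- (-1))" by (rule germ_swp2[OF ok1 u])
      moreover have s: "0 \<le> ?s1 u \<and> ?s1 u < wa"
        using swp_2[OF ok1 u] swp_inside2[OF u, of 0] by simp
      then have "germ ?s2 (?s1 u) 0" using s2_germ0[of "?s1 u"] a(7-9) dG by auto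
      ultimately have "germ (g \<circ> f) t (k + (0 + - (-1) + 0))" by (rule gk)
      then show ?thesis using \<open>k = 0\<close> K by (intro exI[of _ 1]) auto
    next
      case D
      have u: "\<sigma> + d1 \<le> u" "u < \<sigma> + d1 + pw 1 * wb" using D(3) dd by auto
      have us: "\<sigma> \<le> u" using u dG by simp
      have "k = 0" using fix0(1)[OF u_def[symmetric] us] k germ_unique by blast
      have nu: "\<not> (0 \<le> u \<and> u < wa)" "\<not> (\<sigma> \<le> u \<and> u < \<sigma> + d1)" using u us a(7-9) by auto
      have "germ ?s1 u 0" by (rule germ_swp3[OF ok1]) (use nu dd in auto)
      moreover have "germ ?s2 (?s1 u) (- 1)" unfolding s1_fix[OF nu] by (rule germ_swp2[OF ok2 u])
      ultimately have "germ (g \<circ> f) t (k + (0 + 0 + - 1))" by (rule gk)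
      then show ?thesis using \<open>k = 0\<close> K by (intro exI[of _ "- 1"]) auto
    next
      case E
      have nu: "\<not> (0 \<le> u \<and> u < wa)" using r1[of t] k E(1) germ_unique u_def by blast
      have nu2: "\<not> (wa \<le> u \<and> u < wa + wb)" using r2[of t] k E(2) germ_unique u_def by blast
      have "germ ?s1 u 0" by (rule germ_swp3[OF ok1]) (use nu E dd in auto)
      moreover have "germ ?s2 (?s1 u) 0" unfolding s1_fix[OF nu E(3)] by (rule s2_germ0[OF nu2 E(4)])
      ultimately have "germ (g \<circ> f) t (k + (0 + 0 + 0))" by (rule gk)
      then show ?thesis using E(1,2) kb by (intro exI[of _ k]) auto
    qed
  qed
  have gf: "g \<circ> f \<in> W" using W_comp f g by blast
  have "\<phi> (g \<circ> f) \<in> Img"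
  proof (rule Suc.IH[of "g \<circ> f" \<sigma>'])
    show "g \<circ> f \<in> W" by (rule gf)
    show "\<sigma>' \<in> \<Gamma>" "0 \<le> \<sigma>'" using dG dle \<sigma>(2) by auto
    show "\<sigma>' * c0 ^ Suc n \<le> l" using le c0s by (simp add: mult.assoc)
    show "(g \<circ> f) t = t" if t: "\<sigma>' \<le> t" for t
    proof -
      have ts: "\<sigma> \<le> t" "\<sigma> + d1 + d2 \<le> t" using t dle dG by auto
      have "?s1 t = t" by (rule s1_fix) (use ts dG a(7-9) in auto)
      moreover have "?s2 t = t" by (rule s2_fix) (use ts dG a(7-9) in auto)
      ultimately show ?thesis using \<sigma>(3)[OF ts(1)] a(4)[OF ts(1)] by (simp add: g_def)
    qed
    show "\<bar>j\<bar> \<le> int (Suc n)" if "germ (g \<circ> f) t j" for t j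
      using bound[of t] germ_unique[OF that] K(2) by metis
  qed
  then show ?case using Img_cancel[OF f g] by blast
qed

lemma W_bound:
  assumes f: "f \<in> W"
  shows "\<exists>n. \<forall>t k. germ f t k \<longrightarrow> \<bar>k\<bar> \<le> int (Suc n)"
proof -
  obtain P where P: "adapted f P" using W_adapted[OF f] by blast
  have pt: "part 0 l P" using adapted_part[OF P] .
  have "\<forall>p :: real \<times> real. \<exists>k. germ f (fst p) k" using W_germ[OF f] by blast
  then obtain \<kappa> where \<kappa>: "\<And>p :: real \<times> real. germ f (fst p) (\<kappa> p)" by metis
  define n where "n = nat (\<Sum>p\<in>P. \<bar>\<kappa> p\<bar>)"
  have fin: "finite P" using part_finite[OF pt] .
  have "\<bar>k\<bar> \<le> int (Suc n)" if g: "germ f t k" for t k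
  proof (cases "0 \<le> t \<and> t < l")
    case True
    then obtain p where p: "p \<in> P" "fst p \<le> t" "t < snd p" using part_cover[OF pt] by blast
    then have "k = \<kappa> p" using germ_piece[OF P p] g \<kappa> germ_unique by blast
    moreover have "\<bar>\<kappa> p\<bar> \<le> (\<Sum>p\<in>P. \<bar>\<kappa> p\<bar>)" using fin p(1) by (intro member_le_sum) auto
    ultimately show ?thesis by (simp add: n_def)
  next
    case False
    then have "k = 0" using germ_out[OF f False] g germ_unique by blast
    then show ?thesis by simp
  qed
  then show ?thesis by blast
qed

text \<open>Conjugating by a swap with a tiny interval shrinks the support without changing the slopes.\<close>
lemma fixing_Img:
  assumes f: "f \<in> W" and w: "w \<in> \<Gamma>" "0 < w" "w \<le> l" and fw: "\<And>t. 0 \<le> t \<Longrightarrow> t < w \<Longrightarrow> f t = t"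
  shows "\<phi> f \<in> Img"
proof -
  obtain n where n: "\<And>t k. germ f t k \<Longrightarrow> \<bar>k\<bar> \<le> int (Suc n)" using W_bound[OF f] by blast
  \<comment> \<open>The shrunken support must fit into the fixed interval [0, w) and meet the
    smallness condition of \<open>small_Img\<close>.\<close>
  define e where "e = min w (l / c0 ^ Suc n)"
  have cp: "c0 ^ Suc n > 0" using c0_ge by (intro zero_less_power) linarith
  have "e > 0" using w l_pos cp by (simp add: e_def)
  then obtain q where q: "pw q * (l - w) < e" using pw_small_mult[of e "l - w"] w by auto
  define \<sigma> where "\<sigma> = pw q * (l - w)"
  have \<sigma>: "\<sigma> \<in> \<Gamma>" "0 \<le> \<sigma>" "\<sigma> < w" "\<sigma> \<le> l / c0 ^ Suc n" using w l_in q by (auto simp: \<sigma>_def e_def)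
  have ok: "swp_ok w 0 (l - w) q" unfolding swp_ok_def \<sigma>_def[symmetric] using w l_in \<sigma> by auto
  let ?h = "swp w 0 (l - w) q"
  have h: "?h \<in> W" using swp_W[OF ok] .
  have h1: "?h t = pw q * (t - w)" if "w \<le> t" "t < l" for t using swp_1[of w t "l - w" 0 q] that by simp
  have h2: "?h t = w + pw (- q) * t \<and> w \<le> ?h t \<and> ?h t < l" if "0 \<le> t" "t < \<sigma>" for t
    using swp_2[OF ok, of t] swp_inside2[of 0 t q "l - w" w] that \<sigma>_def by simp
  have h3: "?h t = t" if "\<sigma> \<le> t" "t < w" for t
    by (rule swp_3) (use that \<sigma> \<sigma>_def in auto)
  have frange: "w \<le> f t \<and> f t < l" if "w \<le> t" "t < l" for t
  proof -
    have r: "0 \<le> f t \<and> f t < l" using W_range[OF f, of t] that w by simp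
    moreover have "w \<le> f t"
    proof (rule ccontr)
      assume n: "\<not> w \<le> f t"
      then have "f (f t) = f t" using fw r by simp
      then have "f t = t" using W_eq[OF f] by blast
      then show False using n that by simp
    qed
    ultimately show ?thesis by simp
  qed
  define g where "g = (?h \<circ> f) \<circ> ?h"
  have g: "g \<in> W" unfolding g_def using W_comp h f by blast
  have gfix: "g t = t" if t: "\<sigma> \<le> t" for t
  proof -
    consider "t < w" | "w \<le> t" "t < l" | "l \<le> t" by linarith
    then show ?thesis
    proof cases
      case 1
      then show ?thesis using h3[OF t 1] fw[of t] t \<sigma>(2) by (simp add: g_def)
    next
      case 2
      have "?h t < \<sigma>" using h1[OF 2] 2 by (simp add: \<sigma>_def)
      moreover have "0 \<le> ?h t" using h1[OF 2] 2 by simp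
      ultimately have "f (?h t) = ?h t" using fw \<sigma> by simp
      then show ?thesis using swp_swp[OF ok, of t] by (simp add: g_def)
    next
      case 3
      then show ?thesis using W_out[OF g, of t] by simp
    qed
  qed
  have "\<phi> g \<in> Img"
  proof (rule small_Img[OF g \<sigma>(1,2), of n])
    show "\<sigma> * c0 ^ Suc n \<le> l" using \<sigma>(4) cp by (simp only: pos_le_divide_eq)
    show "g t = t" if "\<sigma> \<le> t" for t using gfix[OF that] .
    show "\<bar>j\<bar> \<le> int (Suc n)" if j: "germ g t j" for t j
    proof (cases "0 \<le> t \<and> t < \<sigma>")
      case True
      define u where "u = ?h t"
      have u: "w \<le> u" "u < l" using h2[of t] True unfolding u_def by blast+
      obtain k where k: "germ f u k" using W_germ[OF f] by blast
      have fu: "w \<le> f u" "f u < w + (l - w)" using frange[OF u] by auto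
      have "germ ?h t (- q)" by (rule germ_swp2[OF ok]) (use True \<sigma>_def in auto)
      moreover have "germ (?h \<circ> f) u (k + q)" by (rule germ_comp[OF k]) (rule germ_swp1[OF fu])
      ultimately have "germ g t (- q + (k + q))" unfolding g_def u_def by (rule germ_comp)
      then have "j = k" using germ_unique[OF j] by simp
      then show ?thesis using n[OF k] by simp
    next
      case False
      have "germ g t 0"
      proof (cases "t < 0")
        case True then show ?thesis using germ_out[OF g, of t] by simp
      next
        case F: False
        show ?thesis by (rule germ_fix[OF g, of t t "t + 1"]) (use F False gfix in auto)
      qed
      then show ?thesis using germ_unique[OF j] by simp
    qed
  qed
  moreover have "\<phi> g = \<phi> f" unfolding g_def using phi_conj_swp[OF f ok] by simp
  ultimately show ?thesis by simp
qed

text \<open>Some short interval is displaced by \<open>f\<close>. Swapping it with its image after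
  \<open>f\<close> makes the product fix it pointwise, and conjugation by a rotation brings it to
  the left end, where \<open>fixing_Img\<close> applies.\<close>

theorem phi_Img:
  assumes f: "f \<in> W"
  shows "\<phi> f \<in> Img"
proof (cases "f = id")
  case True
  show ?thesis unfolding True phi_id by (rule Img_one)
next
  case False
  obtain P where P: "adapted f P" using W_adapted[OF f] by blast
  have pt: "part 0 l P" using adapted_part[OF P] .
  have "\<exists>a b k. a \<in> \<Gamma> \<and> 0 \<le> a \<and> a < b \<and> b \<le> l \<and> f a \<in> \<Gamma> \<and> f a \<noteq> a \<and> (\<forall>t. a \<le> t \<longrightarrow> t < b \<longrightarrow> f t = f a + pw k * (t - a))"
  proof -
    obtain t0 where t0: "f t0 \<noteq> t0" using False by (metis ext id_apply)
    then have "0 \<le> t0 \<and> t0 < l" using W_out[OF f] by blast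
    then obtain p where p: "p \<in> P" "fst p \<le> t0" "t0 < snd p" using part_cover[OF pt] by blast
    obtain k where k: "fst p < snd p" "fst p \<in> \<Gamma>" "f (fst p) \<in> \<Gamma>"
      "\<And>t. fst p \<le> t \<Longrightarrow> t < snd p \<Longrightarrow> f t = f (fst p) + pw k * (t - fst p)" "0 \<le> fst p" "snd p \<le> l"
      using adaptedE[OF P p(1)] by metis
    show ?thesis
    proof (cases "f (fst p) = fst p")
      case F: False
      show ?thesis
        by (intro exI[of _ "fst p"] exI[of _ "snd p"] exI[of _ k] conjI allI impI) (rule k F | assumption)+
    next
      case True
      \<comment> \<open>The left end is fixed although the piece is moved, so the slope is not 1 and
        a point slightly to the right is displaced.\<close>
      have k0: "pw k \<noteq> 1"
      proof
        assume "pw k = 1"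
        then show False using k(4)[OF p(2,3)] True t0 by simp
      qed
      obtain j where j: "pw j < snd p - fst p" using pw_small[of "snd p - fst p"] k(1) by auto
      let ?a = "fst p + pw j"
      have a: "fst p \<le> ?a" "?a < snd p" using j by auto
      have fa: "f ?a = fst p + pw k * pw j" using k(4)[OF a] True by simp
      have h: "f t = f ?a + pw k * (t - ?a)" if "?a \<le> t" "t < snd p" for t
        using k(4)[of t] that a True fa by (simp add: algebra_simps)
      have h2: "f ?a \<noteq> ?a" "f ?a \<in> \<Gamma>" "?a \<in> \<Gamma>" "0 \<le> ?a" unfolding fa using k0 k(2,5) by simp_all
      show ?thesis
        by (intro exI[of _ ?a] exI[of _ "snd p"] exI[of _ k] conjI allI impI) (rule a h h2 k(6) | assumption)+
    qed
  qed
  then obtain a b k where a: "a \<in> \<Gamma>" "0 \<le> a" "a < b" "b \<le> l" "f a \<in> \<Gamma>" "f a \<noteq> a"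
    "\<And>t. a \<le> t \<Longrightarrow> t < b \<Longrightarrow> f t = f a + pw k * (t - a)" by blast
  \<comment> \<open>With this bound [a, a + 2 w) lies in the piece and misses the image of [a, a +
    w); its second half is the spare interval for \<open>swp_Img\<close>.\<close>
  define e where "e = min (b - a) \<bar>f a - a\<bar>"
  have e: "e > 0" using a(3,6) by (simp add: e_def)
  obtain j where j: "pw j * (2 + 2 * pw k) < e" using pw_small_mult[OF e, of "2 + 2 * pw k"] by auto
  define w where "w = pw j"
  have w0: "0 < w" "w \<in> \<Gamma>" by (auto simp: w_def)
  have kw: "0 < pw k * w" using w0 by simp
  have we: "2 * w + 2 * (pw k * w) < e" using j by (simp add: w_def algebra_simps)
  have wb: "a + 2 * w < b" and wf: "2 * w + 2 * (pw k * w) < \<bar>f a - a\<bar>" using we kw by (auto simp: e_def)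
  have "a \<le> a + w" "a + w < b" using w0 wb by auto
  have fr: "0 \<le> f a" "f a + pw k * w \<le> l"
  proof -
    show "0 \<le> f a" using W_range[OF f, of a] a(2-4) by simp
    have "f (a + w) = f a + pw k * w" using a(7)[of "a + w"] w0 wb by simp
    moreover have "f (a + w) < l" using W_range[OF f, of "a + w"] a(2-4) w0 wb by simp
    ultimately show "f a + pw k * w \<le> l" by simp
  qed
  have dis: "a + 2 * w \<le> f a \<or> f a + pw k * w \<le> a" using wf w0(1) kw by linarith
  have ok: "swp_ok a (f a) w k" and ok': "swp_ok (a + w) (f a) w k"
    unfolding swp_ok_def using a(1-5) w0 wb fr dis by auto
  let ?s = "swp a (f a) w k"
  have s: "?s \<in> W" "\<phi> ?s \<in> Img" using swp_W[OF ok] swp_Img[OF ok ok'] by auto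
  define f1 where "f1 = ?s \<circ> f"
  have f1: "f1 \<in> W" unfolding f1_def using W_comp f s by blast
  have f1fix: "f1 t = t" if t: "a \<le> t" "t < a + w" for t
  proof -
    have ft: "f t = f a + pw k * (t - a)" using a(7)[of t] t w0 wb by simp
    have "f a \<le> f t" "f t < f a + pw k * w" using ft t by auto
    then have "?s (f t) = a + pw (- k) * (f t - f a)" by (rule swp_2[OF ok])
    also have "f t - f a = pw k * (t - a)" using ft by simp
    finally show ?thesis by (simp add: f1_def)
  qed
  \<comment> \<open>Conjugation by this rotation carries the fixed interval [a, a + w) to [0,
    w).\<close>
  have rk: "rok 0 a w" unfolding rok_def using a(1-4) w0 wb by auto
  let ?r = "rot 0 a w"
  have ri: "finv ?r = rot 0 w a" using rot_inv[of a w] a(2) w0 by simp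
  define f2 where "f2 = ?r \<circ> f1 \<circ> finv ?r"
  have f2: "f2 \<in> W" unfolding f2_def using W_comp W_inv rok_W[OF rk] f1 by blast
  have "f2 t = t" if t: "0 \<le> t" "t < w" for t
  proof -
    have "rot 0 w a t = t + a" using t by (simp add: rot_def)
    moreover have "f1 (t + a) = t + a" using f1fix[of "t + a"] t by simp
    moreover have "?r (t + a) = t" using t by (simp add: rot_def)
    ultimately show ?thesis unfolding f2_def ri by simp
  qed
  then have "\<phi> f2 \<in> Img" using fixing_Img[OF f2 w0(2,1)] a(2-4) w0 wb by simp
  then have "\<phi> f1 \<in> Img" unfolding f2_def using phi_conj[OF f1 rok_W[OF rk]] by simp
  then show ?thesis unfolding f1_def using Img_cancel[OF f s] by blast
qed

end

text \<open>Bits serve as the field with two elements: sums and products are to stay ring operations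
  instead of becoming Boolean connectives.\<close>

declare add_bit_eq_xor [simp del] mult_bit_eq_and [simp del]

lemma bit_add_self: "(b :: bit) + b = 0"
  by (cases b) simp_all

section \<open>An additive invariant\<close>

context pl
begin

text \<open>An interval function whose defect of additivity is invariant under affine maps yields a
  homomorphism: compare its values on a partition and on the image partition.\<close>
definition affine_defect :: "int \<Rightarrow> (real \<Rightarrow> real \<Rightarrow> int) \<Rightarrow> bool" where
  "affine_defect m E \<longleftrightarrow> (\<forall>a c b a' k. a \<in> \<Gamma> \<longrightarrow> c \<in> \<Gamma> \<longrightarrow> b \<in> \<Gamma> \<longrightarrow> a' \<in> \<Gamma> \<longrightarrow> a < c \<longrightarrow> c < b \<longrightarrow>
     [E a c + E c b - E a b
      = E a' (a' + pw k * (c - a)) + E (a' + pw k * (c - a)) (a' + pw k * (b - a)) - E a' (a' + pw k * (b - a))] (mod m))"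

definition thF :: "(real \<Rightarrow> real \<Rightarrow> int) \<Rightarrow> (real \<Rightarrow> real) \<Rightarrow> real \<times> real \<Rightarrow> int" where
  "thF E f p = E (fst p) (snd p) - E (fst (img f p)) (snd (img f p))"

definition thP :: "(real \<Rightarrow> real \<Rightarrow> int) \<Rightarrow> (real \<Rightarrow> real) \<Rightarrow> (real \<times> real) set \<Rightarrow> int" where
  "thP E f P = (\<Sum>p\<in>P. thF E f p)"

text \<open>The generalised Sah-Arnoux-Fathi invariant. By \<open>theta_cong\<close> the choice of
  the partition matters only up to multiples of the modulus.\<close>

definition theta :: "(real \<Rightarrow> real \<Rightarrow> int) \<Rightarrow> (real \<Rightarrow> real) \<Rightarrow> int" where
  "theta E f = thP E f (SOME P. adapted f P)"

lemma img_sub: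
  assumes "\<And>t. a \<le> t \<Longrightarrow> t < b \<Longrightarrow> f t = f a + pw k * (t - a)" "a \<le> c" "c < d" "d \<le> b"
  shows "img f (c, d) = (f a + pw k * (c - a), f a + pw k * (d - a))"
proof -
  have c: "f c = f a + pw k * (c - a)" by (rule assms(1)) (use assms(2-4) in auto)
  have e: "f t = f c + pw k * (t - c)" if "c \<le> t" "t < d" for t
  proof -
    have "f t = f a + pw k * (t - a)" by (rule assms(1)) (use that assms(2-4) in auto)
    then show ?thesis using c by (simp add: algebra_simps)
  qed
  have "rt f (c, d) = f c + pw k * (d - c)" by (rule rt_eq[OF e assms(3)])
  then show ?thesis using c by (simp add: img_def algebra_simps)
qed

text \<open>The defect of additivity of \<open>E\<close> agrees on a piece and on its affine image,
  hence cancels in their difference.\<close>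

lemma thF_add:
  assumes E: "affine_defect m E" and P: "adapted f P" and p: "p \<in> P"
    and G: "a \<in> \<Gamma>" "b \<in> \<Gamma>" "c \<in> \<Gamma>" and o: "fst p \<le> a" "a < c" "c < b" "b \<le> snd p"
  shows "[thF E f (a, c) + thF E f (c, b) = thF E f (a, b)] (mod m)"
proof -
  obtain k where k: "fst p < snd p" "fst p \<in> \<Gamma>" "f (fst p) \<in> \<Gamma>"
    "\<And>t. fst p \<le> t \<Longrightarrow> t < snd p \<Longrightarrow> f t = f (fst p) + pw k * (t - fst p)"
    using adaptedE[OF P p] by metis
  define a' where "a' = f (fst p) + pw k * (a - fst p)"
  have a': "a' \<in> \<Gamma>" using k(2,3) G by (simp add: a'_def)
  have i: "img f (u, v) = (a' + pw k * (u - a), a' + pw k * (v - a))" if "fst p \<le> u" "u < v" "v \<le> snd p" for u v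
    using img_sub[OF k(4) that] by (simp add: a'_def algebra_simps)
  have "[E a c + E c b - E a b
      = E a' (a' + pw k * (c - a)) + E (a' + pw k * (c - a)) (a' + pw k * (b - a)) - E a' (a' + pw k * (b - a))] (mod m)"
    using E G a' o unfolding affine_defect_def by blast
  then have "m dvd (E a c + E c b - E a b) -
     (E a' (a' + pw k * (c - a)) + E (a' + pw k * (c - a)) (a' + pw k * (b - a)) - E a' (a' + pw k * (b - a)))"
    by (simp add: cong_iff_dvd_diff)
  moreover have "(E a c + E c b - E a b) -
     (E a' (a' + pw k * (c - a)) + E (a' + pw k * (c - a)) (a' + pw k * (b - a)) - E a' (a' + pw k * (b - a)))
     = thF E f (a, c) + thF E f (c, b) - thF E f (a, b)"
    using i[of a c] i[of c b] i[of a b] o by (simp add: thF_def)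
  ultimately show ?thesis by (simp add: cong_iff_dvd_diff)
qed

text \<open>Intersection of two pieces. It may come out reversed, meaning empty, so sums over cuts
  test the order of the ends.\<close>

definition cut :: "real \<times> real \<Rightarrow> real \<times> real \<Rightarrow> real \<times> real" where
  "cut p q = (max (fst p) (fst q), min (snd p) (snd q))"

lemma cut_comm: "cut p q = cut q p" by (simp add: cut_def max.commute min.commute)

lemma thF_cut:
  assumes E: "affine_defect m E" and P: "adapted f P" and p: "p \<in> P"
    and Q: "part 0 l Q" and QG: "\<And>q. q \<in> Q \<Longrightarrow> fst q \<in> \<Gamma> \<and> snd q \<in> \<Gamma>"
  shows "[thF E f p = (\<Sum>q\<in>Q. if fst (cut p q) < snd (cut p q) then thF E f (cut p q) else 0)] (mod m)"
proof -
  have pb: "fst p < snd p" "0 \<le> fst p" "snd p \<le> l" "fst p \<in> \<Gamma>" "snd p \<in> \<Gamma>"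
    using part_less[OF adapted_part[OF P] p] part_bounds[OF adapted_part[OF P] p] adapted_ends[OF P p] by auto
  \<comment> \<open>The value on the part of p to the left of u: a primitive whose increments over
    the pieces of \<open>Q\<close> telescope.\<close>
  define h where "h u = (if u \<le> fst p then 0 else if snd p \<le> u then thF E f p else thF E f (fst p, u))" for u
  have "thF E f p = h l - h 0" using pb by (simp add: h_def)
  also have "\<dots> = (\<Sum>q\<in>Q. h (snd q) - h (fst q))" using part_telescope[OF Q, of h] l_pos by simp
  also have "[\<dots> = (\<Sum>q\<in>Q. if fst (cut p q) < snd (cut p q) then thF E f (cut p q) else 0)] (mod m)"
  proof (rule cong_sum)
    fix q assume q: "q \<in> Q"
    have ql: "fst q < snd q" using part_less[OF Q q] .
    show "[h (snd q) - h (fst q) = (if fst (cut p q) < snd (cut p q) then thF E f (cut p q) else 0)] (mod m)"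
    proof (cases "snd q \<le> fst p \<or> snd p \<le> fst q")
      case True
      then show ?thesis using ql pb by (auto simp: h_def cut_def)
    next
      case False
      define lo hi where "lo = max (fst p) (fst q)" "hi = min (snd p) (snd q)"
      have lh: "lo < hi" "fst p \<le> lo" "hi \<le> snd p" "lo \<in> \<Gamma>" "hi \<in> \<Gamma>"
        using False ql pb QG[OF q] unfolding lo_hi_def by (auto simp: max_def min_def)
      have pp: "thF E f (fst p, snd p) = thF E f p" by simp
      have hh: "h (snd q) = thF E f (fst p, hi)"
        using False ql pb pp unfolding h_def lo_hi_def by (auto simp: min_def)
      have "[thF E f (fst p, hi) - h (fst q) = thF E f (lo, hi)] (mod m)"
      proof (cases "fst q \<le> fst p")
        case True
        then show ?thesis by (simp add: h_def lo_hi_def)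
      next
        case F: False
        then have "h (fst q) = thF E f (fst p, lo)" using False by (simp add: h_def lo_hi_def)
        moreover have "[thF E f (fst p, lo) + thF E f (lo, hi) = thF E f (fst p, hi)] (mod m)"
          by (rule thF_add[OF E P p]) (use lh pb F in \<open>auto simp: lo_hi_def\<close>)
        ultimately show ?thesis by (simp add: cong_iff_dvd_diff dvd_diff_commute algebra_simps)
      qed
      moreover have "cut p q = (lo, hi)" by (simp add: cut_def lo_hi_def)
      ultimately show ?thesis using hh lh by simp
    qed
  qed
  finally show ?thesis .
qed

text \<open>Modulo m both sums equal the sum over all intersections of a piece of \<open>P\<close>
  with a piece of \<open>Q\<close>.\<close>

lemma thP_indep:
  assumes E: "affine_defect m E" and P: "adapted f P" and Q: "adapted f Q"
  shows "[thP E f P = thP E f Q] (mod m)"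
proof -
  let ?G = "\<lambda>p q. if fst (cut p q) < snd (cut p q) then thF E f (cut p q) else 0"
  have "[thP E f P = (\<Sum>p\<in>P. \<Sum>q\<in>Q. ?G p q)] (mod m)" unfolding thP_def
    by (rule cong_sum) (rule thF_cut[OF E P _ adapted_part[OF Q] adapted_ends[OF Q]])
  also have "(\<Sum>p\<in>P. \<Sum>q\<in>Q. ?G p q) = (\<Sum>q\<in>Q. \<Sum>p\<in>P. ?G q p)"
    by (subst sum.swap) (simp only: cut_comm)
  also have "[\<dots> = thP E f Q] (mod m)" unfolding thP_def
    by (rule cong_sum, rule cong_sym) (rule thF_cut[OF E Q _ adapted_part[OF P] adapted_ends[OF P]])
  finally show ?thesis .
qed

lemma theta_cong:
  assumes E: "affine_defect m E" and P: "adapted f P"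
  shows "[theta E f = thP E f P] (mod m)"
  unfolding theta_def by (rule thP_indep[OF E _ P]) (rule someI[of "adapted f", OF P])

lemma theta_comp:
  assumes E: "affine_defect m E" and f: "f \<in> W" and g: "g \<in> W"
  shows "[theta E (g \<circ> f) = theta E f + theta E g] (mod m)"
proof -
  obtain P where P: "adapted f P" "adapted g (img f ` P)" using common_adapted[OF f g] .
  have "thP E (g \<circ> f) P = thP E f P + thP E g (img f ` P)"
    unfolding thP_def sum.reindex[OF adapted_inv(2)[OF f P(1)]] sum.distrib[symmetric]
    by (rule sum.cong[OF refl]) (simp add: thF_def img_comp(1)[OF P])
  then show ?thesis
    using theta_cong[OF E comp_adapted[OF P]] theta_cong[OF E P(1)] theta_cong[OF E P(2)]
    by (metis cong_add cong_sym cong_trans)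
qed

lemma rot_adapted:
  assumes "a \<in> \<Gamma>" "x \<in> \<Gamma>" "y \<in> \<Gamma>" "0 < a" "0 < x" "0 < y" "a + x + y < l"
  shows "adapted (rot a x y) {(0, a), (a, a + x), (a + x, a + x + y), (a + x + y, l)}"
    "img (rot a x y) (0, a) = (0, a)" "img (rot a x y) (a, a + x) = (a + y, a + x + y)"
    "img (rot a x y) (a + x, a + x + y) = (a, a + y)" "img (rot a x y) (a + x + y, l) = (a + x + y, l)"
proof -
  let ?r = "rot a x y"
  have e: "?r t = ?r 0 + pw 0 * (t - 0)" if "0 \<le> t" "t < a" for t using that assms by (simp add: rot_def)
  have e2: "?r t = ?r a + pw 0 * (t - a)" if "a \<le> t" "t < a + x" for t using that assms by (simp add: rot_def)
  have e3: "?r t = ?r (a + x) + pw 0 * (t - (a + x))" if "a + x \<le> t" "t < a + x + y" for t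
    using that assms by (simp add: rot_def)
  have e4: "?r t = ?r (a + x + y) + pw 0 * (t - (a + x + y))" if "a + x + y \<le> t" "t < l" for t
    using that assms by (simp add: rot_def)
  have v: "?r 0 = 0" "?r a = a + y" "?r (a + x) = a" "?r (a + x + y) = a + x + y"
    using assms by (auto simp: rot_def)
  have ab: "a < a + x" "a + x < a + x + y" using assms by auto
  show "img ?r (0, a) = (0, a)" using rt_eq[OF e assms(4)] v by (simp add: img_def)
  show "img ?r (a, a + x) = (a + y, a + x + y)" using rt_eq[OF e2 ab(1)] v by (simp add: img_def)
  show "img ?r (a + x, a + x + y) = (a, a + y)" using rt_eq[OF e3 ab(2)] v by (simp add: img_def)
  show "img ?r (a + x + y, l) = (a + x + y, l)" using rt_eq[OF e4 assms(7)] v by (simp add: img_def)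
  have aff: "aff ?r (0, a)" "aff ?r (a, a + x)" "aff ?r (a + x, a + x + y)" "aff ?r (a + x + y, l)"
    unfolding aff_def fst_conv snd_conv using e e2 e3 e4 by blast+
  have pt: "part 0 l {(0, a), (a, a + x), (a + x, a + x + y), (a + x + y, l)}"
  proof (rule partI)
    fix t :: real assume "0 \<le> t" "t < l"
    then show "\<exists>p\<in>{(0, a), (a, a + x), (a + x, a + x + y), (a + x + y, l)}. fst p \<le> t \<and> t < snd p"
      by (simp; linarith)
  next
    fix p t assume "p \<in> {(0, a), (a, a + x), (a + x, a + x + y), (a + x + y, l)}" "fst p \<le> t" "t < snd p"
    then show "0 \<le> t \<and> t < l" using assms(4-7) by auto
  next
    fix p q t assume "p \<in> {(0, a), (a, a + x), (a + x, a + x + y), (a + x + y, l)}"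
      "q \<in> {(0, a), (a, a + x), (a + x, a + x + y), (a + x + y, l)}"
      "fst p \<le> t" "t < snd p" "fst q \<le> t" "t < snd q"
    then show "p = q" using assms(4-7) by auto
  qed (use assms(4-7) in auto)
  show "adapted ?r {(0, a), (a, a + x), (a + x, a + x + y), (a + x + y, l)}"
    unfolding adapted_def using pt aff v assms(1-3) l_in by auto
qed

lemma theta_rot:
  assumes E: "affine_defect m E"
    and r: "a \<in> \<Gamma>" "x \<in> \<Gamma>" "y \<in> \<Gamma>" "0 < a" "0 < x" "0 < y" "a + x + y < l"
  shows "[theta E (rot a x y) = E a (a + x) - E (a + y) (a + x + y) + E (a + x) (a + x + y) - E a (a + y)] (mod m)"
proof -
  have "thP E (rot a x y) {(0, a), (a, a + x), (a + x, a + x + y), (a + x + y, l)}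
     = E a (a + x) - E (a + y) (a + x + y) + E (a + x) (a + x + y) - E a (a + y)"
    using r rot_adapted(2-5)[OF r] by (simp add: thP_def thF_def)
  then show ?thesis using theta_cong[OF E rot_adapted(1)[OF r]] by simp
qed

section \<open>The sign\<close>

definition wt :: "(real \<Rightarrow> bit) \<Rightarrow> bool" where
  "wt e \<longleftrightarrow> (\<forall>x\<in>\<Gamma>. \<forall>y\<in>\<Gamma>. e (x + y) = e x + e y) \<and> (\<forall>k. \<forall>x\<in>\<Gamma>. e (pw k * x) = e x)"

definition invp :: "(real \<Rightarrow> real) \<Rightarrow> real \<Rightarrow> real \<Rightarrow> bit" where
  "invp f x y = (if x < y \<and> f y < f x then 1 else 0)"

text \<open>The parity of the number of inversions, each pair of pieces counted with the product of
  the weights of its lengths. With all weights 1 it is the sign of a permutation.\<close>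

definition sgP :: "(real \<Rightarrow> bit) \<Rightarrow> (real \<Rightarrow> real) \<Rightarrow> (real \<times> real) set \<Rightarrow> bit" where
  "sgP e f P = (\<Sum>p\<in>P. \<Sum>q\<in>P. invp f (fst p) (fst q) * (e (snd p - fst p) * e (snd q - fst q)))"

definition sgn_pl :: "(real \<Rightarrow> bit) \<Rightarrow> (real \<Rightarrow> real) \<Rightarrow> bit" where
  "sgn_pl e f = sgP e f (SOME P. adapted f P)"

text \<open>Distinct pieces have disjoint intervals as images and a single piece is mapped
  increasingly, so whether two points are inverted depends on their pieces alone.\<close>

lemma invp_piece:
  assumes f: "f \<in> W" and P: "adapted f P" and p: "p \<in> P" "fst p \<le> x" "x < snd p"
    and q: "q \<in> P" "fst q \<le> y" "y < snd q"
  shows "invp f x y = invp f (fst p) (fst q)"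
proof (cases "p = q")
  case True
  obtain k where k: "\<And>t. fst p \<le> t \<Longrightarrow> t < snd p \<Longrightarrow> f t = f (fst p) + pw k * (t - fst p)"
    using adaptedE[OF P p(1)] by metis
  have "f x = f (fst p) + pw k * (x - fst p)" "f y = f (fst p) + pw k * (y - fst p)"
    using k[of x] k[of y] p q True by auto
  then have "f y - f x = pw k * (y - x)" by (simp add: algebra_simps)
  then have "x < y \<Longrightarrow> f x < f y" using pw_pos[of k] by (smt (verit) mult_pos_pos)
  then show ?thesis using True by (auto simp: invp_def)
next
  case False
  have pt: "part 0 l P" using adapted_part[OF P] .
  have pi: "part 0 l (img f ` P)" using adapted_part[OF adapted_inv(1)[OF f P]] .
  have ne: "fst p \<noteq> fst q" using part_fst_inj[OF pt p(1) q(1)] False by blast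
  have o: "x < y \<longleftrightarrow> fst p < fst q"
    using part_order[OF pt p(1) q(1)] part_order[OF pt q(1) p(1)] ne p q by linarith
  have fin: "f (fst r) \<le> f t \<and> f t < snd (img f r)" if r: "r \<in> P" "fst r \<le> t" "t < snd r" for r t
  proof -
    obtain k where k: "\<And>t. fst r \<le> t \<Longrightarrow> t < snd r \<Longrightarrow> f t = f (fst r) + pw k * (t - fst r)"
      "img f r = (f (fst r), f (fst r) + pw k * (snd r - fst r))"
      using adaptedE[OF P r(1)] by metis
    show ?thesis using k(1)[OF r(2,3)] k(2) r by simp
  qed
  have fi: "fst (img f r) = f (fst r)" for r by (simp add: img_def)
  have i: "img f p \<in> img f ` P" "img f q \<in> img f ` P" using p q by auto
  have ne': "f (fst p) \<noteq> f (fst q)" using ne W_eq[OF f] by blast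
  have "f y < f x \<longleftrightarrow> f (fst q) < f (fst p)"
    using part_order[OF pi i(1,2)] part_order[OF pi i(2,1)] fin[OF p] fin[OF q] ne' fi by (smt (verit))
  then show ?thesis using o by (simp add: invp_def)
qed

lemma wt_cut:
  assumes e: "wt e" and P: "part 0 l P" and p: "p \<in> P" "fst p \<in> \<Gamma>" "snd p \<in> \<Gamma>"
    and Q: "part 0 l Q" and QG: "\<And>q. q \<in> Q \<Longrightarrow> fst q \<in> \<Gamma> \<and> snd q \<in> \<Gamma>"
  shows "e (snd p - fst p) = (\<Sum>q\<in>Q. if fst (cut p q) < snd (cut p q) then e (snd (cut p q) - fst (cut p q)) else 0)"
proof -
  have pb: "fst p < snd p" "0 \<le> fst p" "snd p \<le> l" using part_less[OF P p(1)] part_bounds[OF P p(1)] by auto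
  \<comment> \<open>Clamping to p makes the increment over a piece q the length of its intersection
    with p.\<close>
  define c where "c u = max (fst p) (min (snd p) u)" for u
  have cG: "c u \<in> \<Gamma>" if "u \<in> \<Gamma>" for u using p that by (simp add: c_def max_def min_def)
  have sub: "e (x - y) = e x - e y" if "x \<in> \<Gamma>" "y \<in> \<Gamma>" for x y
  proof -
    have "e ((x - y) + y) = e (x - y) + e y" using e that G_diff unfolding wt_def by blast
    then show ?thesis by simp
  qed
  have "e (snd p - fst p) = e (c l) - e (c 0)" using sub p pb by (simp add: c_def)
  also have "\<dots> = (\<Sum>q\<in>Q. e (c (snd q)) - e (c (fst q)))" using part_telescope[OF Q, of "\<lambda>u. e (c u)"] l_pos by simp
  also have "\<dots> = (\<Sum>q\<in>Q. if fst (cut p q) < snd (cut p q) then e (snd (cut p q) - fst (cut p q)) else 0)"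
  proof (rule sum.cong[OF refl])
    fix q assume q: "q \<in> Q"
    have ql: "fst q < snd q" using part_less[OF Q q] .
    have s: "e (c (snd q)) - e (c (fst q)) = e (c (snd q) - c (fst q))" using sub cG QG[OF q] by simp
    show "e (c (snd q)) - e (c (fst q)) = (if fst (cut p q) < snd (cut p q) then e (snd (cut p q) - fst (cut p q)) else 0)"
    proof (cases "fst (cut p q) < snd (cut p q)")
      case True
      then have "c (snd q) = snd (cut p q)" "c (fst q) = fst (cut p q)"
        using pb ql by (auto simp: cut_def c_def max_def min_def split: if_splits)
      then show ?thesis using True s by simp
    next
      case False
      then have "c (snd q) = c (fst q)" using pb ql by (auto simp: cut_def c_def max_def min_def split: if_splits)
      then show ?thesis using False by simp
    qed
  qed
  finally show ?thesis .
qed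

text \<open>As in \<open>thP_indep\<close>, both sides become one sum over pairs of intersections:
  cutting a piece leaves its inversions unchanged, and the weights of the parts add up.\<close>

lemma sgP_indep:
  assumes e: "wt e" and f: "f \<in> W" and P: "adapted f P" and Q: "adapted f Q"
  shows "sgP e f P = sgP e f Q"
proof -
  define ee where "ee p q = (if fst (cut p q) < snd (cut p q) then e (snd (cut p q) - fst (cut p q)) else 0)" for p q
  define T where "T p q p' q' = invp f (fst (cut p q)) (fst (cut p' q')) * (ee p q * ee p' q')" for p q p' q'
  have main: "sgP e f P = (\<Sum>pp\<in>P\<times>P. \<Sum>qq\<in>Q\<times>Q. T (fst pp) (fst qq) (snd pp) (snd qq))"
    if P: "adapted f P" and Q: "adapted f Q" for P Q
  proof -
    have pt: "part 0 l P" "part 0 l Q" using adapted_part P Q by blast+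
    have c: "e (snd p - fst p) = (\<Sum>q\<in>Q. ee p q)" if "p \<in> P" for p unfolding ee_def
      using wt_cut[OF e pt(1) that _ _ pt(2)] adapted_ends[OF P that] adapted_ends[OF Q] by blast
    have t: "invp f (fst p) (fst p') * (ee p q * ee p' q') = T p q p' q'"
      if "p \<in> P" "p' \<in> P" "q \<in> Q" "q' \<in> Q" for p p' q q'
    proof (cases "fst (cut p q) < snd (cut p q) \<and> fst (cut p' q') < snd (cut p' q')")
      case True
      have "invp f (fst (cut p q)) (fst (cut p' q')) = invp f (fst p) (fst p')"
        by (rule invp_piece[OF f P that(1) _ _ that(2)]) (use True in \<open>auto simp: cut_def\<close>)
      then show ?thesis by (simp add: T_def)
    next
      case False
      then show ?thesis by (auto simp: T_def ee_def)
    qed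
    have "sgP e f P = (\<Sum>p\<in>P. \<Sum>p'\<in>P. \<Sum>q\<in>Q. \<Sum>q'\<in>Q. invp f (fst p) (fst p') * (ee p q * ee p' q'))"
      unfolding sgP_def
    proof (intro sum.cong refl)
      fix p p' assume "p \<in> P" "p' \<in> P"
      then show "invp f (fst p) (fst p') * (e (snd p - fst p) * e (snd p' - fst p'))
        = (\<Sum>q\<in>Q. \<Sum>q'\<in>Q. invp f (fst p) (fst p') * (ee p q * ee p' q'))"
        by (simp only: c sum_product) (simp only: sum_distrib_left)
    qed
    also have "\<dots> = (\<Sum>p\<in>P. \<Sum>p'\<in>P. \<Sum>q\<in>Q. \<Sum>q'\<in>Q. T p q p' q')"
      by (intro sum.cong refl) (rule t)
    also have "\<dots> = (\<Sum>pp\<in>P\<times>P. \<Sum>qq\<in>Q\<times>Q. T (fst pp) (fst qq) (snd pp) (snd qq))"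
      by (intro trans[OF sum.cartesian_product] sum.cong refl, simp only: case_prod_unfold,
          rule trans[OF sum.cartesian_product]) (simp only: case_prod_unfold)
    finally show ?thesis .
  qed
  have "T p q p' q' = T q p q' p'" for p q p' q' by (simp add: T_def ee_def cut_comm)
  then have "(\<Sum>pp\<in>P\<times>P. \<Sum>qq\<in>Q\<times>Q. T (fst pp) (fst qq) (snd pp) (snd qq))
     = (\<Sum>qq\<in>Q\<times>Q. \<Sum>pp\<in>P\<times>P. T (fst qq) (fst pp) (snd qq) (snd pp))"
    by (subst sum.swap) (intro sum.cong refl)
  then show ?thesis using main[OF P Q] main[OF Q P] by simp
qed

lemma sgn_eq:
  assumes "wt e" "f \<in> W" "adapted f P"
  shows "sgn_pl e f = sgP e f P"
  unfolding sgn_pl_def using sgP_indep[OF assms(1,2) _ assms(3)] someI[of "adapted f", OF assms(3)] by blast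

text \<open>The terms at (p, q) and (q, p) cancel. This stands in for a sum over unordered
  pairs.\<close>

lemma sum_antisym_bit:
  fixes D :: "'a \<Rightarrow> 'a \<Rightarrow> bit"
  assumes "finite P" "\<And>p. p \<in> P \<Longrightarrow> D p p = 0" "\<And>p q. p \<in> P \<Longrightarrow> q \<in> P \<Longrightarrow> D p q + D q p = 0"
  shows "(\<Sum>p\<in>P. \<Sum>q\<in>P. D p q) = 0"
  using assms
proof (induction P rule: finite_induct)
  case (insert x F)
  have "(\<Sum>p\<in>insert x F. \<Sum>q\<in>insert x F. D p q)
     = D x x + (\<Sum>q\<in>F. D x q + D q x) + (\<Sum>p\<in>F. \<Sum>q\<in>F. D p q)"
    using insert(1,2) by (simp add: sum.distrib add_ac)
  also have "(\<Sum>q\<in>F. D x q + D q x) = 0" using insert.prems by (intro sum.neutral) auto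
  also have "(\<Sum>p\<in>F. \<Sum>q\<in>F. D p q) = 0" using insert by auto
  finally show ?case using insert.prems by simp
qed simp

text \<open>For an unordered pair of pieces, being reversed by \<open>g \<circ> f\<close> is the sum
  modulo 2 of being reversed by \<open>f\<close> and then by \<open>g\<close>. Scale invariance of
  the weight makes the image pieces count like the original ones.\<close>

lemma sgn_comp:
  assumes e: "wt e" and f: "f \<in> W" and g: "g \<in> W"
  shows "sgn_pl e (g \<circ> f) = sgn_pl e f + sgn_pl e g"
proof -
  obtain P where P: "adapted f P" "adapted g (img f ` P)" using common_adapted[OF f g] .
  have pt: "part 0 l P" using adapted_part[OF P(1)] .
  have w: "e (snd (img f p) - fst (img f p)) = e (snd p - fst p)" if p: "p \<in> P" for p
  proof -
    obtain k where k: "img f p = (f (fst p), f (fst p) + pw k * (snd p - fst p))" "fst p \<in> \<Gamma>" "snd p \<in> \<Gamma>"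
      using adaptedE[OF P(1) p] by metis
    then show ?thesis using e unfolding wt_def by simp
  qed
  define \<omega> where "\<omega> p q = e (snd p - fst p) * e (snd q - fst q)" for p q :: "real \<times> real"
  have fi: "fst (img f p) = f (fst p)" for p by (simp add: img_def)
  have g': "sgP e g (img f ` P) = (\<Sum>p\<in>P. \<Sum>q\<in>P. invp g (f (fst p)) (f (fst q)) * \<omega> p q)"
    unfolding sgP_def sum.reindex[OF adapted_inv(2)[OF f P(1)]] \<omega>_def
    by (intro sum.cong refl) (simp add: w[unfolded fi] fi)
  define D where "D p q = (invp (g \<circ> f) (fst p) (fst q) + invp f (fst p) (fst q) + invp g (f (fst p)) (f (fst q))) * \<omega> p q" for p q
  have "(\<Sum>p\<in>P. \<Sum>q\<in>P. D p q) = 0"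
  proof (rule sum_antisym_bit[OF part_finite[OF pt]])
    show "D p p = 0" for p by (simp add: D_def invp_def)
    fix p q assume pq: "p \<in> P" "q \<in> P"
    show "D p q + D q p = 0"
    proof (cases "p = q")
      case True then show ?thesis by (simp add: D_def invp_def)
    next
      case False
      then have n: "fst p \<noteq> fst q" using part_fst_inj[OF pt pq] by blast
      then have n2: "f (fst p) \<noteq> f (fst q)" using W_eq[OF f] by blast
      then have n3: "g (f (fst p)) \<noteq> g (f (fst q))" using W_eq[OF g] by blast
      have \<omega>s: "\<omega> q p = \<omega> p q" by (simp add: \<omega>_def mult.commute)
      have "D p q + D q p = (invp (g \<circ> f) (fst p) (fst q) + invp f (fst p) (fst q) + invp g (f (fst p)) (f (fst q))
         + (invp (g \<circ> f) (fst q) (fst p) + invp f (fst q) (fst p) + invp g (f (fst q)) (f (fst p)))) * \<omega> p q"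
        by (simp add: D_def \<omega>s distrib_right)
      also have "invp (g \<circ> f) (fst p) (fst q) + invp f (fst p) (fst q) + invp g (f (fst p)) (f (fst q))
         + (invp (g \<circ> f) (fst q) (fst p) + invp f (fst q) (fst p) + invp g (f (fst q)) (f (fst p))) = 0"
        using n n2 n3 by (cases "fst p < fst q"; cases "f (fst p) < f (fst q)"; cases "g (f (fst p)) < g (f (fst q))")
          (auto simp: invp_def)
      finally show ?thesis by simp
    qed
  qed
  then have "sgP e (g \<circ> f) P + sgP e f P + sgP e g (img f ` P) = 0"
    unfolding g' unfolding D_def sgP_def by (simp add: \<omega>_def distrib_right sum.distrib)
  then have "sgP e (g \<circ> f) P + (sgP e f P + sgP e g (img f ` P)) + (sgP e f P + sgP e g (img f ` P))
      = sgP e f P + sgP e g (img f ` P)" by (simp add: add.assoc)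
  then have "sgP e (g \<circ> f) P = sgP e f P + sgP e g (img f ` P)"
    by (simp only: add.assoc bit_add_self add_0_right)
  then show ?thesis
    using sgn_eq[OF e f P(1)] sgn_eq[OF e g P(2)] sgn_eq[OF e W_comp[OF f g] comp_adapted[OF P]] by simp
qed

lemma sgn_rot:
  assumes e: "wt e"
    and r: "a \<in> \<Gamma>" "x \<in> \<Gamma>" "y \<in> \<Gamma>" "0 < a" "0 < x" "0 < y" "a + x + y < l"
  shows "sgn_pl e (rot a x y) = e x * e y"
proof -
  have W: "rot a x y \<in> W" using rot_W[of a x y] r by simp
  have v: "rot a x y 0 = 0" "rot a x y a = a + y" "rot a x y (a + x) = a" "rot a x y (a + x + y) = a + x + y"
    using r by (auto simp: rot_def)
  have "sgP e (rot a x y) {(0, a), (a, a + x), (a + x, a + x + y), (a + x + y, l)} = e x * e y"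
    using r v by (simp add: sgP_def invp_def)
  then show ?thesis using sgn_eq[OF e W rot_adapted(1)[OF r]] by simp
qed

end

section \<open>Additive functions on the Laurent ring\<close>

locale pl_poly = pl lam l for lam l :: real +
  fixes f :: "int poly"
  assumes minp: "minimal_polynomial lam (map_poly of_int f)"
begin

definition ev :: "int poly \<Rightarrow> real" where "ev p = poly (map_poly of_int p) lam"

lemma of_rat_of_int_poly: "map_poly of_rat (map_poly of_int p :: rat poly) = (map_poly of_int p :: real poly)"
  by (rule poly_eqI) (simp add: coeff_map_poly)

lemma monic: "lead_coeff f = 1"
proof -
  have "degree (map_poly of_int f :: rat poly) = degree f" by (rule degree_map_poly) simp
  moreover have "lead_coeff (map_poly of_int f :: rat poly) = 1" using minp unfolding minimal_polynomial_def by simp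
  ultimately show ?thesis by (simp add: coeff_map_poly)
qed

lemma ev_f: "ev f = 0"
  using minp unfolding minimal_polynomial_def of_rat_of_int_poly ev_def by simp

lemma ev_min: assumes "ev p = 0" "p \<noteq> 0" shows "degree f \<le> degree p"
proof -
  let ?q = "map_poly of_int p :: rat poly"
  have "?q \<noteq> 0" using assms(2) by (metis coeff_map_poly leading_coeff_0_iff of_int_0 of_int_eq_0_iff coeff_0)
  moreover have "poly (map_poly of_rat ?q) lam = 0" using assms(1) unfolding of_rat_of_int_poly ev_def .
  ultimately have "degree (map_poly of_int f :: rat poly) \<le> degree ?q"
    using minp unfolding minimal_polynomial_def by blast
  moreover have "degree (map_poly of_int f :: rat poly) = degree f" "degree ?q = degree p"
    by (rule degree_map_poly; simp)+
  ultimately show ?thesis by simp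
qed

lemma ev_sum: "ev p = (\<Sum>i\<le>degree p. of_int (coeff p i) * lam ^ i)"
proof -
  have "degree (map_poly of_int p :: real poly) = degree p" by (rule degree_map_poly) simp
  then show ?thesis unfolding ev_def poly_altdef by (simp add: coeff_map_poly)
qed

lemma ev_add: "ev (p + q) = ev p + ev q"
proof -
  have "map_poly of_int (p + q) = (map_poly of_int p + map_poly of_int q :: real poly)"
    by (rule poly_eqI) (simp add: coeff_map_poly)
  then show ?thesis by (simp add: ev_def)
qed

lemma ev_smult: "ev (smult c q) = of_int c * ev q"
proof -
  have "map_poly of_int (smult c q) = (smult (of_int c) (map_poly of_int q) :: real poly)"
    by (rule poly_eqI) (simp add: coeff_map_poly)
  then show ?thesis by (simp add: ev_def)
qed

lemma ev_pCons: "ev (pCons a q) = of_int a + lam * ev q"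
proof -
  have "map_poly of_int (pCons a q) = (pCons (of_int a) (map_poly of_int q) :: real poly)"
    by (rule poly_eqI) (simp add: coeff_map_poly coeff_pCons split: nat.split)
  then show ?thesis by (simp add: ev_def)
qed

lemma ev_mult_f: "ev (f * q) = 0"
proof (induction q)
  case (pCons a q)
  have "f * pCons a q = smult a f + pCons 0 (f * q)" by simp
  then have "ev (f * pCons a q) = ev (smult a f) + ev (pCons 0 (f * q))" by (simp only: ev_add)
  then show ?case using pCons by (simp add: ev_smult ev_pCons ev_f)
qed (simp add: ev_def)

text \<open>As \<open>f\<close> is monic, pseudo-division is genuine division over the integers, and
  minimality of the degree kills the remainder.\<close>

lemma ev_dvd: assumes "ev p = 0" shows "f dvd p"
proof -
  have f0: "f \<noteq> 0" using monic by auto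
  obtain q r where qr: "pseudo_divmod p f = (q, r)" by fastforce
  have e: "smult (coeff f (degree f) ^ (Suc (degree p) - degree f)) p = f * q + r" "r = 0 \<or> degree r < degree f"
    using pseudo_divmod[OF f0 qr] by auto
  then have p: "p = f * q + r" using monic by simp
  then have "ev r = 0" using assms ev_add ev_mult_f by simp
  then have "r = 0" using e(2) ev_min[of r] by (cases "r = 0") simp_all
  then show ?thesis using p by simp
qed

text \<open>The linear functional on polynomials that sends t^i to \<open>b (n + int i)\<close>;
  multiplication by t shifts n.\<close>

definition Lf :: "(int \<Rightarrow> int) \<Rightarrow> int \<Rightarrow> int poly \<Rightarrow> int" where
  "Lf b n p = (\<Sum>i\<le>degree p. coeff p i * b (n + int i))"

lemma Lf_ge: "degree p \<le> M \<Longrightarrow> Lf b n p = (\<Sum>i\<le>M. coeff p i * b (n + int i))"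
  unfolding Lf_def by (rule sum.mono_neutral_left) (auto simp: coeff_eq_0)

lemma Lf_add: "Lf b n (p + q) = Lf b n p + Lf b n q"
proof -
  let ?M = "max (degree p) (degree q)"
  have "degree (p + q) \<le> ?M" by (rule degree_add_le_max)
  then show ?thesis using Lf_ge[of "p + q" ?M] Lf_ge[of p ?M] Lf_ge[of q ?M]
    by (simp add: sum.distrib algebra_simps)
qed

lemma Lf_smult: "Lf b n (smult c p) = c * Lf b n p"
  using Lf_ge[of "smult c p" "degree p" b n] Lf_ge[of p "degree p" b n] degree_smult_le[of c p]
  by (simp add: sum_distrib_left mult.assoc)

lemma Lf_pCons: "Lf b n (pCons 0 p) = Lf b (n + 1) p"
proof -
  have "Lf b n (pCons 0 p) = (\<Sum>i\<le>Suc (degree p). coeff (pCons 0 p) i * b (n + int i))"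
    by (rule Lf_ge) (rule degree_pCons_le)
  also have "\<dots> = Lf b (n + 1) p" unfolding Lf_def
    by (subst sum.atMost_Suc_shift) (simp add: algebra_simps)
  finally show ?thesis .
qed

text \<open>The two-sided linear recurrence with characteristic polynomial \<open>f\<close>,
  required modulo m.\<close>

definition recm :: "int \<Rightarrow> (int \<Rightarrow> int) \<Rightarrow> bool" where
  "recm m b \<longleftrightarrow> (\<forall>n. m dvd Lf b n f)"

lemma Lf_mult_f: assumes "recm m b" shows "m dvd Lf b n (f * q)"
proof (induction q arbitrary: n)
  case 0 then show ?case by (simp add: Lf_def)
next
  case (pCons a q)
  have "f * pCons a q = smult a f + pCons 0 (f * q)" by simp
  then have "Lf b n (f * pCons a q) = a * Lf b n f + Lf b (n + 1) (f * q)"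
    by (simp only: Lf_add Lf_smult Lf_pCons)
  then show ?case using pCons(2)[of "n + 1"] assms unfolding recm_def by simp
qed

lemma Lf_monom: "Lf b n (monom c i) = c * b (n + int i)"
proof -
  have "Lf b n (monom c i) = (\<Sum>j\<le>i. coeff (monom c i) j * b (n + int j))"
    by (rule Lf_ge) (rule degree_monom_le)
  also have "\<dots> = (\<Sum>j\<le>i. if j = i then c * b (n + int j) else 0)" by (rule sum.cong) auto
  finally show ?thesis by simp
qed

lemma ev_monom: "ev (monom c i) = of_int c * lam ^ i"
  by (simp add: ev_def map_poly_monom poly_monom)

text \<open>Multiplied by a power of \<open>lam\<close>, a relation becomes a polynomial vanishing
  at \<open>lam\<close>, hence a multiple of \<open>f\<close>, on which the functional of b is 0
  modulo m.\<close>

lemma rel_kernel: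
  assumes b: "recm m b" and K: "finite K" and z: "(\<Sum>k\<in>K. of_int (c k) * pw k) = 0"
  shows "m dvd (\<Sum>k\<in>K. c k * b k)"
proof -
  \<comment> \<open>A shift that makes all exponents non-negative.\<close>
  define N where "N = (\<Sum>k\<in>K. \<bar>k\<bar>)"
  have N: "0 \<le> k + N" if "k \<in> K" for k
  proof -
    have "\<bar>k\<bar> \<le> N" unfolding N_def using K that by (intro member_le_sum) auto
    then show ?thesis by simp
  qed
  define p where "p = (\<Sum>k\<in>K. monom (c k) (nat (k + N)))"
  have evs: "ev (\<Sum>k\<in>J. g k) = (\<Sum>k\<in>J. ev (g k))" if "finite J" for J :: "int set" and g
    using that by (induction J rule: finite_induct) (auto simp: ev_add, simp add: ev_def)
  have Ls: "Lf b n (\<Sum>k\<in>J. g k) = (\<Sum>k\<in>J. Lf b n (g k))" if "finite J" for J :: "int set" and g n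
    using that by (induction J rule: finite_induct) (auto simp: Lf_add, simp add: Lf_def)
  have "ev p = (\<Sum>k\<in>K. pw N * (of_int (c k) * pw k))" unfolding p_def evs[OF K]
  proof (rule sum.cong[OF refl])
    fix k assume "k \<in> K"
    then have "lam ^ nat (k + N) = pw (k + N)" using N pw_nat[of "nat (k + N)"] by simp
    then show "ev (monom (c k) (nat (k + N))) = pw N * (of_int (c k) * pw k)"
      by (simp add: ev_monom pw_add)
  qed
  also have "\<dots> = 0" using z by (simp add: sum_distrib_left[symmetric])
  finally obtain q where "p = f * q" using ev_dvd by (auto simp: dvd_def)
  then have "m dvd Lf b (- N) p" using Lf_mult_f[OF b] by simp
  also have "Lf b (- N) p = (\<Sum>k\<in>K. c k * b k)" unfolding p_def Ls[OF K]
    by (rule sum.cong[OF refl]) (use N in \<open>simp add: Lf_monom\<close>)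
  finally show ?thesis .
qed

definition addm :: "int \<Rightarrow> (real \<Rightarrow> int) \<Rightarrow> bool" where
  "addm m h \<longleftrightarrow> (\<forall>x\<in>\<Gamma>. \<forall>y\<in>\<Gamma>. [h (x + y) = h x + h y] (mod m))"

text \<open>A sequence prescribes the values on powers, and additivity the rest; by
  \<open>rel_kernel\<close> the result does not depend on the Laurent polynomial chosen to represent
  a number.\<close>

lemma lin_exists:
  assumes b: "recm m b"
  shows "\<exists>h. addm m h \<and> (\<forall>k. [h (pw k) = b k] (mod m))"
proof -
  \<comment> \<open>Coefficients vanish off the finite set, so that representations with different
    supports can be summed over the union of these.\<close>
  define rep where "rep x r \<longleftrightarrow> finite (snd r) \<and> (\<forall>k. k \<notin> snd r \<longrightarrow> fst r k = 0) \<and>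
     x = (\<Sum>k\<in>snd r. of_int (fst r k) * pw k)" for x :: real and r :: "(int \<Rightarrow> int) \<times> int set"
  define S where "S r = (\<Sum>k\<in>snd r. fst r k * b k)" for r :: "(int \<Rightarrow> int) \<times> int set"
  define h where "h x = S (SOME r. rep x r)" for x
  have ex: "\<exists>r. rep x r" if x: "x \<in> \<Gamma>" for x
  proof -
    obtain c K where h: "finite K" "x = (\<Sum>k\<in>K. of_int (c k) * pw k)" using x unfolding G_def by blast
    have "(\<Sum>k\<in>K. of_int (c k) * pw k) = (\<Sum>k\<in>K. of_int (if k \<in> K then c k else 0) * pw k)"
      by (rule sum.cong) auto
    then have "rep x (\<lambda>k. if k \<in> K then c k else 0, K)" using h by (simp add: rep_def)
    then show ?thesis by blast
  qed
  have lin: "[S t = S r + S s] (mod m)" if "rep x r" "rep y s" "rep (x + y) t" for x y r s t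
  proof -
    let ?K = "snd r \<union> snd s \<union> snd t"
    have fin: "finite ?K" using that unfolding rep_def by simp
    have e1: "z = (\<Sum>k\<in>?K. of_int (fst q k) * pw k)" "S q = (\<Sum>k\<in>?K. fst q k * b k)"
      if "rep z q" "snd q \<subseteq> ?K" for z q
    proof -
      have "z = (\<Sum>k\<in>snd q. of_int (fst q k) * pw k)" using that unfolding rep_def by blast
      also have "\<dots> = (\<Sum>k\<in>?K. of_int (fst q k) * pw k)"
        by (rule sum.mono_neutral_left[OF fin that(2)]) (use that in \<open>auto simp: rep_def\<close>)
      finally show "z = (\<Sum>k\<in>?K. of_int (fst q k) * pw k)" .
      show "S q = (\<Sum>k\<in>?K. fst q k * b k)" unfolding S_def
        by (rule sum.mono_neutral_left[OF fin that(2)]) (use that in \<open>auto simp: rep_def\<close>)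
    qed
    have r: "snd r \<subseteq> ?K" "snd s \<subseteq> ?K" "snd t \<subseteq> ?K" by auto
    have "(\<Sum>k\<in>?K. of_int (fst t k - fst r k - fst s k) * pw k) = (x + y) - x - y"
      using e1(1)[OF that(1) r(1)] e1(1)[OF that(2) r(2)] e1(1)[OF that(3) r(3)]
      by (simp add: left_diff_distrib sum_subtractf)
    then have "m dvd (\<Sum>k\<in>?K. (fst t k - fst r k - fst s k) * b k)" by (intro rel_kernel[OF b fin]) simp
    also have "(\<Sum>k\<in>?K. (fst t k - fst r k - fst s k) * b k) = S t - S r - S s"
      using e1(2)[OF that(1) r(1)] e1(2)[OF that(2) r(2)] e1(2)[OF that(3) r(3)]
      by (simp add: left_diff_distrib sum_subtractf)
    finally show ?thesis by (simp add: cong_iff_dvd_diff diff_diff_eq)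
  qed
  have hr: "rep x (SOME r. rep x r)" if "x \<in> \<Gamma>" for x using someI_ex[OF ex[OF that]] .
  have "[h (x + y) = h x + h y] (mod m)" if "x \<in> \<Gamma>" "y \<in> \<Gamma>" for x y
    unfolding h_def using lin[OF hr[OF that(1)] hr[OF that(2)] hr[OF G_add[OF that]]] .
  moreover have "[h (pw k) = b k] (mod m)" for k
  proof -
    have 1: "rep (pw k) (\<lambda>j. if j = k then 1 else 0, {k})" "rep 0 (\<lambda>j. 0, {})" by (auto simp: rep_def)
    have "[S (SOME r. rep (pw k) r) = S (\<lambda>j. if j = k then 1 else 0, {k}) + S (\<lambda>j. 0, {})] (mod m)"
      using lin[OF 1(1) 1(2), of "SOME r. rep (pw k) r"] hr[OF G_pw[of k]] by simp
    then show ?thesis by (simp add: h_def S_def)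
  qed
  ultimately show ?thesis unfolding addm_def by blast
qed

end

section \<open>The invariant with values in a cyclic group\<close>

text \<open>The outer coefficients are 1, so the recurrence runs backwards over the integers as
  well; \<open>st\<close> and \<open>ts\<close> are the two directions on pairs of consecutive
  terms.\<close>

lemma two_sided_rec: "\<exists>b :: int \<Rightarrow> int. b 0 = 0 \<and> b 1 = 1 \<and> (\<forall>n. b (n + 2) = - s * b (n + 1) - b n)"
proof -
  define st :: "int \<times> int \<Rightarrow> int \<times> int" where "st = (\<lambda>(x, y). (y, - s * y - x))"
  define ts :: "int \<times> int \<Rightarrow> int \<times> int" where "ts = (\<lambda>(x, y). (- s * x - y, x))"
  define B where "B n = (if n \<ge> 0 then (st ^^ nat n) (0, 1) else (ts ^^ nat (- n)) (0, 1))" for n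
  have inv: "st (ts q) = q" for q by (cases q) (simp add: st_def ts_def)
  have step: "B (n + 1) = st (B n)" for n
  proof (cases "n \<ge> 0")
    case True
    then have "nat (n + 1) = Suc (nat n)" by simp
    then show ?thesis using True by (simp add: B_def)
  next
    case False
    then have "nat (- n) = Suc (nat (- (n + 1)))" by simp
    then have "B n = ts ((ts ^^ nat (- (n + 1))) (0, 1))" using False by (simp add: B_def)
    moreover have "B (n + 1) = (ts ^^ nat (- (n + 1))) (0, 1)" using False by (cases "n = -1") (auto simp: B_def)
    ultimately show ?thesis using inv by simp
  qed
  define b where "b n = fst (B n)" for n
  have b1: "b (n + 1) = snd (B n)" for n using step[of n] by (simp add: b_def st_def split: prod.splits)
  have "b (n + 2) = - s * b (n + 1) - b n" for n
  proof -
    have "n + 2 = (n + 1) + 1" by simp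
    then have "b (n + 2) = snd (B (n + 1))" using b1[of "n + 1"] by (simp only:)
    also have "\<dots> = - s * snd (B n) - fst (B n)" unfolding step by (simp add: st_def split: prod.splits)
    finally show ?thesis using b1 by (simp add: b_def)
  qed
  moreover have "b 0 = 0" "b 1 = 1" using b1[of 0] by (simp_all add: b_def B_def)
  ultimately show ?thesis by blast
qed

text \<open>A discrete primitive; the second sum in its formula takes over for negative
  arguments.\<close>

lemma two_sided_sum: "\<exists>S :: int \<Rightarrow> int. \<forall>n. S (n + 1) = S n + g n"
proof (intro exI allI)
  fix n
  let ?S = "\<lambda>n. (\<Sum>i\<in>{0..<n}. g i) - (\<Sum>i\<in>{n..<0}. g i)"
  show "?S (n + 1) = ?S n + g n"
  proof (cases "n \<ge> 0")
    case True
    then have "{0..<n + 1} = insert n {0..<n}" by auto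
    then show ?thesis using True by simp
  next
    case False
    then have "{n..<0} = insert n {n + 1..<0}" by auto
    then show ?thesis using False by simp
  qed
qed

context pl_poly
begin

text \<open>Solve along each orbit \<open>x \<lambda>\<^sup>n\<close>, with a chosen base point.\<close>
lemma orbit_potential: "\<exists>T :: real \<Rightarrow> int. \<forall>x>0. T (lam * x) = T x + g x"
proof -
  \<comment> \<open>All points of an orbit get the same base point, because the predicate under
    \<open>SOME\<close> depends on the orbit only.\<close>
  define base where "base x = (SOME y. \<exists>k. y = pw k * x)" for x
  have ex: "\<exists>k. base x = pw k * x" for x unfolding base_def by (rule someI_ex) auto
  have base_eq: "base (lam * x) = base x" for x
  proof -
    have "(\<exists>k. y = pw k * (lam * x)) \<longleftrightarrow> (\<exists>k. y = pw k * x)" for y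
    proof
      assume "\<exists>k. y = pw k * (lam * x)"
      then obtain k where "y = pw k * (lam * x)" by blast
      then have "y = pw (k + 1) * x" by (simp add: pw_add)
      then show "\<exists>k. y = pw k * x" by blast
    next
      assume "\<exists>k. y = pw k * x"
      then obtain k where "y = pw k * x" by blast
      moreover have "pw k = pw (k - 1) * lam" using pw_add[of "k - 1" 1] by simp
      ultimately have "y = pw (k - 1) * (lam * x)" by simp
      then show "\<exists>k. y = pw k * (lam * x)" by blast
    qed
    then show ?thesis by (simp add: base_def)
  qed
  have "\<forall>y. \<exists>S :: int \<Rightarrow> int. \<forall>n. S (n + 1) = S n + g (pw n * y)" by (intro allI) (rule two_sided_sum)
  then obtain S :: "real \<Rightarrow> int \<Rightarrow> int" where S: "\<And>y n. S y (n + 1) = S y n + g (pw n * y)" by metis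
  define idx where "idx x = (THE n. x = pw n * base x)" for x
  have idx: "idx x = n" if "x > 0" "x = pw n * base x" for x n
    unfolding idx_def
  proof (rule the_equality[of _ n])
    fix j assume "x = pw j * base x"
    then have "pw j * base x = pw n * base x" "base x \<noteq> 0" using that by auto
    then show "j = n" using pw_inj by simp
  qed (rule that(2))
  show ?thesis
  proof (intro exI[of _ "\<lambda>x. S (base x) (idx x)"] allI impI)
    fix x :: real assume x: "x > 0"
    obtain k where k: "base x = pw k * x" using ex by blast
    have e: "x = pw (- k) * base x" using k by simp
    have "pw (- k + 1) * (pw k * x) = lam * x" using pw_add[of "- k + 1" k] by (simp add: mult.assoc[symmetric])
    then have lx: "lam * x = pw (- k + 1) * base (lam * x)" using k by (simp only: base_eq)
    have lx0: "lam * x > 0" using x lam_pos by simp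
    have "idx (lam * x) = - k + 1" "idx x = - k" using idx[OF lx0 lx] idx[OF x e] by auto
    then show "S (base (lam * x)) (idx (lam * x)) = S (base x) (idx x) + g x"
      using S[of "base x" "- k"] e by (simp add: base_eq)
  qed
qed

section \<open>Bilinear forms and invariance under \<open>lam\<close>\<close>

definition biadd :: "int \<Rightarrow> (real \<Rightarrow> real \<Rightarrow> int) \<Rightarrow> bool" where
  "biadd m \<beta> \<longleftrightarrow> (\<forall>x\<in>\<Gamma>. \<forall>y\<in>\<Gamma>. \<forall>z\<in>\<Gamma>. [\<beta> (x + y) z = \<beta> x z + \<beta> y z] (mod m) \<and> [\<beta> z (x + y) = \<beta> z x + \<beta> z y] (mod m))"

lemma lam_inv_pw:
  assumes "\<And>x y. x \<in> \<Gamma> \<Longrightarrow> y \<in> \<Gamma> \<Longrightarrow> 0 < x \<Longrightarrow> 0 < y \<Longrightarrow> [D (lam * x) (lam * y) = D x y] (mod m)"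
    "x \<in> \<Gamma>" "y \<in> \<Gamma>" "0 < x" "0 < y"
  shows "[D (pw k * x) (pw k * y) = D x y] (mod (m :: int))"
proof (induction k rule: int_induct[where k = 0])
  case base then show ?case by simp
next
  case (step1 i)
  have e: "pw (i + 1) * z = lam * (pw i * z)" for z by (simp add: pw_add)
  have "[D (lam * (pw i * x)) (lam * (pw i * y)) = D (pw i * x) (pw i * y)] (mod m)"
    using assms by (intro assms(1)) auto
  then show ?case unfolding e using step1 cong_trans by blast
next
  case (step2 i)
  have e: "lam * (pw (i - 1) * z) = pw i * z" for z using pw_add[of "i - 1" 1] by (simp add: mult_ac)
  have "[D (lam * (pw (i - 1) * x)) (lam * (pw (i - 1) * y)) = D (pw (i - 1) * x) (pw (i - 1) * y)] (mod m)"
    using assms by (intro assms(1)) auto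
  then show ?case unfolding e using step2 cong_trans cong_sym by blast
qed

text \<open>For adjacent intervals of lengths x and y the contribution of the left end cancels, and
  the defect is \<open>\<beta> x y + T x + T y - T (x + y)\<close>. It is invariant under
  translation, so only scaling by \<open>lam\<close> has to be checked.\<close>

lemma affine_defect_bi:
  assumes \<beta>: "biadd m \<beta>"
    and D: "\<And>x y. x \<in> \<Gamma> \<Longrightarrow> y \<in> \<Gamma> \<Longrightarrow> 0 < x \<Longrightarrow> 0 < y \<Longrightarrow>
      [\<beta> (lam * x) (lam * y) + T (lam * x) + T (lam * y) - T (lam * (x + y)) = \<beta> x y + T x + T y - T (x + y)] (mod m)"
  shows "affine_defect m (\<lambda>a b. \<beta> a (b - a) + T (b - a))"
  unfolding affine_defect_def
proof (intro allI impI)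
  fix a c b a' k assume G: "a \<in> \<Gamma>" "c \<in> \<Gamma>" "b \<in> \<Gamma>" "a' \<in> \<Gamma>" and o: "a < c" "c < b"
  define D where "D x y = \<beta> x y + T x + T y - T (x + y)" for x y
  let ?E = "\<lambda>a b. \<beta> a (b - a) + T (b - a)"
  have key: "[?E z (z + x) + ?E (z + x) (z + (x + y)) - ?E z (z + (x + y)) = D x y] (mod m)"
    if "z \<in> \<Gamma>" "x \<in> \<Gamma>" "y \<in> \<Gamma>" for x y z
  proof -
    have "[\<beta> (z + x) y = \<beta> z y + \<beta> x y] (mod m)" "[\<beta> z (x + y) = \<beta> z x + \<beta> z y] (mod m)"
      using \<beta> that unfolding biadd_def by blast+
    then have "[\<beta> (z + x) y - \<beta> z (x + y) = (\<beta> z y + \<beta> x y) - (\<beta> z x + \<beta> z y)] (mod m)" by (rule cong_diff)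
    then have "m dvd (\<beta> (z + x) y - \<beta> z (x + y)) - ((\<beta> z y + \<beta> x y) - (\<beta> z x + \<beta> z y))" by (simp only: cong_iff_dvd_diff)
    then show ?thesis by (simp add: cong_iff_dvd_diff D_def algebra_simps)
  qed
  have w: "c - a \<in> \<Gamma>" "b - c \<in> \<Gamma>" "0 < c - a" "0 < b - c" using G o by auto
  have "[D (pw k * (c - a)) (pw k * (b - c)) = D (c - a) (b - c)] (mod m)"
    by (rule lam_inv_pw[OF _ w]) (use assms(2) in \<open>simp add: D_def distrib_left\<close>)
  moreover have "[?E a c + ?E c b - ?E a b = D (c - a) (b - c)] (mod m)"
    using key[OF G(1) w(1,2)] by (simp add: algebra_simps)
  moreover have "[?E a' (a' + pw k * (c - a)) + ?E (a' + pw k * (c - a)) (a' + pw k * (b - a)) - ?E a' (a' + pw k * (b - a))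
      = D (pw k * (c - a)) (pw k * (b - c))] (mod m)"
  proof -
    have e: "pw k * (b - a) = pw k * (c - a) + pw k * (b - c)" by (simp add: algebra_simps)
    show ?thesis unfolding e using key[OF G(4) G_scale[OF w(1), of k] G_scale[OF w(2), of k]] .
  qed
  ultimately show "[?E a c + ?E c b - ?E a b = ?E a' (a' + pw k * (c - a)) + ?E (a' + pw k * (c - a)) (a' + pw k * (b - a)) - ?E a' (a' + pw k * (b - a))] (mod m)"
    using cong_sym cong_trans by blast
qed

text \<open>The dependence on the position a cancels, and so do the potentials, as a rotation keeps
  lengths. What remains is the antisymmetrisation of the form.\<close>

lemma theta_rot_bi:
  assumes \<beta>: "biadd m \<beta>" and E: "affine_defect m E" "E = (\<lambda>a b. \<beta> a (b - a) + T (b - a))"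
    and r: "a \<in> \<Gamma>" "x \<in> \<Gamma>" "y \<in> \<Gamma>" "0 < a" "0 < x" "0 < y" "a + x + y < l"
  shows "[theta E (rot a x y) = \<beta> x y - \<beta> y x] (mod m)"
proof -
  have "[\<beta> (a + x) y = \<beta> a y + \<beta> x y] (mod m)" "[\<beta> (a + y) x = \<beta> a x + \<beta> y x] (mod m)"
    using \<beta> r unfolding biadd_def by blast+
  then have "[\<beta> (a + x) y - \<beta> (a + y) x = (\<beta> a y + \<beta> x y) - (\<beta> a x + \<beta> y x)] (mod m)" by (rule cong_diff)
  then have "m dvd (\<beta> (a + x) y - \<beta> (a + y) x) - ((\<beta> a y + \<beta> x y) - (\<beta> a x + \<beta> y x))" by (simp only: cong_iff_dvd_diff)
  moreover have "(\<beta> (a + x) y - \<beta> (a + y) x) - ((\<beta> a y + \<beta> x y) - (\<beta> a x + \<beta> y x)) =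
     (E a (a + x) - E (a + y) (a + x + y) + E (a + x) (a + x + y) - E a (a + y)) - (\<beta> x y - \<beta> y x)"
    unfolding E(2) by (simp add: algebra_simps)
  ultimately have "[E a (a + x) - E (a + y) (a + x + y) + E (a + x) (a + x + y) - E a (a + y) = \<beta> x y - \<beta> y x] (mod m)"
    by (simp only: cong_iff_dvd_diff)
  then show ?thesis using theta_rot[OF E(1) r] cong_trans by blast
qed

end

context pl_poly
begin

lemma addm_0: assumes "addm m h" shows "[h 0 = 0] (mod m)"
proof -
  have "[h (0 + 0) = h 0 + h 0] (mod m)" using assms G_0 unfolding addm_def by blast
  then have "m dvd h 0 - (h 0 + h 0)" by (simp add: cong_iff_dvd_diff)
  then show ?thesis by (simp add: cong_iff_dvd_diff)
qed

lemma addm_minus: assumes "addm m h" "x \<in> \<Gamma>" shows "[h (- x) = - h x] (mod m)"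
proof -
  have "[h (- x + x) = h (- x) + h x] (mod m)" using assms G_minus[OF assms(2)] unfolding addm_def by blast
  then have "[0 = h (- x) + h x] (mod m)" using addm_0[OF assms(1)] by (metis add.left_inverse cong_sym cong_trans)
  then have "m dvd 0 - (h (- x) + h x)" by (simp only: cong_iff_dvd_diff)
  then obtain k where "0 - (h (- x) + h x) = m * k" by (rule dvdE)
  then have "h (- x) - - h x = m * (- k)" by simp
  then show ?thesis unfolding cong_iff_dvd_diff by (rule dvdI)
qed

lemma addm_diff: assumes "addm m h" "x \<in> \<Gamma>" "y \<in> \<Gamma>" shows "[h (x - y) = h x - h y] (mod m)"
proof -
  have "[h (x + - y) = h x + h (- y)] (mod m)" using assms G_minus[OF assms(3)] unfolding addm_def by blast
  moreover have "[h x + h (- y) = h x + - h y] (mod m)" using addm_minus[OF assms(1,3)] by (intro cong_add cong_refl)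
  ultimately show ?thesis by (simp add: cong_trans[of _ _ m])
qed

lemma addm_int: assumes "addm m h" "x \<in> \<Gamma>" shows "[h (of_int n * x) = n * h x] (mod m)"
proof (induction n rule: int_induct[where k = 0])
  case base then show ?case using addm_0[OF assms(1)] by simp
next
  case (step1 i)
  have "[h (of_int i * x + x) = h (of_int i * x) + h x] (mod m)" using assms G_of_int[OF assms(2)] unfolding addm_def by blast
  moreover have "[h (of_int i * x) + h x = i * h x + h x] (mod m)" using step1 by (intro cong_add cong_refl)
  ultimately have "[h (of_int i * x + x) = i * h x + h x] (mod m)" by (rule cong_trans)
  then show ?case by (simp add: algebra_simps)
next
  case (step2 i)
  have "[h (of_int i * x - x) = h (of_int i * x) - h x] (mod m)" using addm_diff assms by simp
  moreover have "[h (of_int i * x) - h x = i * h x - h x] (mod m)" using step2 by (intro cong_diff cong_refl)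
  ultimately have "[h (of_int i * x - x) = i * h x - h x] (mod m)" by (rule cong_trans)
  then show ?case by (simp add: algebra_simps)
qed

lemma addm_shift:
  assumes h: "addm m h" and h1: "addm m h1" and h2: "addm m h2"
    and e: "\<And>k. [h (pw (k + 1)) = p * h1 (pw k) + q * h2 (pw k)] (mod m)" and x: "x \<in> \<Gamma>"
  shows "[h (lam * x) = p * h1 x + q * h2 x] (mod m)"
  using x
proof (induction x rule: G_induct)
  case zero
  have "[p * h1 0 + q * h2 0 = p * 0 + q * 0] (mod m)"
    using addm_0[OF h1] addm_0[OF h2] by (intro cong_add cong_mult cong_refl)
  then show ?case using addm_0[OF h] by (simp add: cong_def)
next
  case (add x k)
  have l: "lam * x \<in> \<Gamma>" using G_scale[OF add(1), of 1] by simp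
  have "lam * (x + pw k) = lam * x + pw (k + 1)" by (simp add: pw_add algebra_simps)
  then have "[h (lam * (x + pw k)) = h (lam * x) + h (pw (k + 1))] (mod m)" using h l unfolding addm_def by simp
  also have "[h (lam * x) + h (pw (k + 1)) = (p * h1 x + q * h2 x) + (p * h1 (pw k) + q * h2 (pw k))] (mod m)"
    using add(2) e by (intro cong_add)
  also have "(p * h1 x + q * h2 x) + (p * h1 (pw k) + q * h2 (pw k)) = p * (h1 x + h1 (pw k)) + q * (h2 x + h2 (pw k))"
    by (simp add: algebra_simps)
  also have "[\<dots> = p * h1 (x + pw k) + q * h2 (x + pw k)] (mod m)"
    using h1 h2 add(1) unfolding addm_def by (intro cong_add[of "p * (h1 x + h1 (pw k))"] cong_mult cong_refl) (blast intro: cong_sym G_pw)+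
  finally show ?case .
next
  case (sub x k)
  have l: "lam * x \<in> \<Gamma>" using G_scale[OF sub(1), of 1] by simp
  have "lam * (x - pw k) = lam * x - pw (k + 1)" by (simp add: pw_add algebra_simps)
  then have "[h (lam * (x - pw k)) = h (lam * x) - h (pw (k + 1))] (mod m)" using addm_diff[OF h l G_pw] by simp
  also have "[h (lam * x) - h (pw (k + 1)) = (p * h1 x + q * h2 x) - (p * h1 (pw k) + q * h2 (pw k))] (mod m)"
    using sub(2) e by (intro cong_diff)
  also have "(p * h1 x + q * h2 x) - (p * h1 (pw k) + q * h2 (pw k)) = p * (h1 x - h1 (pw k)) + q * (h2 x - h2 (pw k))"
    by (simp add: algebra_simps)
  also have "[\<dots> = p * h1 (x - pw k) + q * h2 (x - pw k)] (mod m)"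
    using addm_diff[OF h1 sub(1) G_pw] addm_diff[OF h2 sub(1) G_pw]
    by (intro cong_add[of "p * (h1 x - h1 (pw k))"] cong_mult cong_refl) (blast intro: cong_sym)+
  finally show ?case .
qed

text \<open>The coordinates of \<open>\<Gamma>\<close> in \<open>(\<int>/m)[t]/(t\<^sup>2 + s t + 1)\<close>; multiplication by \<open>t\<close> has determinant one, so
  \<open>u x v y - v x u y\<close> is invariant.\<close>
lemma coordinates:
  assumes "\<And>b. (\<And>n. b (n + 2) = - s * b (n + 1) - b n) \<Longrightarrow> recm m b"
  obtains u v where "addm m u" "addm m v" "[u 1 = 1] (mod m)" "[v 1 = 0] (mod m)" "[v lam = 1] (mod m)"
    "\<And>x. x \<in> \<Gamma> \<Longrightarrow> [u (lam * x) = - v x] (mod m)" "\<And>x. x \<in> \<Gamma> \<Longrightarrow> [v (lam * x) = u x - s * v x] (mod m)"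
proof -
  obtain b :: "int \<Rightarrow> int" where b: "b 0 = 0" "b 1 = 1" "\<And>n. b (n + 2) = - s * b (n + 1) - b n"
    using two_sided_rec[of s] by blast
  \<comment> \<open>Modulo t^2 + s t + 1 one has t^n = b(n) t - b(n - 1), so \<open>c\<close> and
    \<open>b\<close> are the two coordinate sequences.\<close>
  define c where "c n = - b (n - 1)" for n
  have bb: "b (n + 1) = - s * b n - b (n - 1)" for n
  proof -
    have "n - 1 + 2 = n + 1" "n - 1 + 1 = n" by simp_all
    then show ?thesis using b(3)[of "n - 1"] by (simp only:)
  qed
  have bm: "b (-1) = -1" using b(3)[of "-1"] b(1,2) by simp
  have c: "c (n + 2) = - s * c (n + 1) - c n" for n
  proof -
    have i: "n + 2 - 1 = n + 1" "n + 1 - 1 = n" by simp_all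
    show ?thesis unfolding c_def i using bb[of n] by simp
  qed
  obtain v where v: "addm m v" "\<And>k. [v (pw k) = b k] (mod m)" using lin_exists[OF assms[OF b(3)]] by blast
  obtain u where u: "addm m u" "\<And>k. [u (pw k) = c k] (mod m)" using lin_exists[OF assms[OF c]] by blast
  have "[u (pw (k + 1)) = (-1) * v (pw k) + 0 * v (pw k)] (mod m)" for k
  proof -
    have "[(-1) * v (pw k) = (-1) * b k] (mod m)" using v(2) by (intro cong_mult cong_refl)
    then show ?thesis using u(2)[of "k + 1"] by (simp add: c_def cong_def)
  qed
  then have su: "[u (lam * x) = (-1) * v x + 0 * v x] (mod m)" if "x \<in> \<Gamma>" for x
    using addm_shift[OF u(1) v(1) v(1)] that by blast
  have "[v (pw (k + 1)) = 1 * u (pw k) + (- s) * v (pw k)] (mod m)" for k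
  proof -
    have e: "b (k + 1) = 1 * c k + (- s) * b k" using bb[of k] by (simp add: c_def)
    have "[1 * u (pw k) + (- s) * v (pw k) = 1 * c k + (- s) * b k] (mod m)"
      using u(2) v(2) by (intro cong_add cong_mult cong_refl)
    then show ?thesis using v(2)[of "k + 1"] e by (simp add: cong_def)
  qed
  then have sv: "[v (lam * x) = 1 * u x + (- s) * v x] (mod m)" if "x \<in> \<Gamma>" for x
    using addm_shift[OF v(1) u(1) v(1)] that by blast
  show ?thesis
    by (rule that[OF u(1) v(1)]) (use u(2)[of 0] v(2)[of 0] v(2)[of 1] b(1,2) bm su sv in \<open>simp_all add: c_def\<close>)
qed

lemma addm_add: "addm m h \<Longrightarrow> x \<in> \<Gamma> \<Longrightarrow> y \<in> \<Gamma> \<Longrightarrow> [h (x + y) = h x + h y] (mod m)"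
  by (simp add: addm_def)

lemma biadd_prod:
  assumes "addm m h" "addm m k"
  shows "biadd m (\<lambda>x y. h x * k y)"
  unfolding biadd_def
proof (intro ballI conjI)
  fix x y z assume G: "x \<in> \<Gamma>" "y \<in> \<Gamma>" "z \<in> \<Gamma>"
  have "[h (x + y) * k z = (h x + h y) * k z] (mod m)" using addm_add[OF assms(1) G(1,2)] by (intro cong_mult cong_refl)
  then show "[h (x + y) * k z = h x * k z + h y * k z] (mod m)" by (simp add: distrib_right)
  have "[h z * k (x + y) = h z * (k x + k y)] (mod m)" using addm_add[OF assms(2) G(1,2)] by (intro cong_mult cong_refl)
  then show "[h z * k (x + y) = h z * k x + h z * k y] (mod m)" by (simp add: distrib_left)
qed

lemma biadd_lin:
  assumes "biadd m \<beta>" "biadd m \<gamma>"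
  shows "biadd m (\<lambda>x y. \<beta> x y + c * \<gamma> x y)"
  unfolding biadd_def
proof (intro ballI conjI)
  fix x y z assume G: "x \<in> \<Gamma>" "y \<in> \<Gamma>" "z \<in> \<Gamma>"
  have "[\<beta> (x + y) z + c * \<gamma> (x + y) z = (\<beta> x z + \<beta> y z) + c * (\<gamma> x z + \<gamma> y z)] (mod m)"
    using assms G unfolding biadd_def by (intro cong_add[of "\<beta> (x + y) z"] cong_mult cong_refl) blast+
  then show "[\<beta> (x + y) z + c * \<gamma> (x + y) z = \<beta> x z + c * \<gamma> x z + (\<beta> y z + c * \<gamma> y z)] (mod m)"
    by (simp add: algebra_simps)
  have "[\<beta> z (x + y) + c * \<gamma> z (x + y) = (\<beta> z x + \<beta> z y) + c * (\<gamma> z x + \<gamma> z y)] (mod m)"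
    using assms G unfolding biadd_def by (intro cong_add[of "\<beta> z (x + y)"] cong_mult cong_refl) blast+
  then show "[\<beta> z (x + y) + c * \<gamma> z (x + y) = \<beta> z x + c * \<gamma> z x + (\<beta> z y + c * \<gamma> z y)] (mod m)"
    by (simp add: algebra_simps)
qed

text \<open>An antisymmetrisation \<open>u x v y - v x u y\<close> is needed with no factor \<open>2\<close>. For odd \<open>s\<close> there is an invariant
  bilinear form with this property. For even \<open>s\<close> the form \<open>u x v y\<close> is invariant up to the polarisation
  of a quadratic form, which a potential along the orbits absorbs.\<close>
lemma bilinear_choice:
  assumes u: "addm m u" and v: "addm m v"
    and lu: "\<And>x. x \<in> \<Gamma> \<Longrightarrow> [u (lam * x) = - v x] (mod m)" and lv: "\<And>x. x \<in> \<Gamma> \<Longrightarrow> [v (lam * x) = u x - s * v x] (mod m)"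
  obtains \<beta> T where "biadd m \<beta>" "affine_defect m (\<lambda>a b. \<beta> a (b - a) + T (b - a))"
    "\<And>x y. \<beta> x y - \<beta> y x = u x * v y - v x * u y"
proof (cases "even s")
  case True
  then obtain h where s: "s = 2 * h" by (auto elim: evenE)
  \<comment> \<open>Multiplication by \<open>lam\<close> changes u x v y by minus the polarisation
    of \<open>Q\<close>, and \<open>Q\<close> has integral coefficients because s is even.\<close>
  define Q where "Q x = u x * v x - h * (v x * v x)" for x
  obtain T :: "real \<Rightarrow> int" where T: "\<And>x. x > 0 \<Longrightarrow> T (lam * x) = T x + - Q x"
    using orbit_potential[of "\<lambda>x. - Q x"] by blast
  have \<beta>: "biadd m (\<lambda>x y. u x * v y)" using biadd_prod[OF u v] .
  have "affine_defect m (\<lambda>a b. u a * v (b - a) + T (b - a))"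
  proof (rule affine_defect_bi[OF \<beta>])
    fix x y assume G: "x \<in> \<Gamma>" "y \<in> \<Gamma>" and p: "0 < x" "0 < y"
    have "[u (lam * x) * v (lam * y) = - v x * (u y - s * v y)] (mod m)" using lu[OF G(1)] lv[OF G(2)] by (rule cong_mult)
    moreover have "[Q (x + y) = (u x + u y) * (v x + v y) - h * ((v x + v y) * (v x + v y))] (mod m)"
      unfolding Q_def using addm_add[OF u G] addm_add[OF v G] by (intro cong_diff cong_mult cong_refl)
    ultimately have "[u (lam * x) * v (lam * y) + Q (x + y)
      = - v x * (u y - s * v y) + ((u x + u y) * (v x + v y) - h * ((v x + v y) * (v x + v y)))] (mod m)" by (rule cong_add)
    then have "[u (lam * x) * v (lam * y) + Q (x + y) + (T x - Q x + T y - Q y - T (x + y))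
      = - v x * (u y - s * v y) + ((u x + u y) * (v x + v y) - h * ((v x + v y) * (v x + v y))) + (T x - Q x + T y - Q y - T (x + y))] (mod m)"
      by (rule cong_add) (rule cong_refl)
    moreover have "u (lam * x) * v (lam * y) + T (lam * x) + T (lam * y) - T (lam * (x + y))
      = u (lam * x) * v (lam * y) + Q (x + y) + (T x - Q x + T y - Q y - T (x + y))" using T p by simp
    moreover have "- v x * (u y - s * v y) + ((u x + u y) * (v x + v y) - h * ((v x + v y) * (v x + v y))) + (T x - Q x + T y - Q y - T (x + y))
      = u x * v y + T x + T y - T (x + y)" unfolding Q_def s by (simp add: algebra_simps)
    ultimately show "[u (lam * x) * v (lam * y) + T (lam * x) + T (lam * y) - T (lam * (x + y)) = u x * v y + T x + T y - T (x + y)] (mod m)"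
      by (simp only:)
  qed
  then show ?thesis using that[OF \<beta>] by (simp add: mult.commute)
next
  case False
  then obtain h where s: "s = 2 * h + 1" by (auto elim: oddE)
  \<comment> \<open>Half the sum of the polar form of the norm u^2 - s u v + v^2 and of the
    determinant, both invariant under \<open>lam\<close>; for odd s the coefficients are
    integers.\<close>
  define \<beta> where "\<beta> x y = u x * u y + (- h) * (u x * v y) + (- h - 1) * (v x * u y) + 1 * (v x * v y)" for x y
  have \<beta>: "biadd m \<beta>" unfolding \<beta>_def[abs_def] by (intro biadd_lin biadd_prod u v)
  have "affine_defect m (\<lambda>a b. \<beta> a (b - a) + (\<lambda>_. 0) (b - a))"
  proof (rule affine_defect_bi[OF \<beta>])
    fix x y assume G: "x \<in> \<Gamma>" "y \<in> \<Gamma>" and p: "0 < x" "0 < y"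
    have "[\<beta> (lam * x) (lam * y) = - v x * - v y + (- h) * (- v x * (u y - s * v y)) + (- h - 1) * ((u x - s * v x) * - v y)
      + 1 * ((u x - s * v x) * (u y - s * v y))] (mod m)" unfolding \<beta>_def
      using lu[OF G(1)] lu[OF G(2)] lv[OF G(1)] lv[OF G(2)] by (intro cong_add cong_mult cong_refl)
    also have "- v x * - v y + (- h) * (- v x * (u y - s * v y)) + (- h - 1) * ((u x - s * v x) * - v y)
      + 1 * ((u x - s * v x) * (u y - s * v y)) = \<beta> x y" unfolding \<beta>_def s by (simp add: algebra_simps)
    finally show "[\<beta> (lam * x) (lam * y) + 0 + 0 - 0 = \<beta> x y + 0 + 0 - 0] (mod m)" by simp
  qed
  moreover have "\<beta> x y - \<beta> y x = u x * v y - v x * u y" for x y by (simp add: \<beta>_def algebra_simps)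
  ultimately show ?thesis using that[OF \<beta>, of "\<lambda>_. 0"] by blast
qed

text \<open>By invariance under \<open>lam\<close>, a rotation with lengths \<open>pw k\<close> and
  \<open>pw k\<close> y yields the determinant of 1 and y, which is v y because 1 has coordinates
  (1, 0).\<close>

lemma cyclic_invariant:
  assumes "\<And>b. (\<And>n. b (n + 2) = - s * b (n + 1) - b n) \<Longrightarrow> recm m b"
  obtains \<chi> v where "addm m v" "[v 1 = 0] (mod m)" "[v lam = 1] (mod m)"
    "\<And>g h. g \<in> W \<Longrightarrow> h \<in> W \<Longrightarrow> [\<chi> (g \<circ> h) = \<chi> g + \<chi> h] (mod m)"
    "\<And>k y. y \<in> \<Gamma> \<Longrightarrow> 0 < y \<Longrightarrow> pw k + pw k + pw k * y < l \<Longrightarrow> [\<chi> (rot (pw k) (pw k) (pw k * y)) = v y] (mod m)"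
proof -
  obtain u v where u: "addm m u" and v: "addm m v" and i: "[u 1 = 1] (mod m)" "[v 1 = 0] (mod m)" "[v lam = 1] (mod m)"
    and l: "\<And>x. x \<in> \<Gamma> \<Longrightarrow> [u (lam * x) = - v x] (mod m)" "\<And>x. x \<in> \<Gamma> \<Longrightarrow> [v (lam * x) = u x - s * v x] (mod m)"
    using coordinates[OF assms] by blast
  obtain \<beta> T where \<beta>: "biadd m \<beta>" and A: "affine_defect m (\<lambda>a b. \<beta> a (b - a) + T (b - a))"
    and alt: "\<And>x y. \<beta> x y - \<beta> y x = u x * v y - v x * u y" using bilinear_choice[OF u v l] by blast
  define D where "D x y = u x * v y - v x * u y" for x y
  let ?E = "\<lambda>a b. \<beta> a (b - a) + T (b - a)"
  have Dl: "[D (lam * x) (lam * y) = D x y] (mod m)" if G: "x \<in> \<Gamma>" "y \<in> \<Gamma>" for x y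
  proof -
    have "[D (lam * x) (lam * y) = - v x * (u y - s * v y) - (u x - s * v x) * - v y] (mod m)" unfolding D_def
      using l(1)[OF G(1)] l(1)[OF G(2)] l(2)[OF G(1)] l(2)[OF G(2)] by (intro cong_diff cong_mult)
    also have "- v x * (u y - s * v y) - (u x - s * v x) * - v y = D x y" by (simp add: D_def algebra_simps)
    finally show ?thesis .
  qed
  show ?thesis
  proof (rule that[OF v i(2,3), of "theta ?E"])
    fix g h assume "g \<in> W" "h \<in> W"
    then show "[theta ?E (g \<circ> h) = theta ?E g + theta ?E h] (mod m)"
      using theta_comp[OF A, of h g] by (simp add: add.commute)
  next
    fix k y assume y: "y \<in> \<Gamma>" "0 < y" "pw k + pw k + pw k * y < l"
    have "[theta ?E (rot (pw k) (pw k) (pw k * y)) = \<beta> (pw k) (pw k * y) - \<beta> (pw k * y) (pw k)] (mod m)"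
      by (rule theta_rot_bi[OF \<beta> A refl]) (use y in auto)
    also have "\<beta> (pw k) (pw k * y) - \<beta> (pw k * y) (pw k) = D (pw k * 1) (pw k * y)" unfolding alt D_def by simp
    also have "[\<dots> = D 1 y] (mod m)" by (rule lam_inv_pw[where D = D]) (use y Dl in auto)
    also have "[D 1 y = 1 * v y - 0 * u y] (mod m)" unfolding D_def using i by (intro cong_diff cong_mult cong_refl)
    finally show "[theta ?E (rot (pw k) (pw k) (pw k * y)) = v y] (mod m)" by simp
  qed
qed

text \<open>For y = 0 the rotation is the identity, and the homomorphism property settles inverses;
  so the values at rotations with positive y determine the invariant on all representatives.\<close>

lemma chi_gel:
  assumes v: "addm m v"
    and hom: "\<And>g h. g \<in> W \<Longrightarrow> h \<in> W \<Longrightarrow> [\<chi> (g \<circ> h) = \<chi> g + \<chi> h] (mod m)"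
    and r: "\<And>k y. y \<in> \<Gamma> \<Longrightarrow> 0 < y \<Longrightarrow> pw k + pw k + pw k * y < l \<Longrightarrow> [\<chi> (rot (pw k) (pw k) (pw k * y)) = v y] (mod m)"
    and y: "y \<in> \<Gamma>"
  shows "[\<chi> (gel y) = v y] (mod m)"
proof -
  have "[\<chi> (id \<circ> id) = \<chi> id + \<chi> id] (mod m)" using hom W_id by blast
  then have "m dvd \<chi> id - (\<chi> id + \<chi> id)" unfolding comp_id cong_iff_dvd_diff .
  then have id0: "[\<chi> id = 0] (mod m)" by (simp add: cong_iff_dvd_diff)
  have mid: "[\<chi> (mid z) = v z] (mod m)" if z: "z \<in> \<Gamma>" "0 \<le> z" for z
  proof -
    obtain k where k: "mid z = rot (pw k) (pw k) (pw k * z)" "pw k + pw k + pw k * z < l" using midE[OF z(2)] .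
    show ?thesis
    proof (cases "z = 0")
      case True
      have "mid z = id" unfolding k(1) by (auto simp: True rot_def fun_eq_iff)
      then show ?thesis using id0 addm_0[OF v] True by (metis cong_sym cong_trans)
    next
      case False
      then show ?thesis unfolding k(1) using r[OF z(1) _ k(2)] z(2) by simp
    qed
  qed
  let ?p = "max y 0" and ?n = "max (- y) 0"
  have G: "?p \<in> \<Gamma>" "?n \<in> \<Gamma>" using y by (auto simp: max_def)
  have W: "mid ?p \<in> W" "mid ?n \<in> W" using mid_W G by auto
  have "mid ?n \<circ> finv (mid ?n) = id" using W_f_inv[OF W(2)] by (auto simp: fun_eq_iff)
  then have "[\<chi> id = \<chi> (mid ?n) + \<chi> (finv (mid ?n))] (mod m)" using hom[OF W(2) W_inv[OF W(2)]] by simp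
  then have "[0 = \<chi> (mid ?n) + \<chi> (finv (mid ?n))] (mod m)" using id0 cong_sym cong_trans by blast
  then have n: "m dvd 0 - (\<chi> (mid ?n) + \<chi> (finv (mid ?n)))" by (simp only: cong_iff_dvd_diff)
  have "m dvd \<chi> (gel y) - (\<chi> (mid ?p) + \<chi> (finv (mid ?n)))"
    using hom[OF W(1) W_inv[OF W(2)]] unfolding gel_def cong_iff_dvd_diff .
  moreover have "m dvd \<chi> (mid ?p) - v ?p" "m dvd \<chi> (mid ?n) - v ?n" using mid G by (auto simp: cong_iff_dvd_diff)
  moreover have "m dvd v (?p - ?n) - (v ?p - v ?n)" using addm_diff[OF v G] by (simp only: cong_iff_dvd_diff)
  moreover have "?p - ?n = y" by auto
  ultimately have "m dvd v y - (v ?p - v ?n)" "m dvd \<chi> (gel y) - (\<chi> (mid ?p) + \<chi> (finv (mid ?n)))"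
    "m dvd \<chi> (mid ?p) - v ?p" "m dvd \<chi> (mid ?n) - v ?n" by simp_all
  with n have "\<exists>c1 c2 c3 c4 c5. v y - (v ?p - v ?n) = m * c1 \<and> \<chi> (gel y) - (\<chi> (mid ?p) + \<chi> (finv (mid ?n))) = m * c2 \<and>
    \<chi> (mid ?p) - v ?p = m * c3 \<and> \<chi> (mid ?n) - v ?n = m * c4 \<and> 0 - (\<chi> (mid ?n) + \<chi> (finv (mid ?n))) = m * c5"
    unfolding dvd_def by blast
  then obtain c1 c2 c3 c4 c5 where "v y - (v ?p - v ?n) = m * c1" "\<chi> (gel y) - (\<chi> (mid ?p) + \<chi> (finv (mid ?n))) = m * c2"
    "\<chi> (mid ?p) - v ?p = m * c3" "\<chi> (mid ?n) - v ?n = m * c4" "0 - (\<chi> (mid ?n) + \<chi> (finv (mid ?n))) = m * c5"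
    by blast
  then have "\<chi> (gel y) - v y = m * (c2 + c3 - c5 - c4 - c1)" by (simp add: algebra_simps)
  then show ?thesis unfolding cong_iff_dvd_diff by simp
qed

section \<open>The sign as an invariant modulo 2\<close>

lemma of_int_bit_cong: "[x = y] (mod 2) \<Longrightarrow> (of_int x :: bit) = of_int y"
proof -
  assume "[x = y] (mod 2)"
  then have "2 dvd x - y" by (simp only: cong_iff_dvd_diff)
  then obtain k where "x - y = 2 * k" by (rule dvdE)
  then have "x = y + 2 * k" by simp
  then show ?thesis by simp
qed

lemma of_int_bit_0: "(of_int x :: bit) = 0 \<longleftrightarrow> even x"
proof
  assume h: "(of_int x :: bit) = 0"
  show "even x"
  proof (rule ccontr)
    assume "odd x"
    then obtain k where "x = 2 * k + 1" by (auto elim: oddE)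
    then show False using h by simp
  qed
next
  assume "even x" then obtain k where "x = 2 * k" by (auto elim: evenE)
  then show "(of_int x :: bit) = 0" by simp
qed

definition bint :: "bit \<Rightarrow> int" where "bint b = (if b = 0 then 0 else 1)"

lemma bint_of_int: "[bint (of_int x) = x] (mod 2)"
  by (cases "even x") (auto simp: bint_def of_int_bit_0 cong_iff_dvd_diff)

lemma bint_add: "[bint (a + b) = bint a + bint b] (mod 2)"
  by (cases a; cases b) (auto simp: bint_def cong_def)

text \<open>The constant sequence 1 obeys the recurrence of \<open>f\<close> modulo 2 because f(1)
  is even. The resulting weight is 1 on every power of \<open>lam\<close>, hence invariant under
  scaling, and the sign of a rotation with lengths \<open>pw k\<close> and \<open>pw k\<close> y is
  the weight of y.\<close>

lemma sign_invariant:
  assumes ev: "even (poly f 1)"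
  obtains \<chi> v where "addm 2 v" "\<And>k. [v (pw k) = 1] (mod 2)"
    "\<And>g h. g \<in> W \<Longrightarrow> h \<in> W \<Longrightarrow> [\<chi> (g \<circ> h) = \<chi> g + \<chi> h] (mod 2)"
    "\<And>k y. y \<in> \<Gamma> \<Longrightarrow> 0 < y \<Longrightarrow> pw k + pw k + pw k * y < l \<Longrightarrow> [\<chi> (rot (pw k) (pw k) (pw k * y)) = v y] (mod 2)"
proof -
  have "recm 2 (\<lambda>_. 1)" unfolding recm_def Lf_def using ev by (simp add: poly_altdef)
  then obtain v where v: "addm 2 v" "\<And>k. [v (pw k) = 1] (mod 2)" using lin_exists by blast
  define e where "e x = (of_int (v x) :: bit)" for x
  have ea: "e (x + y) = e x + e y" if "x \<in> \<Gamma>" "y \<in> \<Gamma>" for x y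
    using of_int_bit_cong[OF addm_add[OF v(1) that]] by (simp add: e_def)
  have e1: "e (pw k) = 1" for k using of_int_bit_cong[OF v(2)[of k]] by (simp add: e_def)
  have em: "e (x - y) = e x - e y" if "x \<in> \<Gamma>" "y \<in> \<Gamma>" for x y
    using of_int_bit_cong[OF addm_diff[OF v(1) that]] by (simp add: e_def)
  have e0: "e 0 = 0" using of_int_bit_cong[OF addm_0[OF v(1)]] by (simp add: e_def)
  have es: "e (pw k * x) = e x" if "x \<in> \<Gamma>" for x k
    using that
  proof (induction x rule: G_induct)
    case (add x j)
    have "e (pw k * x + pw (k + j)) = e (pw k * x) + e (pw (k + j))" using ea add(1) by simp
    then show ?case using add ea[OF add(1) G_pw[of j]] e1[of j] e1[of "k + j"] by (simp add: pw_add distrib_left)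
  next
    case (sub x j)
    have "e (pw k * x - pw (k + j)) = e (pw k * x) - e (pw (k + j))" using em sub(1) by simp
    then show ?case using sub em[OF sub(1) G_pw[of j]] e1[of j] e1[of "k + j"] by (simp add: pw_add right_diff_distrib)
  qed (simp add: e0)
  have wt: "wt e" unfolding wt_def using ea es by blast
  show ?thesis
  proof (rule that[OF v, of "\<lambda>g. bint (sgn_pl e g)"])
    fix g h assume "g \<in> W" "h \<in> W"
    then show "[bint (sgn_pl e (g \<circ> h)) = bint (sgn_pl e g) + bint (sgn_pl e h)] (mod 2)"
      using sgn_comp[OF wt, of h g] bint_add[of "sgn_pl e g" "sgn_pl e h"] by (simp add: add.commute)
  next
    fix k y assume y: "y \<in> \<Gamma>" "0 < y" "pw k + pw k + pw k * y < l"
    have "sgn_pl e (rot (pw k) (pw k) (pw k * y)) = e (pw k) * e (pw k * y)" by (rule sgn_rot[OF wt]) (use y in auto)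
    then have "sgn_pl e (rot (pw k) (pw k) (pw k * y)) = of_int (v y)" using e1 es[OF y(1)] by (simp add: e_def)
    then show "[bint (sgn_pl e (rot (pw k) (pw k) (pw k * y))) = v y] (mod 2)" using bint_of_int by simp
  qed
qed

end

section \<open>The relations among rotations\<close>

locale pl_both = pl_hom lam l A \<phi> + pl_poly lam l f
  for lam l :: real and A :: "('g, 'm) monoid_scheme" (structure) and \<phi> :: "(real \<Rightarrow> real) \<Rightarrow> 'g" and f :: "int poly"
begin

lemma Ker_2: "2 \<in> Ker" using Ker_sym[of 0] by simp

lemma Ker_even: assumes "even n" shows "of_int n \<in> Ker"
proof -
  obtain k where "n = 2 * k" using assms by (auto elim: evenE)
  then have "of_int n = of_int k * (2 :: real)" by simp
  then show ?thesis using Ker_int[OF Ker_2, of k] by (simp only:)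
qed

lemma Ker_odd_1: assumes "odd n" "of_int n \<in> Ker" shows "1 \<in> Ker"
proof -
  have "of_int n - of_int (n - 1) \<in> Ker" using Ker_diff[OF assms(2) Ker_even[of "n - 1"]] assms(1) by simp
  then show ?thesis by simp
qed

text \<open>The case of \<open>Ker_rel\<close> for the relation f(\<open>lam\<close>) = 0; the
  factor in front of y is f(1/\<open>lam\<close>).\<close>

lemma Ker_f:
  assumes "y \<in> \<Gamma>"
  shows "(\<Sum>i\<le>degree f. of_int (coeff f i) * pw (- int i)) * y \<in> Ker"
proof -
  have re: "(\<Sum>k\<in>int ` {..degree f}. g k) = (\<Sum>i\<le>degree f. g (int i))" for g :: "int \<Rightarrow> real"
    by (subst sum.reindex) (auto simp: inj_on_def)
  have "(\<Sum>k\<in>int ` {..degree f}. of_int (coeff f (nat k)) * pw k) = 0"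
    unfolding re using ev_f unfolding ev_sum by (simp add: pw_nat)
  then have "(\<Sum>k\<in>int ` {..degree f}. of_int (coeff f (nat k)) * pw (- k)) * y \<in> Ker"
    by (rule Ker_rel[rotated]) (use assms in auto)
  then show ?thesis unfolding re by simp
qed

definition span2 :: "real \<Rightarrow> bool" where
  "span2 y \<longleftrightarrow> y \<in> \<Gamma> \<and> (\<exists>a b :: int. y - (of_int a + of_int b * lam) \<in> Ker)"

lemma span2_lin: assumes "span2 x" "span2 y" shows "span2 (of_int c * x + of_int d * y)"
proof -
  obtain a b a' b' :: int where h: "x - (of_int a + of_int b * lam) \<in> Ker" "y - (of_int a' + of_int b' * lam) \<in> Ker"
    using assms unfolding span2_def by blast
  have "of_int c * (x - (of_int a + of_int b * lam)) + of_int d * (y - (of_int a' + of_int b' * lam)) \<in> Ker"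
    using h by (intro Ker_add Ker_int)
  also have "of_int c * (x - (of_int a + of_int b * lam)) + of_int d * (y - (of_int a' + of_int b' * lam))
    = of_int c * x + of_int d * y - (of_int (c * a + d * a') + of_int (c * b + d * b') * lam)"
    by (simp add: algebra_simps)
  finally have "\<exists>a b :: int. of_int c * x + of_int d * y - (of_int a + of_int b * lam) \<in> Ker" by blast
  then show ?thesis using assms unfolding span2_def by simp
qed

lemma span2_I: "y \<in> \<Gamma> \<Longrightarrow> y - (of_int a + of_int b * lam) \<in> Ker \<Longrightarrow> span2 y"
  unfolding span2_def by blast

lemma span2_0: "span2 0" by (rule span2_I[of _ 0 0]) (simp_all add: Ker_0)
lemma span2_1: "span2 1" by (rule span2_I[of _ 1 0]) (simp_all add: Ker_0)
lemma span2_lam: "span2 lam" by (rule span2_I[of _ 0 1]) (simp_all add: Ker_0)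

text \<open>By \<open>Ker_sym\<close> a negative power is, modulo \<open>Ker\<close>, minus the
  corresponding positive one.\<close>

lemma span2_all:
  assumes n: "\<And>n. span2 (lam ^ n)" and y: "y \<in> \<Gamma>"
  shows "\<exists>a b :: int. y - (of_int a + of_int b * lam) \<in> Ker"
proof -
  have p: "span2 (pw k)" for k
  proof (cases "k \<ge> 0")
    case True
    then have "pw k = lam ^ nat k" using pw_nat[of "nat k"] by simp
    then show ?thesis using n by simp
  next
    case False
    define j where "j = nat (- k)"
    have k: "k = - int j" using False by (simp add: j_def)
    obtain a b :: int where ab: "lam ^ j - (of_int a + of_int b * lam) \<in> Ker" using n[of j] unfolding span2_def by blast
    have "(pw (int j) + pw (- int j)) - (lam ^ j - (of_int a + of_int b * lam)) \<in> Ker"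
      using Ker_sym ab by (rule Ker_diff)
    also have "(pw (int j) + pw (- int j)) - (lam ^ j - (of_int a + of_int b * lam)) = pw k - (of_int (- a) + of_int (- b) * lam)"
      unfolding k pw_nat by simp
    finally show ?thesis by (rule span2_I[rotated]) simp
  qed
  have "span2 y" using y
  proof (induction y rule: G_induct)
    case zero then show ?case by (rule span2_0)
  next
    case (add x k) then show ?case using span2_lin[OF add(2) p[of k], of 1 1] by simp
  next
    case (sub x k) then show ?case using span2_lin[OF sub(2) p[of k], of 1 "-1"] by simp
  qed
  then show ?thesis unfolding span2_def by blast
qed

lemma addm_Ker_lin:
  assumes v: "addm m v" and vk: "\<And>y. y \<in> Ker \<Longrightarrow> [v y = 0] (mod m)"
    and y: "y \<in> \<Gamma>" "y - (of_int a + of_int b * lam) \<in> Ker"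
  shows "[v y = a * v 1 + b * v lam] (mod m)"
proof -
  let ?z = "of_int a * 1 + of_int b * lam"
  have zG: "of_int a * 1 \<in> \<Gamma>" "of_int b * lam \<in> \<Gamma>" using G_of_int[OF G_1] G_of_int[OF G_lam] by blast+
  have "[v (y - ?z) = v y - v ?z] (mod m)" using addm_diff[OF v y(1) G_add[OF zG]] .
  moreover have "[v (y - ?z) = 0] (mod m)" using vk y(2) by simp
  ultimately have "m dvd 0 - (v y - v ?z)" using cong_sym cong_trans unfolding cong_iff_dvd_diff[symmetric] by blast
  then have "m dvd v y - v ?z" by (simp add: dvd_diff_commute)
  then have 1: "[v y = v ?z] (mod m)" by (simp only: cong_iff_dvd_diff)
  have 2: "[v ?z = v (of_int a * 1) + v (of_int b * lam)] (mod m)" using addm_add[OF v zG] .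
  have 3: "[v (of_int a * 1) + v (of_int b * lam) = a * v 1 + b * v lam] (mod m)"
    using addm_int[OF v G_1, of a] addm_int[OF v G_lam, of b] by (intro cong_add)
  show ?thesis using 1 2 3 cong_trans by blast
qed

subsection \<open>Degree one\<close>

text \<open>Here \<open>lam\<close> is an integer N and f = t - N; the last relation is
  f(1/\<open>lam\<close>) applied to \<open>lam\<close> y.\<close>

lemma deg1:
  assumes d: "degree f = 1"
  obtains N :: int where "lam = of_int N" "poly f 1 = 1 - N" "\<And>y. y \<in> \<Gamma> \<Longrightarrow> of_int (1 - N * N) * y \<in> Ker"
proof -
  define N where "N = - coeff f 0"
  have c1: "coeff f 1 = 1" using monic d by simp
  have "of_int (coeff f 0) + of_int (coeff f 1) * lam = 0" using ev_f unfolding ev_sum d by simp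
  then have lN: "lam = of_int N" using c1 by (simp add: N_def)
  have "poly f 1 = 1 - N" using c1 d by (simp add: poly_altdef N_def)
  moreover have "of_int (1 - N * N) * y \<in> Ker" if y: "y \<in> \<Gamma>" for y
  proof -
    have "pw 1 * y \<in> \<Gamma>" using y by (rule G_scale)
    from Ker_f[OF this] have "(of_int (coeff f 0) + of_int (coeff f 1) * pw (-1)) * (pw 1 * y) \<in> Ker" unfolding d by simp
    also have "(of_int (coeff f 0) + of_int (coeff f 1) * pw (-1)) * (pw 1 * y) = of_int (1 - N * N) * y"
    proof -
      have c0: "of_int (coeff f 0) = - lam" "of_int (1 - N * N) = 1 - lam * lam" using lN by (simp_all add: N_def)
      show ?thesis unfolding c0 c1 using lam_pos by (simp add: pw_m1 field_simps)
    qed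
    finally show ?thesis .
  qed
  ultimately show ?thesis using that lN by blast
qed

lemma deg1_span:
  assumes d: "degree f = 1" and y: "y \<in> \<Gamma>"
  shows "\<exists>n :: int. y - of_int n \<in> Ker"
proof -
  obtain N :: int where N: "lam = of_int N" using deg1[OF d] by blast
  have "span2 (lam ^ n)" for n
  proof (rule span2_I[of _ "N ^ n" 0])
    show "lam ^ n \<in> \<Gamma>" using G_pw[of "int n"] unfolding pw_nat .
    have "lam ^ n - (of_int (N ^ n) + of_int 0 * lam) = 0" using N by simp
    then show "lam ^ n - (of_int (N ^ n) + of_int 0 * lam) \<in> Ker" using Ker_0 by (simp only:)
  qed
  then obtain a b :: int where "y - (of_int a + of_int b * lam) \<in> Ker" using span2_all[OF _ y] by blast
  moreover have "of_int a + of_int b * lam = of_int (a + b * N)" using N by simp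
  ultimately have "y - of_int (a + b * N) \<in> Ker" by (simp only:)
  then show ?thesis by blast
qed

text \<open>Now N is even, so the odd number 1 - N^2 and 2 both lie in \<open>Ker\<close>, and
  together they generate 1.\<close>

lemma deg1_odd:
  assumes d: "degree f = 1" and o: "odd (poly f 1)" and y: "y \<in> \<Gamma>"
  shows "y \<in> Ker"
proof -
  obtain N :: int where N: "poly f 1 = 1 - N" "\<And>y. y \<in> \<Gamma> \<Longrightarrow> of_int (1 - N * N) * y \<in> Ker" using deg1[OF d] by blast
  have "of_int (1 - N * N) \<in> Ker" using N(2)[OF G_1] by simp
  moreover have "odd (1 - N * N)" using o N(1) by simp
  ultimately have one: "1 \<in> Ker" using Ker_odd_1 by blast
  obtain n :: int where n: "y - of_int n \<in> Ker" using deg1_span[OF d y] by blast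
  have "of_int n \<in> Ker" using Ker_int[OF one, of n] by simp
  then show ?thesis using Ker_add[OF n] by force
qed

lemma deg1_even:
  assumes d: "degree f = 1" and v: "addm 2 v" "[v 1 = 1] (mod 2)" and vk: "\<And>y. y \<in> Ker \<Longrightarrow> [v y = 0] (mod 2)"
    and y: "y \<in> \<Gamma>" "[v y = 0] (mod 2)"
  shows "y \<in> Ker"
proof -
  obtain n :: int where n: "y - of_int n \<in> Ker" using deg1_span[OF d y(1)] by blast
  have n0: "y - (of_int n + of_int 0 * lam) \<in> Ker" using n by simp
  have "[v y = n * v 1 + 0 * v lam] (mod 2)" by (rule addm_Ker_lin[OF v(1) vk y(1) n0])
  moreover have "[n * v 1 + 0 * v lam = n * 1 + 0 * v lam] (mod 2)" using v(2) by (intro cong_add cong_mult cong_refl)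
  ultimately have "[n = 0] (mod 2)" using y(2) by (simp add: cong_def)
  then have "even n" by (simp add: cong_iff_dvd_diff)
  then show ?thesis using Ker_add[OF n Ker_even] by force
qed

subsection \<open>Degree two\<close>

lemma deg2_coeff:
  assumes d: "degree f = 2"
  shows "lam * lam + of_int (coeff f 1) * lam + of_int (coeff f 0) = 0" "poly f 1 = 1 + coeff f 1 + coeff f 0"
proof -
  have c2: "coeff f 2 = 1" using monic d by simp
  have e: "{..2::nat} = {0, 1, 2}" by auto
  have "(\<Sum>i\<le>2. of_int (coeff f i) * lam ^ i) = 0" using ev_f unfolding ev_sum d .
  then show "lam * lam + of_int (coeff f 1) * lam + of_int (coeff f 0) = 0"
    unfolding e using c2 by (simp add: power2_eq_square algebra_simps)
  show "poly f 1 = 1 + coeff f 1 + coeff f 0" unfolding poly_altdef d e using c2 by simp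
qed

text \<open>The element \<open>lam\<close> + 1/\<open>lam\<close> lies in \<open>Ker\<close>; in its
  multiple by -a_0 the inverse disappears through a_0 / \<open>lam\<close> = -\<open>lam\<close> -
  a_1.\<close>

lemma deg2_rel:
  assumes d: "degree f = 2"
  shows "of_int (1 - coeff f 0) * lam + of_int (coeff f 1) \<in> Ker"
proof -
  define i where "i = 1 / lam"
  have i: "lam * i = 1" using lam_pos by (simp add: i_def)
  have "of_int (- coeff f 0) * (pw 1 + pw (- 1)) \<in> Ker" by (intro Ker_int Ker_sym)
  also have "pw 1 + pw (- 1) = lam + i" by (simp add: pw_m1 i_def)
  also have "of_int (- coeff f 0) * (lam + i) = of_int (1 - coeff f 0) * lam + of_int (coeff f 1)"
  proof -
    have "i * (lam * lam + of_int (coeff f 1) * lam + of_int (coeff f 0)) = 0" using deg2_coeff(1)[OF d] by simp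
    then have "lam * (lam * i) + of_int (coeff f 1) * (lam * i) + of_int (coeff f 0) * i = 0" by (simp add: algebra_simps)
    then show ?thesis unfolding i by (simp add: algebra_simps)
  qed
  finally show ?thesis .
qed

text \<open>Reducing \<open>lam\<close>^2 f(1/\<open>lam\<close>) by f and by
  \<open>deg2_rel\<close> leaves the integer 1 - a_0^2 - a_1^2, which has the parity of
  f(1).\<close>

lemma deg2_one:
  assumes d: "degree f = 2" and o: "odd (poly f 1)"
  shows "1 \<in> Ker"
proof -
  let ?a = "of_int (coeff f 0) :: real" and ?b = "of_int (coeff f 1) :: real"
  have c2: "coeff f 2 = 1" using monic d by simp
  have e: "{..2::nat} = {0, 1, 2}" by auto
  have q: "lam * lam = - ?b * lam - ?a" using deg2_coeff(1)[OF d] by linarith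
  have "pw 2 = lam * lam" using pw_nat[of 2] by (simp add: power2_eq_square)
  have "(?a + ?b * pw (-1) + pw (-2)) * pw 2 \<in> Ker"
    using Ker_f[OF G_pw[of 2]] unfolding d e using c2 by (simp add: algebra_simps)
  also have "(?a + ?b * pw (-1) + pw (-2)) * pw 2 = ?a * (lam * lam) + ?b * lam + 1"
  proof -
    have "pw (-1) * pw 2 = lam" using pw_add[of "-1" 2] by simp
    moreover have "pw (-2) * pw 2 = 1" using pw_add[of "-2" 2] by simp
    ultimately show ?thesis using \<open>pw 2 = lam * lam\<close> by (simp add: distrib_right mult.assoc)
  qed
  finally have 1: "?a * (lam * lam) + ?b * lam + 1 \<in> Ker" .
  have "(?a * (lam * lam) + ?b * lam + 1) - of_int (coeff f 1) * (of_int (1 - coeff f 0) * lam + of_int (coeff f 1)) \<in> Ker"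
    by (intro Ker_diff 1 Ker_int deg2_rel[OF d])
  also have "(?a * (lam * lam) + ?b * lam + 1) - of_int (coeff f 1) * (of_int (1 - coeff f 0) * lam + of_int (coeff f 1))
     = of_int (1 - coeff f 0 * coeff f 0 - coeff f 1 * coeff f 1)"
    unfolding q by (simp add: algebra_simps)
  finally have "of_int (1 - coeff f 0 * coeff f 0 - coeff f 1 * coeff f 1) \<in> Ker" .
  moreover have "odd (1 - coeff f 0 * coeff f 0 - coeff f 1 * coeff f 1)"
    using o unfolding deg2_coeff(2)[OF d] by auto
  ultimately show ?thesis using Ker_odd_1 by blast
qed

lemma deg2_span:
  assumes d: "degree f = 2" and y: "y \<in> \<Gamma>"
  shows "\<exists>a b :: int. y - (of_int a + of_int b * lam) \<in> Ker"
proof (rule span2_all[OF _ y])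
  have q: "lam * lam = of_int (- coeff f 1) * lam + of_int (- coeff f 0) * 1" using deg2_coeff(1)[OF d] by simp
  have "span2 (lam ^ n) \<and> span2 (lam ^ Suc n)" for n
  proof (induction n)
    case 0 then show ?case using span2_1 span2_lam by simp
  next
    case (Suc n)
    have "lam ^ Suc (Suc n) = of_int (- coeff f 1) * lam ^ Suc n + of_int (- coeff f 0) * lam ^ n"
      using arg_cong[OF q, of "\<lambda>z. z * lam ^ n"] by (simp add: algebra_simps)
    then show ?case using span2_lin[of "lam ^ Suc n" "lam ^ n"] Suc by (simp only:)
  qed
  then show "span2 (lam ^ n)" for n by blast
qed

lemma deg2_odd:
  assumes d: "degree f = 2" and o: "odd (poly f 1)"
    and v: "addm (1 - coeff f 0) v" "[v 1 = 0] (mod (1 - coeff f 0))" "[v lam = 1] (mod (1 - coeff f 0))"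
    and vk: "\<And>y. y \<in> Ker \<Longrightarrow> [v y = 0] (mod (1 - coeff f 0))"
    and y: "y \<in> \<Gamma>" "[v y = 0] (mod (1 - coeff f 0))"
  shows "y \<in> Ker"
proof -
  let ?m = "1 - coeff f 0"
  obtain a b :: int where ab: "y - (of_int a + of_int b * lam) \<in> Ker" using deg2_span[OF d y(1)] by blast
  have "[v y = a * v 1 + b * v lam] (mod ?m)" by (rule addm_Ker_lin[OF v(1) vk y(1) ab])
  moreover have "[a * v 1 + b * v lam = a * 0 + b * 1] (mod ?m)" using v(2,3) by (intro cong_add cong_mult cong_refl)
  ultimately have "[b = 0] (mod ?m)" using y(2) by (simp add: cong_def)
  then obtain c where c: "b = ?m * c" by (auto simp: cong_iff_dvd_diff elim: dvdE)
  have one: "1 \<in> Ker" using deg2_one[OF d o] .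
  have "(y - (of_int a + of_int b * lam)) + of_int c * (of_int ?m * lam + of_int (coeff f 1)) + of_int (a - c * coeff f 1) * 1 \<in> Ker"
    by (intro Ker_add Ker_int ab one deg2_rel[OF d])
  also have "(y - (of_int a + of_int b * lam)) + of_int c * (of_int ?m * lam + of_int (coeff f 1)) + of_int (a - c * coeff f 1) * 1 = y"
    unfolding c by (simp add: algebra_simps)
  finally show ?thesis .
qed

lemma deg2_even:
  assumes d: "degree f = 2" and ev: "even (poly f 1)"
    and v: "addm (1 - coeff f 0) v" "[v 1 = 0] (mod (1 - coeff f 0))" "[v lam = 1] (mod (1 - coeff f 0))"
    and vk: "\<And>y. y \<in> Ker \<Longrightarrow> [v y = 0] (mod (1 - coeff f 0))"
    and w: "addm 2 w" "[w 1 = 1] (mod 2)" "[w lam = 1] (mod 2)" and wk: "\<And>y. y \<in> Ker \<Longrightarrow> [w y = 0] (mod 2)"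
    and y: "y \<in> \<Gamma>" "[v y = 0] (mod (1 - coeff f 0))" "[w y = 0] (mod 2)"
  shows "y \<in> Ker"
proof -
  let ?m = "1 - coeff f 0"
  obtain a b :: int where ab: "y - (of_int a + of_int b * lam) \<in> Ker" using deg2_span[OF d y(1)] by blast
  have "[v y = a * v 1 + b * v lam] (mod ?m)" by (rule addm_Ker_lin[OF v(1) vk y(1) ab])
  moreover have "[a * v 1 + b * v lam = a * 0 + b * 1] (mod ?m)" using v(2,3) by (intro cong_add cong_mult cong_refl)
  ultimately have "[b = 0] (mod ?m)" using y(2) by (simp add: cong_def)
  then obtain c where c: "b = ?m * c" by (auto simp: cong_iff_dvd_diff elim: dvdE)
  have "[w y = a * w 1 + b * w lam] (mod 2)" by (rule addm_Ker_lin[OF w(1) wk y(1) ab])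
  moreover have "[a * w 1 + b * w lam = a * 1 + b * 1] (mod 2)" using w(2,3) by (intro cong_add cong_mult cong_refl)
  ultimately have "[a + b = 0] (mod 2)" using y(3) by (simp add: cong_def)
  then have "even (a + b)" by (simp add: cong_iff_dvd_diff)
  \<comment> \<open>As f(1) is even, 1 - a_0 and a_1 have equal parity; hence so do b and c a_1,
    while a + b is even.\<close>
  then have e: "even (a - c * coeff f 1)" using ev unfolding deg2_coeff(2)[OF d] c by auto
  have "(y - (of_int a + of_int b * lam)) + of_int c * (of_int ?m * lam + of_int (coeff f 1)) + of_int (a - c * coeff f 1) \<in> Ker"
    by (intro Ker_add Ker_int ab deg2_rel[OF d] Ker_even[OF e])
  also have "(y - (of_int a + of_int b * lam)) + of_int c * (of_int ?m * lam + of_int (coeff f 1)) + of_int (a - c * coeff f 1) = y"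
    unfolding c by (simp add: algebra_simps)
  finally show ?thesis .
qed

subsection \<open>Degree three\<close>

text \<open>The relations used are \<open>lam\<close>^n + \<open>lam\<close>^-n for n = 1, 2 and the
  multiples of f(1/\<open>lam\<close>) by \<open>lam\<close>^2 and \<open>lam\<close>^3. One
  combination is the integer -(a_1^2 + a_2^2), odd by assumption, so 1 lies in \<open>Ker\<close>;
  the multiple by \<open>lam\<close>^2 is (a_1 + a_2)(\<open>lam\<close> + 1) and then loses its
  constant term.\<close>

lemma deg3_rels:
  assumes d: "degree f = 3" and c0: "coeff f 0 = -1" and o: "odd (coeff f 2 + coeff f 1)"
  shows "1 \<in> Ker" "of_int (coeff f 1 + coeff f 2) * lam \<in> Ker"
    "lam * lam + of_int (coeff f 2 + 1) * lam + of_int (coeff f 1) \<in> Ker"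
    "lam * lam * lam = of_int (- coeff f 2) * (lam * lam) + of_int (- coeff f 1) * lam + 1"
proof -
  define a b :: real where "a = of_int (coeff f 1)" and "b = of_int (coeff f 2)"
  define i where "i = 1 / lam"
  have i: "lam * i = 1" using lam_pos by (simp add: i_def)
  have c3: "coeff f 3 = 1" using monic d by simp
  have e: "{..3::nat} = {0, 1, 2, 3}" by auto
  have "(\<Sum>j\<le>3. of_int (coeff f j) * lam ^ j) = 0" using ev_f unfolding ev_sum d .
  then have q: "lam * lam * lam + b * (lam * lam) + a * lam - 1 = 0"
    unfolding e using c3 c0 by (simp add: power2_eq_square power3_eq_cube algebra_simps a_def b_def)
  then show "lam * lam * lam = of_int (- coeff f 2) * (lam * lam) + of_int (- coeff f 1) * lam + 1"
    by (simp add: a_def b_def)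
  have p: "pw 1 = lam" "pw 2 = lam * lam" "pw 3 = lam * lam * lam" "pw (-1) = i" "pw (-2) = i * i" "pw (-3) = i * i * i"
    using pw_nat[of 2] pw_nat[of 3] pw_minus[of 2] pw_minus[of 3]
    by (simp_all add: pw_m1 i_def power2_eq_square power3_eq_cube)
  have K: "(- 1 + a * i + b * (i * i) + i * i * i) * y \<in> Ker" if "y \<in> \<Gamma>" for y
  proof -
    have "(\<Sum>j\<le>3. of_int (coeff f j) * pw (- int j)) = - 1 + a * i + b * (i * i) + i * i * i"
      unfolding e using c3 c0 p by (simp add: a_def b_def)
    then show ?thesis using Ker_f[OF that] unfolding d by (simp only:)
  qed
  have iq: "i = lam * lam + b * lam + a"
  proof -
    have "i * (lam * lam * lam + b * (lam * lam) + a * lam - 1) = 0" using q by simp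
    then have "(lam * i) * lam * lam + b * (lam * i) * lam + a * (lam * i) - i = 0" by (simp add: algebra_simps)
    then show ?thesis unfolding i by simp
  qed
  have iiq: "i * i = lam + b + a * i"
  proof -
    have "i * i = i * (lam * lam + b * lam + a)" by (subst iq) simp
    also have "\<dots> = (lam * i) * lam + b * (lam * i) + a * i" by (simp add: algebra_simps)
    finally show ?thesis unfolding i by simp
  qed
  have s1: "lam + i \<in> Ker" and s2: "lam * lam + i * i \<in> Ker" using Ker_sym[of 1] Ker_sym[of 2] p by simp_all
  have "lam + i = lam * lam + (b + 1) * lam + a" unfolding iq by (simp add: algebra_simps)
  then have k1: "lam * lam + (b + 1) * lam + a \<in> Ker" using s1 by simp
  then show "lam * lam + of_int (coeff f 2 + 1) * lam + of_int (coeff f 1) \<in> Ker" by (simp add: a_def b_def)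
  have e1: "(a + b) * lam + (a + b) \<in> Ker"
  proof -
    have "(- 1 + a * i + b * (i * i) + i * i * i) * pw 2 \<in> Ker" by (rule K) simp
    also have "(- 1 + a * i + b * (i * i) + i * i * i) * pw 2
      = - (lam * lam) + a * (lam * i) * lam + b * (lam * i) * (lam * i) + (lam * i) * (lam * i) * i"
      unfolding p by (simp add: algebra_simps)
    also have "\<dots> = (a + b) * lam + (a + b)" unfolding i by (simp add: iq algebra_simps)
    finally show ?thesis .
  qed
  have e3: "(a + b) * (lam * lam + lam) \<in> Ker"
  proof -
    have "(- 1 + a * i + b * (i * i) + i * i * i) * pw 3 \<in> Ker" by (rule K) simp
    also have "(- 1 + a * i + b * (i * i) + i * i * i) * pw 3
      = - (lam * lam * lam) + a * (lam * i) * (lam * lam) + b * (lam * i) * (lam * i) * lam + (lam * i) * (lam * i) * (lam * i)"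
      unfolding p by (simp add: algebra_simps)
    also have "\<dots> = (a + b) * (lam * lam + lam)" unfolding i using q by (simp add: algebra_simps)
    finally show ?thesis .
  qed
  have e2: "- (a + b) * lam + (b - a) \<in> Ker"
  proof -
    have "(lam * lam + i * i) - of_int (coeff f 1) * (lam + i) - (lam * lam + (b + 1) * lam + a) \<in> Ker"
      by (intro Ker_diff Ker_int s1 s2 k1)
    also have "(lam * lam + i * i) - of_int (coeff f 1) * (lam + i) - (lam * lam + (b + 1) * lam + a) = - (a + b) * lam + (b - a)"
      unfolding iiq a_def[symmetric] by (simp add: algebra_simps)
    finally show ?thesis .
  qed
  have "(a + b) * (lam * lam + lam) - of_int (coeff f 1 + coeff f 2) * (lam * lam + (b + 1) * lam + a)
      - of_int (coeff f 2) * (- (a + b) * lam + (b - a)) \<in> Ker"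
    by (intro Ker_diff Ker_int e3 k1 e2)
  also have "(a + b) * (lam * lam + lam) - of_int (coeff f 1 + coeff f 2) * (lam * lam + (b + 1) * lam + a)
      - of_int (coeff f 2) * (- (a + b) * lam + (b - a)) = of_int (- (coeff f 1 * coeff f 1) - coeff f 2 * coeff f 2)"
    unfolding a_def b_def by (simp add: algebra_simps)
  finally have "of_int (- (coeff f 1 * coeff f 1) - coeff f 2 * coeff f 2) \<in> Ker" .
  moreover have "odd (- (coeff f 1 * coeff f 1) - coeff f 2 * coeff f 2)" using o by auto
  ultimately show one: "1 \<in> Ker" using Ker_odd_1 by blast
  have "((a + b) * lam + (a + b)) - of_int (coeff f 1 + coeff f 2) * 1 \<in> Ker" by (intro Ker_diff Ker_int e1 one)
  then show "of_int (coeff f 1 + coeff f 2) * lam \<in> Ker" by (simp add: a_def b_def)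
qed

text \<open>The relation \<open>lam\<close> + 1/\<open>lam\<close> expresses \<open>lam\<close>^2
  through 1 and \<open>lam\<close> modulo \<open>Ker\<close>; the cubic recurrence then covers all
  higher powers.\<close>

lemma deg3_span:
  assumes d: "degree f = 3" and c0: "coeff f 0 = -1" and o: "odd (coeff f 2 + coeff f 1)" and y: "y \<in> \<Gamma>"
  shows "\<exists>a b :: int. y - (of_int a + of_int b * lam) \<in> Ker"
proof (rule span2_all[OF _ y])
  note R = deg3_rels[OF d c0 o]
  have G2: "lam * lam \<in> \<Gamma>" using G_scale[OF G_lam, of 1] by simp
  have s2: "span2 (lam * lam)"
    by (rule span2_I[of _ "- coeff f 1" "- (coeff f 2 + 1)"]) (use G2 R(3) in \<open>simp_all add: algebra_simps\<close>)
  have "span2 (lam ^ n) \<and> span2 (lam ^ Suc n) \<and> span2 (lam ^ Suc (Suc n))" for n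
  proof (induction n)
    case 0 then show ?case using span2_1 span2_lam s2 by simp
  next
    case (Suc n)
    have e: "lam ^ Suc (Suc (Suc n)) = of_int 1 * (of_int (- coeff f 2) * lam ^ Suc (Suc n) + of_int (- coeff f 1) * lam ^ Suc n) + of_int 1 * lam ^ n"
      using arg_cong[OF R(4), of "\<lambda>z. z * lam ^ n"] by (simp add: algebra_simps)
    have "span2 (of_int 1 * (of_int (- coeff f 2) * lam ^ Suc (Suc n) + of_int (- coeff f 1) * lam ^ Suc n) + of_int 1 * lam ^ n)"
      using Suc by (intro span2_lin) blast+
    then show ?case using Suc e by (simp only:)
  qed
  then show "span2 (lam ^ n)" for n by blast
qed

lemma deg3_ker:
  assumes d: "degree f = 3" and c0: "coeff f 0 = -1" and o: "odd (coeff f 2 + coeff f 1)"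
    and v: "addm (coeff f 1 + coeff f 2) v" "[v 1 = 0] (mod (coeff f 1 + coeff f 2))" "[v lam = 1] (mod (coeff f 1 + coeff f 2))"
    and vk: "\<And>y. y \<in> Ker \<Longrightarrow> [v y = 0] (mod (coeff f 1 + coeff f 2))"
    and y: "y \<in> \<Gamma>" "[v y = 0] (mod (coeff f 1 + coeff f 2))"
  shows "y \<in> Ker"
proof -
  let ?m = "coeff f 1 + coeff f 2"
  note R = deg3_rels[OF d c0 o]
  obtain a b :: int where ab: "y - (of_int a + of_int b * lam) \<in> Ker" using deg3_span[OF d c0 o y(1)] by blast
  have "[v y = a * v 1 + b * v lam] (mod ?m)" by (rule addm_Ker_lin[OF v(1) vk y(1) ab])
  moreover have "[a * v 1 + b * v lam = a * 0 + b * 1] (mod ?m)" using v(2,3) by (intro cong_add cong_mult cong_refl)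
  ultimately have "[b = 0] (mod ?m)" using y(2) by (simp add: cong_def)
  then obtain c where c: "b = ?m * c" by (auto simp: cong_iff_dvd_diff elim: dvdE)
  have "(y - (of_int a + of_int b * lam)) + of_int c * (of_int ?m * lam) + of_int a * 1 \<in> Ker"
    by (intro Ker_add Ker_int ab R(1,2))
  also have "(y - (of_int a + of_int b * lam)) + of_int c * (of_int ?m * lam) + of_int a * 1 = y"
    unfolding c by (simp add: algebra_simps)
  finally show ?thesis .
qed

end

section \<open>Quadratic factors t^2 + s t + 1 of the minimal polynomial modulo m\<close>

context pl_poly
begin

text \<open>Modulo 1 - a_0 the polynomial f becomes t^2 + a_1 t + 1.\<close>

lemma recm_deg2:
  assumes d: "degree f = 2" and b: "\<And>n. b (n + 2) = - (coeff f 1) * b (n + 1) - b n"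
  shows "recm (1 - coeff f 0) b"
  unfolding recm_def
proof
  fix n
  have c2: "coeff f 2 = 1" using monic d by simp
  have e: "{..2::nat} = {0, 1, 2}" by auto
  have "Lf b n f = coeff f 0 * b n + coeff f 1 * b (n + 1) + b (n + 2)" unfolding Lf_def d e using c2 by simp
  also have "\<dots> = (1 - coeff f 0) * (- b n)" unfolding b by (simp add: algebra_simps)
  finally show "1 - coeff f 0 dvd Lf b n f" by simp
qed

text \<open>Modulo a_1 + a_2 the polynomial f becomes (t - 1)(t^2 + (a_2 + 1) t + 1).\<close>

lemma recm_deg3:
  assumes d: "degree f = 3" and c0: "coeff f 0 = -1" and b: "\<And>n. b (n + 2) = - (coeff f 2 + 1) * b (n + 1) - b n"
  shows "recm (coeff f 1 + coeff f 2) b"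
  unfolding recm_def
proof
  fix n
  have c3: "coeff f 3 = 1" using monic d by simp
  have e: "{..3::nat} = {0, 1, 2, 3}" by auto
  have "Lf b n f = - b n + coeff f 1 * b (n + 1) + coeff f 2 * b (n + 2) + b (n + 3)"
    unfolding Lf_def d e using c3 c0 by simp
  moreover have "b (n + 3) = - (coeff f 2 + 1) * b (n + 2) - b (n + 1)" using b[of "n + 1"] by (simp add: add.assoc)
  moreover note b[of n]
  ultimately have "Lf b n f = (coeff f 1 + coeff f 2) * b (n + 1)" by (simp add: algebra_simps)
  then show "coeff f 1 + coeff f 2 dvd Lf b n f" by simp
qed

end

section \<open>The group of the theorem\<close>

lemma hom_derived_one:
  assumes "group G" "comm_group H" "X \<in> hom G H" and d: "d \<in> derived G (carrier G)"
  shows "X d = \<one>\<^bsub>H\<^esub>"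
proof -
  interpret G: group G by fact
  interpret H: comm_group H by fact
  interpret X: group_hom G H X by unfold_locales fact
  have "derived_set G (carrier G) \<subseteq> kernel G H X"
  proof (rule subsetI)
    fix z assume "z \<in> derived_set G (carrier G)"
    then obtain a b where ab: "a \<in> carrier G" "b \<in> carrier G" "z = a \<otimes>\<^bsub>G\<^esub> b \<otimes>\<^bsub>G\<^esub> inv\<^bsub>G\<^esub> a \<otimes>\<^bsub>G\<^esub> inv\<^bsub>G\<^esub> b" by blast
    have c: "X a \<in> carrier H" "X b \<in> carrier H" using ab by auto
    have "X z = X a \<otimes>\<^bsub>H\<^esub> X b \<otimes>\<^bsub>H\<^esub> inv\<^bsub>H\<^esub> X a \<otimes>\<^bsub>H\<^esub> inv\<^bsub>H\<^esub> X b" using ab by simp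
    also have "\<dots> = (X a \<otimes>\<^bsub>H\<^esub> inv\<^bsub>H\<^esub> X a) \<otimes>\<^bsub>H\<^esub> (X b \<otimes>\<^bsub>H\<^esub> inv\<^bsub>H\<^esub> X b)"
      using c by (simp only: H.m_ac H.m_closed H.inv_closed)
    also have "\<dots> = \<one>\<^bsub>H\<^esub>" using c by simp
    finally show "z \<in> kernel G H X" using ab by (simp add: kernel_def)
  qed
  then have "d \<in> kernel G H X" using G.generate_subgroup_incl[OF _ X.subgroup_kernel] d unfolding derived_def by blast
  then show ?thesis by (simp add: kernel_def)
qed

lemma abelianisation_iso:
  assumes "group G" and H: "comm_group H" and X: "X \<in> hom G H" and surj: "X ` carrier G = carrier H"
    and ker: "\<And>g. g \<in> carrier G \<Longrightarrow> X g = \<one>\<^bsub>H\<^esub> \<Longrightarrow> g \<in> derived G (carrier G)"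
  shows "abelianisation G \<cong> H"
proof -
  interpret G: group G by fact
  interpret H: comm_group H by fact
  interpret X: group_hom G H X by unfold_locales (rule X)
  have "derived G (carrier G) \<subseteq> kernel G H X"
    using hom_derived_one[OF assms(1-3)] G.derived_in_carrier[of "carrier G"] by (auto simp: kernel_def)
  moreover have "kernel G H X \<subseteq> derived G (carrier G)" using ker by (auto simp: kernel_def)
  ultimately have "derived G (carrier G) = kernel G H X" by blast
  then show ?thesis unfolding abelianisation_def using X.FactGroup_iso[OF surj] by simp
qed

context pl
begin

lemma slope_group_eq: "slope_group lam = range pw"
proof
  have g: "group pos_real_group"
  proof (rule groupI)
    fix x assume "x \<in> carrier pos_real_group"
    then show "\<exists>y\<in>carrier pos_real_group. y \<otimes>\<^bsub>pos_real_group\<^esub> x = \<one>\<^bsub>pos_real_group\<^esub>"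
      by (intro bexI[of _ "1 / x"]) (auto simp: pos_real_group_def)
  qed (auto simp: pos_real_group_def)
  have i: "inv\<^bsub>pos_real_group\<^esub> lam = 1 / lam"
    by (rule group.inv_equality[OF g]) (use lam_pos in \<open>auto simp: pos_real_group_def\<close>)
  show "slope_group lam \<subseteq> range pw"
  proof
    fix s assume "s \<in> slope_group lam"
    then have "s \<in> generate pos_real_group {lam}" by (simp add: slope_group_def)
    then show "s \<in> range pw"
    proof induction
      case one
      have "pw 0 = \<one>\<^bsub>pos_real_group\<^esub>" by (simp add: pos_real_group_def)
      then show ?case by (metis rangeI)
    next
      case (incl h) then show ?case using pw_1 by (metis rangeI singletonD)
    next
      case (inv h)
      then have "inv\<^bsub>pos_real_group\<^esub> h = pw (-1)" using i pw_m1 by simp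
      then show ?case by (metis rangeI)
    next
      case (eng h1 h2)
      then obtain a b where "h1 = pw a" "h2 = pw b" by blast
      then have "h1 \<otimes>\<^bsub>pos_real_group\<^esub> h2 = pw (a + b)" by (simp add: pos_real_group_def pw_add)
      then show ?case by (metis rangeI)
    qed
  qed
  have m: "x * y \<in> slope_group lam" if "x \<in> slope_group lam" "y \<in> slope_group lam" for x y
    using generate.eng[OF that[unfolded slope_group_def]] by (simp add: slope_group_def pos_real_group_def)
  have o: "1 \<in> slope_group lam" using generate.one[of pos_real_group "{lam}"] by (simp add: slope_group_def pos_real_group_def)
  have l1: "lam \<in> slope_group lam" unfolding slope_group_def by (rule generate.incl) simp
  have l2: "1 / lam \<in> slope_group lam" using generate.inv[of lam "{lam}" pos_real_group] i by (simp add: slope_group_def)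
  have "pw k \<in> slope_group lam" for k
  proof (induction k rule: int_induct[where k = 0])
    case base then show ?case using o by simp
  next
    case (step1 i) then show ?case using m[OF step1(2) l1] by (simp add: pw_add)
  next
    case (step2 i)
    have "pw (i - 1) = pw i * (1 / lam)" using pw_add[of i "-1"] pw_m1 by simp
    then show ?case using m[OF step2(2) l2] by simp
  qed
  then show "range pw \<subseteq> slope_group lam" by blast
qed

section \<open>Identification of V with \<open>W\<close>\<close>

abbreviation "Vc \<equiv> V_carrier \<Gamma> (slope_group lam) l"
abbreviation "V \<equiv> V_group \<Gamma> (slope_group lam) l"
abbreviation "J \<equiv> {0..l}"

text \<open>\<open>rs\<close> and \<open>xt\<close> are mutually inverse between \<open>W\<close>
  and V. Overriding the value at l in \<open>xt\<close> changes nothing there, because elements of V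
  fix l by \<open>xt_W\<close>.\<close>

definition rs :: "(real \<Rightarrow> real) \<Rightarrow> real \<Rightarrow> real" where "rs f = restrict f J"
definition xt :: "(real \<Rightarrow> real) \<Rightarrow> real \<Rightarrow> real" where "xt g t = (if 0 \<le> t \<and> t < l then g t else t)"

lemma W_l: "f \<in> W \<Longrightarrow> f l = l" using W_out[of f l] by simp

lemma W_J: "f \<in> W \<Longrightarrow> t \<in> J \<Longrightarrow> f t \<in> J"
  using W_range[of f t] W_l[of f] by (cases "t = l") auto

lemma rs_Bij: assumes f: "f \<in> W" shows "rs f \<in> Bij J"
proof -
  have "bij_betw f J J"
  proof (rule bij_betwI[of _ _ _ "finv f"])
    show "f \<in> J \<rightarrow> J" "finv f \<in> J \<rightarrow> J" using W_J f W_inv by blast+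
  qed (auto simp: W_inv_f[OF f] W_f_inv[OF f])
  then have "bij_betw (rs f) J J" unfolding rs_def using bij_betw_cong[of J "restrict f J" f J] by simp
  then show ?thesis by (simp add: Bij_def rs_def)
qed

lemma rs_cont: assumes f: "f \<in> W" and t: "t \<in> J" shows "continuous (at t within {t..l}) (rs f)"
proof -
  obtain k where "germ f t k" using W_germ[OF f] by blast
  then obtain v where v: "v > t" "\<And>u. t \<le> u \<Longrightarrow> u < v \<Longrightarrow> f u = f t + pw k * (u - t)" unfolding germ_def by blast
  have lim: "((\<lambda>u. f t + pw k * (u - t)) \<longlongrightarrow> f t + pw k * (t - t)) (at t within {t..l})"
    by (intro tendsto_intros)
  have "eventually (\<lambda>u. f t + pw k * (u - t) = rs f u) (at t within {t..l})"
    unfolding eventually_at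
  proof (intro exI[of _ "v - t"] conjI ballI impI)
    show "0 < v - t" using v(1) by simp
    fix u assume u: "u \<in> {t..l}" "u \<noteq> t \<and> dist u t < v - t"
    then have "t \<le> u" "u < v" "u \<in> J" using t by (auto simp: dist_real_def)
    then show "f t + pw k * (u - t) = rs f u" using v(2)[of u] by (simp add: rs_def)
  qed
  then have "(rs f \<longlongrightarrow> f t + pw k * (t - t)) (at t within {t..l})" using lim by (rule Lim_transform_eventually[rotated])
  then show ?thesis using t by (simp add: continuous_within rs_def)
qed

lemma rs_pw_affine: assumes f: "f \<in> W" shows "pw_affine \<Gamma> (slope_group lam) l (rs f)"
proof -
  obtain P where P: "adapted f P" using W_adapted[OF f] by blast
  have pt: "part 0 l P" using adapted_part[OF P] .
  define B where "B = insert l (fst ` P)"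
  have Beq: "B = insert 0 (snd ` P)" unfolding B_def using part_endpoints[OF pt] l_pos by simp
  have fin: "finite B" using part_finite[OF pt] by (simp add: B_def)
  have BG: "B \<subseteq> \<Gamma>" using adapted_ends[OF P] l_in by (auto simp: B_def)
  have Bb: "0 \<le> b \<and> b \<le> l" if "b \<in> B" for b
  proof -
    have "b = l \<or> (\<exists>p\<in>P. b = fst p)" using that by (auto simp: B_def)
    then show ?thesis using part_bounds[OF pt] part_less[OF pt] l_pos by (metis less_imp_le order_trans order_refl)
  qed
  \<comment> \<open>The unordered division points are sorted here, since the definition of V asks
    for an increasing sequence. Neighbours in the list lie in a common piece.\<close>
  define xs where "xs = sorted_list_of_set B"
  have sx: "set xs = B" "sorted_wrt (<) xs" using fin by (simp_all add: xs_def)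
  define n where "n = length xs - 1"
  have lx: "0 < length xs" using sx(1) by (cases xs) (auto simp: B_def)
  have in_B: "xs ! i \<in> B" if "i \<le> n" for i 
  proof -
    have "i < length xs" using that lx unfolding n_def by linarith
    then show ?thesis using sx(1) nth_mem by blast
  qed
  have less: "xs ! i < xs ! j" if "i < j" "j \<le> n" for i j
    using sorted_wrt_nth_less[OF sx(2) that(1)] that lx by (simp add: n_def)
  have idx: "\<exists>j\<le>n. xs ! j = b" if "b \<in> B" for b
    using that sx(1) lx by (metis Suc_pred' in_set_conv_nth less_Suc_eq_le n_def diff_Suc_1 One_nat_def)
  have "xs ! 0 = 0"
  proof -
    obtain j where j: "j \<le> n" "xs ! j = 0" using idx[of 0] Beq by blast
    then show ?thesis using less[of 0 j] Bb[OF in_B[of 0]] by (cases "j = 0") auto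
  qed
  moreover have "xs ! n = l"
  proof -
    obtain j where j: "j \<le> n" "xs ! j = l" using idx[of l] by (auto simp: B_def)
    then show ?thesis using less[of j n] Bb[OF in_B[of n]] by (cases "j = n") auto
  qed
  moreover have "\<exists>s\<in>slope_group lam. \<exists>c. \<forall>t\<in>{xs ! i..<xs ! Suc i}. rs f t = s * t + c" if i: "i < n" for i
  proof -
    have b: "xs ! i \<in> B" "xs ! Suc i \<in> B" "xs ! i < xs ! Suc i" using in_B[of i] in_B[of "Suc i"] less[of i "Suc i"] i by auto
    have "xs ! i \<noteq> l" using b Bb[of "xs ! Suc i"] by auto
    then obtain p where p: "p \<in> P" "fst p = xs ! i" using b(1) by (auto simp: B_def)
    have "snd p \<in> B" using p Beq by auto
    then obtain j where j: "j \<le> n" "xs ! j = snd p" using idx by blast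
    have "i < j"
    proof (rule ccontr)
      assume "\<not> i < j"
      then have "xs ! j \<le> xs ! i" using less[of j i] i by (cases "j = i") auto
      then show False using j p part_less[OF pt p(1)] by simp
    qed
    then have le: "xs ! Suc i \<le> snd p" using less[of "Suc i" j] j by (cases "Suc i = j") auto
    obtain k where k: "\<And>t. fst p \<le> t \<Longrightarrow> t < snd p \<Longrightarrow> f t = f (fst p) + pw k * (t - fst p)"
      using adaptedE[OF P p(1)] by metis
    have "rs f t = pw k * t + (f (fst p) - pw k * fst p)" if t: "t \<in> {xs ! i..<xs ! Suc i}" for t
    proof -
      have "t \<in> J" using t Bb[OF b(1)] Bb[OF b(2)] by auto
      moreover have "f t = f (fst p) + pw k * (t - fst p)" by (rule k) (use t le p in auto)
      ultimately show ?thesis by (simp add: rs_def algebra_simps)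
    qed
    then show ?thesis using slope_group_eq by blast
  qed
  ultimately show ?thesis unfolding pw_affine_def
    using less in_B BG by (intro exI[of _ n] exI[of _ "\<lambda>i. xs ! i"]) auto
qed

lemma rs_V: "f \<in> W \<Longrightarrow> rs f \<in> Vc"
  unfolding V_carrier_def using rs_Bij rs_cont rs_pw_affine by blast

text \<open>The point \<open>l\<close> is fixed: a value \<open>g l < l\<close> would leave a gap that no half-open image interval can close.\<close>
lemma xt_W:
  assumes g: "g \<in> Vc"
  shows "xt g \<in> W" "g l = l"
proof -
  have bij: "bij_betw g J J" using g unfolding V_carrier_def Bij_def by blast
  then have inj: "inj_on g J" and img: "g ` J = J" unfolding bij_betw_def by auto
  obtain n x where x: "x 0 = 0" "x n = l" "\<And>i. i < n \<Longrightarrow> x i < x (Suc i)" "\<And>i. i \<le> n \<Longrightarrow> x i \<in> \<Gamma>"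
    "\<And>i. i < n \<Longrightarrow> \<exists>s\<in>slope_group lam. \<exists>c. \<forall>t\<in>{x i..<x (Suc i)}. g t = s * t + c"
    using g unfolding V_carrier_def pw_affine_def by blast
  have inc: "x i \<le> x j" if "i \<le> j" "j \<le> n" for i j
    using that
  proof (induction j)
    case (Suc j) then show ?case using x(3)[of j] by (cases "i = Suc j") auto
  qed simp
  define B where "B = x ` {..n}"
  have fin: "finite B" and BG: "B \<subseteq> \<Gamma>" and B0: "0 \<in> B" and Bl: "l \<in> B"
    using x(1,2,4) by (auto simp: B_def)
  have BJ: "B \<subseteq> J" using inc[of 0] inc[of _ n] x(1,2) by (auto simp: B_def)
  define P where "P = brk B"
  have pt: "part 0 l P" unfolding P_def by (rule part_brk[OF fin B0 Bl BJ])
  have piece: "\<exists>k. \<forall>t. fst p \<le> t \<longrightarrow> t < snd p \<longrightarrow> g t = g (fst p) + pw k * (t - fst p)" if p: "p \<in> P" for p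
  proof -
    have pb: "fst p \<in> B" "snd p \<in> B" "fst p < snd p" "\<And>b. b \<in> B \<Longrightarrow> b \<le> fst p \<or> snd p \<le> b"
      using p by (auto simp: P_def brk_def)
    obtain i where i: "i \<le> n" "fst p = x i" using pb(1) by (auto simp: B_def)
    have "i \<noteq> n" using i x(2) pb BJ by force
    then have i': "i < n" using i by simp
    then have "x (Suc i) \<in> B" "x i < x (Suc i)" using x(3) by (auto simp: B_def)
    then have le: "snd p \<le> x (Suc i)" using pb(4) i by force
    obtain s c where s: "s \<in> slope_group lam" "\<And>t. t \<in> {x i..<x (Suc i)} \<Longrightarrow> g t = s * t + c" using x(5)[OF i'] by blast
    obtain k where k: "s = pw k" using s(1) slope_group_eq by blast
    have "g t = g (fst p) + pw k * (t - fst p)" if "fst p \<le> t" "t < snd p" for t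
      using s(2)[of t] s(2)[of "fst p"] that le i k pb(3) by (simp add: algebra_simps)
    then show ?thesis by blast
  qed
  have pJ: "fst p \<in> J" "fst p < l" "fst p \<in> \<Gamma>" "snd p \<in> \<Gamma>" "snd p \<le> l" if "p \<in> P" for p
    using that part_bounds[OF pt that] part_less[OF pt that] BG by (auto simp: P_def brk_def)
  have finP: "finite P" using part_finite[OF pt] .
  have preim: "\<exists>t\<in>J. g t = u" if "u \<in> J" for u using img that by (metis imageE)
  have left: "\<exists>t'. fst p \<le> t' \<and> t' < t \<and> g t' = q" if p: "p \<in> P" "fst p \<le> t" "t < snd p" and q: "g (fst p) \<le> q" "q < g t" for p t q
  proof -
    obtain k where k: "\<And>t. fst p \<le> t \<Longrightarrow> t < snd p \<Longrightarrow> g t = g (fst p) + pw k * (t - fst p)" using piece[OF p(1)] by blast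
    define t' where "t' = fst p + pw (- k) * (q - g (fst p))"
    have "pw (- k) * (q - g (fst p)) < pw (- k) * (pw k * (t - fst p))"
      using q(2) k[OF p(2,3)] by (intro mult_strict_left_mono) auto
    then have t': "fst p \<le> t'" "t' < t" using q(1) by (auto simp: t'_def)
    then have "g t' = g (fst p) + pw k * (t' - fst p)" using p by (intro k) auto
    then show ?thesis using t' by (intro exI[of _ t']) (simp add: t'_def)
  qed
  show gl: "g l = l"
  proof (rule ccontr)
    assume n: "g l \<noteq> l"
    define q where "q = g l"
    have "g l \<in> J" using bij_betwE[OF bij] l_pos by simp
    then have q: "0 \<le> q" "q < l" using n unfolding q_def by auto
    \<comment> \<open>The value \<open>u\<close> chosen below lies just above q, under every left
      image value exceeding q. The piece attaining \<open>u\<close> then starts at or below q and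
      attains q a second time, at a point other than l.\<close>
    define M where "M = insert l {y \<in> (\<lambda>p. g (fst p)) ` P. y > q}"
    have fM: "finite M" using finP by (simp add: M_def)
    have mM: "Min M > q" using fM q by (subst Min_gr_iff) (auto simp: M_def)
    define u where "u = (q + Min M) / 2"
    have "Min M \<le> l" using fM by (intro Min_le) (auto simp: M_def)
    then have u: "q < u" "u < Min M" "u \<in> J" "u < l" using mM q by (auto simp: u_def)
    obtain t where t: "t \<in> J" "g t = u" using preim[OF u(3)] by blast
    have "t \<noteq> l" using t u q_def by auto
    then obtain p where p: "p \<in> P" "fst p \<le> t" "t < snd p" using part_cover[OF pt, of t] t by auto
    obtain k where "g t = g (fst p) + pw k * (t - fst p)" using piece[OF p(1)] p by blast
    then have "g (fst p) \<le> u" using t p by simp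
    have "g (fst p) \<le> q"
    proof (rule ccontr)
      assume "\<not> g (fst p) \<le> q"
      then have "g (fst p) \<in> M" using p by (auto simp: M_def)
      then have "Min M \<le> g (fst p)" using fM by simp
      then show False using \<open>g (fst p) \<le> u\<close> u by simp
    qed
    then obtain t' where t': "fst p \<le> t'" "t' < t" "g t' = q" using left[OF p] u t by blast
    have "t' \<in> J" "l \<in> J" using t' t pJ[OF p(1)] l_pos by auto
    then have "t' = l" using inj t'(3) unfolding inj_on_def q_def by blast
    then show False using t' t by simp
  qed
  have gr: "0 \<le> g t \<and> g t < l" if "0 \<le> t" "t < l" for t
  proof -
    have "g t \<in> J" using bij_betwE[OF bij] that by simp
    moreover have "g t \<noteq> l"
    proof
      assume "g t = l"
      then have "g t = g l" using gl by simp
      then have "t = l" using inj that unfolding inj_on_def by auto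
      then show False using that by simp
    qed
    ultimately show ?thesis by simp
  qed
  \<comment> \<open>The definition of V puts the break points into \<open>\<Gamma>\<close> but says
    nothing about their values. The smallest left value outside \<open>\<Gamma>\<close> is the right
    image end of a piece whose left value lies in \<open>\<Gamma>\<close>, and so it lies in
    \<open>\<Gamma>\<close> after all.\<close>
  have gG: "g (fst p) \<in> \<Gamma>" if "p \<in> P" for p
  proof (rule ccontr)
    assume "g (fst p) \<notin> \<Gamma>"
    define Z where "Z = {p\<in>P. g (fst p) \<notin> \<Gamma>}"
    have "p \<in> Z" using that \<open>g (fst p) \<notin> \<Gamma>\<close> by (simp add: Z_def)
    then have Z: "finite Z" "Z \<noteq> {}" using finite_subset[OF _ finP, of Z] unfolding Z_def by blast+
    define c where "c = Min ((\<lambda>p. g (fst p)) ` Z)"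
    have "c \<in> (\<lambda>p. g (fst p)) ` Z" unfolding c_def using Z by (intro Min_in) auto
    then obtain r where r: "r \<in> P" "g (fst r) \<notin> \<Gamma>" "c = g (fst r)" by (auto simp: Z_def)
    have cmin: "c \<le> g (fst q)" if "q \<in> P" "g (fst q) \<notin> \<Gamma>" for q
      unfolding c_def using Z(1) that by (intro Min_le) (auto simp: Z_def)
    have c: "0 < c" "c < l"
    proof -
      have "0 \<le> c \<and> c < l" using gr[of "fst r"] pJ[OF r(1)] r(3) by auto
      moreover have "c \<noteq> 0" using r G_0 by metis
      ultimately show "0 < c" "c < l" by auto
    qed
    have "\<forall>p\<in>P. \<exists>k. \<forall>t. fst p \<le> t \<longrightarrow> t < snd p \<longrightarrow> g t = g (fst p) + pw k * (t - fst p)" using piece by blast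
    then obtain \<kappa> where \<kappa>: "\<And>p t. p \<in> P \<Longrightarrow> fst p \<le> t \<Longrightarrow> t < snd p \<Longrightarrow> g t = g (fst p) + pw (\<kappa> p) * (t - fst p)"
      by metis
    define en where "en p = g (fst p) + pw (\<kappa> p) * (snd p - fst p)" for p
    \<comment> \<open>Between the largest of these image ends and \<open>c\<close> there is none, so
      the piece attaining \<open>u\<close> cannot end before \<open>c\<close>; it cannot pass
      \<open>c\<close> either, by injectivity.\<close>
    define M where "M = insert 0 {y \<in> (\<lambda>p. g (fst p)) ` P \<union> en ` P. y < c}"
    have fM: "finite M" using finP by (simp add: M_def)
    have mM: "Max M < c" using fM c by (subst Max_less_iff) (auto simp: M_def)
    define u where "u = (c + Max M) / 2"
    have "0 \<le> Max M" using fM by (intro Max_ge) (auto simp: M_def)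
    then have u: "u < c" "Max M < u" "u \<in> J" using mM c by (auto simp: u_def)
    obtain t where t: "t \<in> J" "g t = u" using preim[OF u(3)] by blast
    have "t \<noteq> l" using t u c gl by auto
    then obtain q where q: "q \<in> P" "fst q \<le> t" "t < snd q" using part_cover[OF pt, of t] t by auto
    have gt: "u = g (fst q) + pw (\<kappa> q) * (t - fst q)" using \<kappa>[OF q] t by simp
    then have lt: "g (fst q) \<le> u" using q by simp
    have "g (fst q) \<in> \<Gamma>" using cmin[OF q(1)] lt u by force
    have ltn: "u < en q"
    proof -
      have "pw (\<kappa> q) * (t - fst q) < pw (\<kappa> q) * (snd q - fst q)" using q by (intro mult_strict_left_mono) auto
      then show ?thesis using gt by (simp add: en_def)
    qed
    have "\<not> en q < c"
    proof
      assume "en q < c"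
      then have "en q \<in> M" using q by (auto simp: M_def)
      then have "en q \<le> Max M" using fM by simp
      then show False using ltn u by simp
    qed
    moreover have "\<not> c < en q"
    proof
      assume h: "c < en q"
      define s where "s = fst q + pw (- \<kappa> q) * (c - g (fst q))"
      have "pw (- \<kappa> q) * (c - g (fst q)) < pw (- \<kappa> q) * (pw (\<kappa> q) * (snd q - fst q))"
        using h by (intro mult_strict_left_mono) (auto simp: en_def)
      then have s: "fst q \<le> s" "s < snd q" using lt u by (auto simp: s_def)
      then have "g s = c" using \<kappa>[OF q(1) s] by (simp add: s_def)
      then have "g s = g (fst r)" using r by simp
      moreover have "s \<in> J" using s pJ[OF q(1)] by auto
      ultimately have "s = fst r" using inj pJ(1)[OF r(1)] unfolding inj_on_def by blast
      then have "q = r" using part_unique[OF pt q(1) r(1), of s] s part_less[OF pt r(1)] by auto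
      then show False using lt u r by simp
    qed
    ultimately have "c = en q" by simp
    then have "c \<in> \<Gamma>" unfolding en_def using \<open>g (fst q) \<in> \<Gamma>\<close> pJ[OF q(1)] by simp
    then show False using r by simp
  qed
  show "xt g \<in> W"
  proof -
    have eq: "xt g t = g t" if "0 \<le> t" "t < l" for t using that by (simp add: xt_def)
    have rng: "0 \<le> xt g t \<and> xt g t < l \<longleftrightarrow> 0 \<le> t \<and> t < l" for t using gr by (auto simp: xt_def)
    have "bij (xt g)"
    proof (rule bijI)
      show "inj (xt g)"
      proof (rule injI)
        fix s t assume h: "xt g s = xt g t"
        show "s = t"
        proof (cases "0 \<le> s \<and> s < l")
          case True
          then have "0 \<le> t \<and> t < l" using rng h by metis
          then show ?thesis using h True eq inj unfolding inj_on_def by auto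
        next
          case False
          then have "\<not> (0 \<le> t \<and> t < l)" using rng h by metis
          then have "xt g t = t" "xt g s = s" using False by (simp_all only: xt_def if_False)
          then show ?thesis using h by simp
        qed
      qed
      show "surj (xt g)" unfolding surj_def
      proof
        fix u
        show "\<exists>t. u = xt g t"
        proof (cases "0 \<le> u \<and> u < l")
          case True
          then obtain t where t: "t \<in> J" "g t = u" using preim[of u] by auto
          then have "t \<noteq> l" using True gl by auto
          then show ?thesis using t eq[of t] by (intro exI[of _ t]) auto
        next
          case False then show ?thesis by (intro exI[of _ u]) (auto simp: xt_def)
        qed
      qed
    qed
    moreover have "adapted (xt g) P" unfolding adapted_def
    proof (intro conjI ballI)
      show "part 0 l P" by (rule pt)
      fix p assume p: "p \<in> P"
      have f: "xt g (fst p) = g (fst p)" using pJ[OF p] by (intro eq) auto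
      show "fst p \<in> \<Gamma>" "snd p \<in> \<Gamma>" using pJ[OF p] by auto
      show "xt g (fst p) \<in> \<Gamma>" unfolding f using gG[OF p] .
      obtain k where k: "\<And>t. fst p \<le> t \<Longrightarrow> t < snd p \<Longrightarrow> g t = g (fst p) + pw k * (t - fst p)" using piece[OF p] by blast
      have "xt g t = xt g (fst p) + pw k * (t - fst p)" if "fst p \<le> t" "t < snd p" for t
        unfolding f using k[OF that] eq[of t] that pJ[OF p] by auto
      then show "aff (xt g) p" unfolding aff_def by blast
    qed
    moreover have "xt g t = t" if "\<not> (0 \<le> t \<and> t < l)" for t using that by (simp only: xt_def if_False)
    ultimately show ?thesis unfolding W_def by blast
  qed
qed

lemma rs_xt: assumes "g \<in> Vc" shows "rs (xt g) = g"
proof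
  fix t
  have "g \<in> extensional J" using assms unfolding V_carrier_def Bij_def by blast
  then show "rs (xt g) t = g t" using xt_W(2)[OF assms] unfolding rs_def xt_def
    by (cases "t \<in> J") (auto simp: extensional_def)
qed

lemma xt_rs: assumes "f \<in> W" shows "xt (rs f) = f"
proof
  fix t show "xt (rs f) t = f t" using W_out[OF assms, of t] by (auto simp: xt_def rs_def)
qed

lemma rs_comp: assumes "f \<in> W" "g \<in> W" shows "rs (g \<circ> f) = compose J (rs g) (rs f)"
proof
  fix t show "rs (g \<circ> f) t = compose J (rs g) (rs f) t"
    using W_J[OF assms(1), of t] by (auto simp: rs_def compose_def restrict_def)
qed

lemma V_simps: "carrier V = Vc" "\<one>\<^bsub>V\<^esub> = rs id" "x \<in> Bij J \<Longrightarrow> y \<in> Bij J \<Longrightarrow> x \<otimes>\<^bsub>V\<^esub> y = compose J x y"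
  by (auto simp: V_group_def BijGroup_def rs_def restrict_def)

lemma rs_mult: assumes "f \<in> W" "g \<in> W" shows "rs (g \<circ> f) = rs g \<otimes>\<^bsub>V\<^esub> rs f"
  using rs_comp[OF assms] V_simps(3)[OF rs_Bij[OF assms(2)] rs_Bij[OF assms(1)]] by simp

lemma V_elem: "g \<in> Vc \<Longrightarrow> \<exists>f\<in>W. g = rs f" using xt_W rs_xt by metis

lemma V_grp: "group V"
proof (rule groupI)
  fix x y assume "x \<in> carrier V" "y \<in> carrier V"
  then obtain f g where f: "f \<in> W" "x = rs f" "g \<in> W" "y = rs g" using V_elem V_simps(1) by metis
  show "x \<otimes>\<^bsub>V\<^esub> y \<in> carrier V" using rs_mult[OF f(3,1)] rs_V[OF W_comp[OF f(3,1)]] f V_simps(1) by simp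
next
  show "\<one>\<^bsub>V\<^esub> \<in> carrier V" unfolding V_simps using rs_V[OF W_id] .
next
  fix x y z assume "x \<in> carrier V" "y \<in> carrier V" "z \<in> carrier V"
  then obtain f g h where f: "f \<in> W" "x = rs f" "g \<in> W" "y = rs g" "h \<in> W" "z = rs h" using V_elem V_simps(1) by metis
  show "x \<otimes>\<^bsub>V\<^esub> y \<otimes>\<^bsub>V\<^esub> z = x \<otimes>\<^bsub>V\<^esub> (y \<otimes>\<^bsub>V\<^esub> z)"
    unfolding f(2,4,6) rs_mult[OF f(3,1), symmetric] rs_mult[OF f(5,3), symmetric]
      rs_mult[OF f(5) W_comp[OF f(3,1)], symmetric] rs_mult[OF W_comp[OF f(5,3)] f(1), symmetric]
    by (simp only: comp_assoc)
next
  fix x assume "x \<in> carrier V"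
  then obtain f where f: "f \<in> W" "x = rs f" using V_elem V_simps(1) by metis
  show "\<one>\<^bsub>V\<^esub> \<otimes>\<^bsub>V\<^esub> x = x" unfolding f(2) V_simps(2) rs_mult[OF f(1) W_id, symmetric] by (simp only: id_comp)
  have "finv f \<circ> f = id" using W_inv_f[OF f(1)] by (auto simp: fun_eq_iff)
  then have "rs (finv f) \<otimes>\<^bsub>V\<^esub> x = \<one>\<^bsub>V\<^esub>" unfolding f(2) V_simps(2) rs_mult[OF f(1) W_inv[OF f(1)], symmetric] by (simp only:)
  then show "\<exists>y\<in>carrier V. y \<otimes>\<^bsub>V\<^esub> x = \<one>\<^bsub>V\<^esub>" using rs_V[OF W_inv[OF f(1)]] V_simps(1) by blast
qed

definition cl :: "(real \<Rightarrow> real) \<Rightarrow> (real \<Rightarrow> real) set" where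
  "cl f = derived V (carrier V) #>\<^bsub>V\<^esub> rs f"

lemma cl_hom: "pl_hom lam l (abelianisation V) cl"
proof -
  interpret Vg: group V by (rule V_grp)
  interpret D: normal "derived V (carrier V)" V by (rule Vg.derived_self_is_normal)
  have rsV: "f \<in> W \<Longrightarrow> rs f \<in> carrier V" for f using rs_V V_simps(1) by simp
  have "pl_hom_axioms lam l (abelianisation V) cl"
  proof
    fix f assume "f \<in> W"
    then show "cl f \<in> carrier (abelianisation V)"
      using rsV Vg.rcosetsI[OF D.subset] by (simp add: abelianisation_def FactGroup_def cl_def)
  next
    fix f g assume "f \<in> W" "g \<in> W"
    then show "cl (f \<circ> g) = cl f \<otimes>\<^bsub>abelianisation V\<^esub> cl g"
      using D.rcos_sum[OF rsV rsV] rs_mult by (simp add: abelianisation_def FactGroup_def cl_def)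
  qed
  moreover have "comm_group (abelianisation V)" unfolding abelianisation_def by (rule Vg.derived_quot_is_comm_group)
  ultimately show ?thesis unfolding pl_hom_def using pl_axioms by blast
qed

lemma cl_one: assumes "f \<in> W" shows "cl f = \<one>\<^bsub>abelianisation V\<^esub> \<longleftrightarrow> rs f \<in> derived V (carrier V)"
proof -
  interpret Vg: group V by (rule V_grp)
  have s: "subgroup (derived V (carrier V)) V" using Vg.derived_is_subgroup[of "carrier V"] by simp
  have r: "rs f \<in> carrier V" using rs_V[OF assms] V_simps(1) by simp
  show ?thesis unfolding cl_def abelianisation_def FactGroup_def
    using Vg.coset_join1[OF _ r s] Vg.coset_join2[OF r s] by auto
qed

text \<open>Every class has a representative \<open>gel y\<close>, so an invariant is complete as soon as it is so on these.\<close>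
lemma Vab_iso:
  assumes H: "comm_group H" and X: "\<And>f. f \<in> W \<Longrightarrow> X f \<in> carrier H"
    and Xm: "\<And>f g. f \<in> W \<Longrightarrow> g \<in> W \<Longrightarrow> X (f \<circ> g) = X f \<otimes>\<^bsub>H\<^esub> X g"
    and surj: "\<And>h. h \<in> carrier H \<Longrightarrow> \<exists>y\<in>\<Gamma>. X (gel y) = h"
    and ker: "\<And>y. (\<And>z. z \<in> pl_hom.Ker lam l (abelianisation V) cl \<Longrightarrow> X (gel z) = \<one>\<^bsub>H\<^esub>) \<Longrightarrow> y \<in> \<Gamma> \<Longrightarrow> X (gel y) = \<one>\<^bsub>H\<^esub> \<Longrightarrow>
      y \<in> pl_hom.Ker lam l (abelianisation V) cl"
  shows "abelianisation V \<cong> H"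
proof -
  interpret Vg: group V by (rule V_grp)
  interpret H: comm_group H by fact
  interpret C: pl_hom lam l "abelianisation V" cl by (rule cl_hom)
  define Y where "Y g = X (xt g)" for g
  have Yrs: "Y (rs f) = X f" if "f \<in> W" for f using xt_rs[OF that] by (simp add: Y_def)
  have Yhom: "Y \<in> hom V H"
  proof (rule homI)
    fix g assume "g \<in> carrier V"
    then show "Y g \<in> carrier H" using X xt_W(1) V_simps(1) by (simp add: Y_def)
  next
    fix g h assume "g \<in> carrier V" "h \<in> carrier V"
    then obtain f1 f2 where f: "f1 \<in> W" "g = rs f1" "f2 \<in> W" "h = rs f2" using V_elem V_simps(1) by metis
    have "Y (rs (f1 \<circ> f2)) = X f1 \<otimes>\<^bsub>H\<^esub> X f2" using Yrs[OF W_comp[OF f(3,1)]] Xm[OF f(1,3)] by simp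
    then show "Y (g \<otimes>\<^bsub>V\<^esub> h) = Y g \<otimes>\<^bsub>H\<^esub> Y h" unfolding f rs_mult[OF f(3,1)] Yrs[OF f(1)] Yrs[OF f(3)] .
  qed
  interpret Yh: group_hom V H Y by unfold_locales (rule Yhom)
  note dk = hom_derived_one[OF V_grp H Yhom]
  have KerX: "X (gel z) = \<one>\<^bsub>H\<^esub>" if z: "z \<in> C.Ker" for z
  proof -
    have zG: "z \<in> \<Gamma>" and "C.psi z = \<one>\<^bsub>abelianisation V\<^esub>" using z unfolding C.Ker_def by auto
    then have "cl (gel z) = \<one>\<^bsub>abelianisation V\<^esub>" using C.phi_gel by simp
    then have "rs (gel z) \<in> derived V (carrier V)" using cl_one[OF gel_W[OF zG]] by blast
    then show ?thesis using dk Yrs[OF gel_W[OF zG]] by simp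
  qed
  show ?thesis
  proof (rule abelianisation_iso[OF V_grp H Yhom])
    show "Y ` carrier V = carrier H"
    proof
      show "Y ` carrier V \<subseteq> carrier H" using Yh.hom_closed by blast
      show "carrier H \<subseteq> Y ` carrier V"
      proof
        fix h assume "h \<in> carrier H"
        then obtain y where y: "y \<in> \<Gamma>" "X (gel y) = h" using surj by blast
        then have "h = Y (rs (gel y))" "rs (gel y) \<in> carrier V" using Yrs gel_W rs_V V_simps(1) by auto
        then show "h \<in> Y ` carrier V" by blast
      qed
    qed
    fix g assume "g \<in> carrier V" and Yg: "Y g = \<one>\<^bsub>H\<^esub>"
    then obtain f where f: "f \<in> W" "g = rs f" using V_elem V_simps(1) by metis
    have Xf: "X f = \<one>\<^bsub>H\<^esub>" using Yg Yrs[OF f(1)] f(2) by simp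
    have "cl f \<in> C.psi ` \<Gamma>" using C.phi_Img[OF f(1)] unfolding C.Img_def .
    then obtain y where y: "y \<in> \<Gamma>" "cl f = cl (gel y)" using C.phi_gel by auto
    \<comment> \<open>As \<open>f\<close> and \<open>gel y\<close> have the same class, their
      quotient lies in the derived subgroup and is invisible to \<open>X\<close>.\<close>
    let ?d = "f \<circ> finv (gel y)"
    have gy: "gel y \<in> W" using gel_W[OF y(1)] .
    have d: "?d \<in> W" using W_comp[OF W_inv[OF gy] f(1)] .
    have "cl ?d = cl f \<otimes>\<^bsub>abelianisation V\<^esub> inv\<^bsub>abelianisation V\<^esub> cl (gel y)"
      using C.phi_mult[OF f(1) W_inv[OF gy]] C.phi_inv[OF gy] by simp
    also have "\<dots> = \<one>\<^bsub>abelianisation V\<^esub>" unfolding y(2) using C.phi_closed[OF gy] by simp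
    finally have "rs ?d \<in> derived V (carrier V)" using cl_one[OF d] by blast
    then have Xd: "X ?d = \<one>\<^bsub>H\<^esub>" using dk Yrs[OF d] by simp
    have "finv (gel y) \<circ> gel y = id" using W_inv_f[OF gy] by (auto simp: fun_eq_iff)
    then have "?d \<circ> gel y = f" by (simp only: comp_assoc comp_id)
    then have "X f = X ?d \<otimes>\<^bsub>H\<^esub> X (gel y)" using Xm[OF d gy] by (simp only:)
    then have "X (gel y) = \<one>\<^bsub>H\<^esub>" using Xf Xd X[OF gy] by simp
    then have "y \<in> C.Ker" using ker[OF KerX y(1)] by blast
    then have "cl f = \<one>\<^bsub>abelianisation V\<^esub>" using y C.phi_gel[OF y(1)] unfolding C.Ker_def by simp
    then show "g \<in> derived V (carrier V)" using cl_one[OF f(1)] f(2) by blast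
  qed
qed

end

section \<open>The abelianisation in each case\<close>

lemma mod_abs_eq_iff: "x mod \<bar>m\<bar> = y mod \<bar>m\<bar> \<longleftrightarrow> [x = y] (mod m)" for x y m :: int
  by (simp add: cong_iff_dvd_diff mod_eq_dvd_iff)

lemma Z_mod_simps:
  "comm_group (Z_mod m)" "\<one>\<^bsub>Z_mod m\<^esub> = 0" "x mod \<bar>m\<bar> \<in> carrier (Z_mod m)"
  "x \<otimes>\<^bsub>Z_mod m\<^esub> y = (x + y) mod \<bar>m\<bar>" "z \<in> carrier (Z_mod m) \<Longrightarrow> z mod \<bar>m\<bar> = z"
  by (auto simp: Z_mod_def carrier_integer_mod_group split: if_splits)

context pl_poly
begin

sublocale ab: pl_both lam l "abelianisation V" cl f
  by (intro pl_both.intro cl_hom pl_poly_axioms)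

lemma Z_mod_hom:
  assumes "[\<chi> (g \<circ> h) = \<chi> g + \<chi> h] (mod m)"
  shows "\<chi> (g \<circ> h) mod \<bar>m\<bar> = (\<chi> g mod \<bar>m\<bar>) \<otimes>\<^bsub>Z_mod m\<^esub> (\<chi> h mod \<bar>m\<bar>)"
  unfolding Z_mod_simps mod_add_eq mod_abs_eq_iff by (rule assms)

text \<open>On representatives the invariant is the additive function \<open>v\<close>, so the
  isomorphism reduces to statements about \<open>v\<close> on \<open>\<Gamma>\<close>: it takes the
  value 1, and it vanishes only on \<open>Ker\<close>.\<close>

lemma Vab_cyclic:
  assumes v: "addm m v" and c: "c \<in> \<Gamma>" "[v c = 1] (mod m)"
    and hom: "\<And>g h. g \<in> W \<Longrightarrow> h \<in> W \<Longrightarrow> [\<chi> (g \<circ> h) = \<chi> g + \<chi> h] (mod m)"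
    and r: "\<And>k y. y \<in> \<Gamma> \<Longrightarrow> 0 < y \<Longrightarrow> pw k + pw k + pw k * y < l \<Longrightarrow> [\<chi> (rot (pw k) (pw k) (pw k * y)) = v y] (mod m)"
    and ker: "\<And>y. (\<And>z. z \<in> ab.Ker \<Longrightarrow> [v z = 0] (mod m)) \<Longrightarrow> y \<in> \<Gamma> \<Longrightarrow> [v y = 0] (mod m) \<Longrightarrow> y \<in> ab.Ker"
  shows "abelianisation V \<cong> Z_mod m"
proof (rule Vab_iso[where X = "\<lambda>g. \<chi> g mod \<bar>m\<bar>"])
  have gel: "[\<chi> (gel y) = v y] (mod m)" if "y \<in> \<Gamma>" for y by (rule chi_gel[OF v hom r that])
  have one: "\<chi> (gel y) mod \<bar>m\<bar> = \<one>\<^bsub>Z_mod m\<^esub> \<longleftrightarrow> [v y = 0] (mod m)" if "y \<in> \<Gamma>" for y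
    using gel[OF that] mod_abs_eq_iff[of "\<chi> (gel y)" m 0] unfolding Z_mod_simps mod_0 by (auto simp: cong_def)
  show "comm_group (Z_mod m)" by (rule Z_mod_simps)
  show "\<chi> g mod \<bar>m\<bar> \<in> carrier (Z_mod m)" for g by (rule Z_mod_simps)
  show "\<chi> (g \<circ> h) mod \<bar>m\<bar> = (\<chi> g mod \<bar>m\<bar>) \<otimes>\<^bsub>Z_mod m\<^esub> (\<chi> h mod \<bar>m\<bar>)" if "g \<in> W" "h \<in> W" for g h
    by (rule Z_mod_hom[OF hom[OF that]])
  show "\<exists>y\<in>\<Gamma>. \<chi> (gel y) mod \<bar>m\<bar> = h" if h: "h \<in> carrier (Z_mod m)" for h
  proof
    show G: "of_int h * c \<in> \<Gamma>" using c(1) by simp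
    have "[v (of_int h * c) = h * v c] (mod m)" by (rule addm_int[OF v c(1)])
    moreover have "[h * v c = h * 1] (mod m)" using c(2) by (intro cong_mult cong_refl)
    ultimately have "[\<chi> (gel (of_int h * c)) = h] (mod m)" using gel[OF G] by (simp add: cong_def)
    then have "\<chi> (gel (of_int h * c)) mod \<bar>m\<bar> = h mod \<bar>m\<bar>" by (simp only: mod_abs_eq_iff)
    then show "\<chi> (gel (of_int h * c)) mod \<bar>m\<bar> = h" using Z_mod_simps(5)[OF h] by simp
  qed
  fix y assume k: "\<And>z. z \<in> ab.Ker \<Longrightarrow> \<chi> (gel z) mod \<bar>m\<bar> = \<one>\<^bsub>Z_mod m\<^esub>" and y: "y \<in> \<Gamma>" "\<chi> (gel y) mod \<bar>m\<bar> = \<one>\<^bsub>Z_mod m\<^esub>"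
  show "y \<in> ab.Ker"
  proof (rule ker[OF _ y(1)])
    show "[v z = 0] (mod m)" if "z \<in> ab.Ker" for z using k[OF that] one[OF ab.Ker_G[OF that]] by blast
    show "[v y = 0] (mod m)" using y one by blast
  qed
qed

lemma Vab_deg1_odd:
  assumes d: "degree f = 1" and o: "odd (poly f 1)"
  shows "trivial_group (abelianisation V)"
proof -
  have C: "carrier (Z_mod 1) = {0}" by (auto simp: Z_mod_def carrier_integer_mod_group)
  \<comment> \<open>With a trivial target the zero map is the invariant, and the kernel condition
    says that all of \<open>\<Gamma>\<close> lies in \<open>Ker\<close>.\<close>
  have "abelianisation V \<cong> Z_mod 1"
  proof (rule Vab_iso[where X = "\<lambda>_. 0"])
    show "comm_group (Z_mod 1)" by (rule Z_mod_simps)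
    show "0 \<in> carrier (Z_mod 1)" using C by simp
    show "0 = 0 \<otimes>\<^bsub>Z_mod 1\<^esub> 0" unfolding Z_mod_simps by simp
    show "\<exists>y\<in>\<Gamma>. 0 = h" if "h \<in> carrier (Z_mod 1)" for h using that C by (intro bexI[of _ 0]) auto
    show "y \<in> ab.Ker" if "y \<in> \<Gamma>" for y using ab.deg1_odd[OF d o that] .
  qed
  then obtain h where "bij_betw h (carrier (abelianisation V)) (carrier (Z_mod 1))" unfolding is_iso_def iso_def by blast
  then have "card (carrier (abelianisation V)) = card (carrier (Z_mod 1))" by (rule bij_betw_same_card)
  then have "card (carrier (abelianisation V)) = 1" using C by simp
  then obtain a where "carrier (abelianisation V) = {a}" by (rule card_1_singletonE)
  then show ?thesis using ab.A.trivial_group by blast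
qed

lemma Vab_deg1_even:
  assumes d: "degree f = 1" and e: "even (poly f 1)"
  shows "abelianisation V \<cong> Z_mod 2"
proof -
  obtain \<chi> v where v: "addm 2 v" "\<And>k. [v (pw k) = 1] (mod 2)"
    and c: "\<And>g h. g \<in> W \<Longrightarrow> h \<in> W \<Longrightarrow> [\<chi> (g \<circ> h) = \<chi> g + \<chi> h] (mod 2)"
      "\<And>k y. y \<in> \<Gamma> \<Longrightarrow> 0 < y \<Longrightarrow> pw k + pw k + pw k * y < l \<Longrightarrow> [\<chi> (rot (pw k) (pw k) (pw k * y)) = v y] (mod 2)"
    by (rule sign_invariant[OF e]) (rule that; assumption)
  have v1: "[v 1 = 1] (mod 2)" using v(2)[of 0] by simp
  show ?thesis
  proof (rule Vab_cyclic[OF v(1) G_1 v1])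
    show "y \<in> ab.Ker" if "\<And>z. z \<in> ab.Ker \<Longrightarrow> [v z = 0] (mod 2)" "y \<in> \<Gamma>" "[v y = 0] (mod 2)" for y
      by (rule ab.deg1_even[OF d v(1) v1]; (rule that; assumption | rule that))
  qed (rule c; assumption)+
qed

lemma Vab_deg2_odd:
  assumes d: "degree f = 2" and o: "odd (poly f 1)"
  shows "abelianisation V \<cong> Z_mod (1 - coeff f 0)"
proof -
  let ?m = "1 - coeff f 0"
  obtain \<chi> v where v: "addm ?m v" "[v 1 = 0] (mod ?m)" "[v lam = 1] (mod ?m)"
    and c: "\<And>g h. g \<in> W \<Longrightarrow> h \<in> W \<Longrightarrow> [\<chi> (g \<circ> h) = \<chi> g + \<chi> h] (mod ?m)"
      "\<And>k y. y \<in> \<Gamma> \<Longrightarrow> 0 < y \<Longrightarrow> pw k + pw k + pw k * y < l \<Longrightarrow> [\<chi> (rot (pw k) (pw k) (pw k * y)) = v y] (mod ?m)"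
    by (rule cyclic_invariant[OF recm_deg2[OF d]]) (assumption | rule that)+
  show ?thesis
  proof (rule Vab_cyclic[OF v(1) G_lam v(3)])
    show "y \<in> ab.Ker" if "\<And>z. z \<in> ab.Ker \<Longrightarrow> [v z = 0] (mod ?m)" "y \<in> \<Gamma>" "[v y = 0] (mod ?m)" for y
      by (rule ab.deg2_odd[OF d o v]; (rule that; assumption | rule that))
  qed (rule c; assumption)+
qed

lemma Vab_deg3:
  assumes d: "degree f = 3" and c0: "coeff f 0 = -1" and o: "odd (coeff f 2 + coeff f 1)"
  shows "abelianisation V \<cong> Z_mod (coeff f 1 + coeff f 2)"
proof -
  let ?m = "coeff f 1 + coeff f 2"
  obtain \<chi> v where v: "addm ?m v" "[v 1 = 0] (mod ?m)" "[v lam = 1] (mod ?m)"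
    and c: "\<And>g h. g \<in> W \<Longrightarrow> h \<in> W \<Longrightarrow> [\<chi> (g \<circ> h) = \<chi> g + \<chi> h] (mod ?m)"
      "\<And>k y. y \<in> \<Gamma> \<Longrightarrow> 0 < y \<Longrightarrow> pw k + pw k + pw k * y < l \<Longrightarrow> [\<chi> (rot (pw k) (pw k) (pw k * y)) = v y] (mod ?m)"
    by (rule cyclic_invariant[OF recm_deg3[OF d c0]]) (assumption | rule that)+
  show ?thesis
  proof (rule Vab_cyclic[OF v(1) G_lam v(3)])
    show "y \<in> ab.Ker" if "\<And>z. z \<in> ab.Ker \<Longrightarrow> [v z = 0] (mod ?m)" "y \<in> \<Gamma>" "[v y = 0] (mod ?m)" for y
      by (rule ab.deg3_ker[OF d c0 o v]; (rule that; assumption | rule that))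
  qed (rule c; assumption)+
qed

lemma Vab_deg2_even:
  assumes d: "degree f = 2" and e: "even (poly f 1)"
  shows "abelianisation V \<cong> Z_mod 2 \<times>\<times> Z_mod (1 - coeff f 0)"
proof -
  let ?m = "1 - coeff f 0"
  obtain \<chi> v where v: "addm ?m v" "[v 1 = 0] (mod ?m)" "[v lam = 1] (mod ?m)"
    and c: "\<And>g h. g \<in> W \<Longrightarrow> h \<in> W \<Longrightarrow> [\<chi> (g \<circ> h) = \<chi> g + \<chi> h] (mod ?m)"
      "\<And>k y. y \<in> \<Gamma> \<Longrightarrow> 0 < y \<Longrightarrow> pw k + pw k + pw k * y < l \<Longrightarrow> [\<chi> (rot (pw k) (pw k) (pw k * y)) = v y] (mod ?m)"
    by (rule cyclic_invariant[OF recm_deg2[OF d]]) (assumption | rule that)+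
  obtain \<psi> w where w: "addm 2 w" "\<And>k. [w (pw k) = 1] (mod 2)"
    and s: "\<And>g h. g \<in> W \<Longrightarrow> h \<in> W \<Longrightarrow> [\<psi> (g \<circ> h) = \<psi> g + \<psi> h] (mod 2)"
      "\<And>k y. y \<in> \<Gamma> \<Longrightarrow> 0 < y \<Longrightarrow> pw k + pw k + pw k * y < l \<Longrightarrow> [\<psi> (rot (pw k) (pw k) (pw k * y)) = w y] (mod 2)"
    by (rule sign_invariant[OF e]) (rule that; assumption)
  have w1: "[w 1 = 1] (mod 2)" and wl: "[w lam = 1] (mod 2)" using w(2)[of 0] w(2)[of 1] by simp_all
  have gv: "[\<chi> (gel y) = v y] (mod ?m)" if "y \<in> \<Gamma>" for y
    by (rule chi_gel[OF v(1) _ _ that]; rule c; assumption)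
  have gw: "[\<psi> (gel y) = w y] (mod 2)" if "y \<in> \<Gamma>" for y
    by (rule chi_gel[OF w(1) _ _ that]; rule s; assumption)
  define X where "X g = (\<psi> g mod \<bar>2\<bar>, \<chi> g mod \<bar>?m\<bar>)" for g
  have one: "X (gel y) = \<one>\<^bsub>Z_mod 2 \<times>\<times> Z_mod ?m\<^esub> \<longleftrightarrow> [w y = 0] (mod 2) \<and> [v y = 0] (mod ?m)" if y: "y \<in> \<Gamma>" for y
  proof -
    have "X (gel y) = \<one>\<^bsub>Z_mod 2 \<times>\<times> Z_mod ?m\<^esub> \<longleftrightarrow> \<psi> (gel y) mod \<bar>2\<bar> = 0 mod \<bar>2\<bar> \<and> \<chi> (gel y) mod \<bar>?m\<bar> = 0 mod \<bar>?m\<bar>"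
      unfolding X_def one_DirProd Z_mod_simps prod.inject mod_0 ..
    also have "\<dots> \<longleftrightarrow> [\<psi> (gel y) = 0] (mod 2) \<and> [\<chi> (gel y) = 0] (mod ?m)" unfolding mod_abs_eq_iff ..
    finally show ?thesis using gv[OF y] gw[OF y] by (simp add: cong_def)
  qed
  show ?thesis
  proof (rule Vab_iso[where X = X])
    show "comm_group (Z_mod 2 \<times>\<times> Z_mod ?m)"
    proof (rule group.group_comm_groupI)
      show "group (Z_mod 2 \<times>\<times> Z_mod ?m)" using Z_mod_simps(1) by (intro DirProd_group comm_group.axioms)
      show "x \<otimes>\<^bsub>Z_mod 2 \<times>\<times> Z_mod ?m\<^esub> y = y \<otimes>\<^bsub>Z_mod 2 \<times>\<times> Z_mod ?m\<^esub> x" for x y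
        by (cases x; cases y) (simp add: Z_mod_simps add.commute)
    qed
    show "X g \<in> carrier (Z_mod 2 \<times>\<times> Z_mod ?m)" for g
      unfolding X_def carrier_DirProd using Z_mod_simps(3) by blast
    show "X (g \<circ> h) = X g \<otimes>\<^bsub>Z_mod 2 \<times>\<times> Z_mod ?m\<^esub> X h" if "g \<in> W" "h \<in> W" for g h
      unfolding X_def mult_DirProd using Z_mod_hom[OF c(1)[OF that]] Z_mod_hom[OF s(1)[OF that]] by blast
    show "\<exists>y\<in>\<Gamma>. X (gel y) = h" if h: "h \<in> carrier (Z_mod 2 \<times>\<times> Z_mod ?m)" for h
    proof -
      obtain p q where pq: "h = (p, q)" "p \<in> carrier (Z_mod 2)" "q \<in> carrier (Z_mod ?m)" using h by auto
      \<comment> \<open>At 1 and \<open>lam\<close> the function \<open>v\<close> takes the values 0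
        and 1, and \<open>w\<close> takes 1 and 1; so this element has \<open>w\<close> equal to p
        and \<open>v\<close> equal to q. The pair is thus surjective for even moduli too.\<close>
      let ?y = "of_int (p - q) * 1 + of_int q * lam"
      have G: "of_int (p - q) * 1 \<in> \<Gamma>" "of_int q * lam \<in> \<Gamma>" using G_of_int[OF G_1] G_of_int[OF G_lam] by blast+
      have yG: "?y \<in> \<Gamma>" using G by (rule G_add)
      have lin: "[u ?y = (p - q) * u 1 + q * u lam] (mod n)" if u: "addm n u" for u n
      proof -
        have "[u ?y = u (of_int (p - q) * 1) + u (of_int q * lam)] (mod n)" by (rule addm_add[OF u G])
        moreover have "[u (of_int (p - q) * 1) + u (of_int q * lam) = (p - q) * u 1 + q * u lam] (mod n)"
          by (intro cong_add addm_int[OF u G_1] addm_int[OF u G_lam])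
        ultimately show ?thesis by (rule cong_trans)
      qed
      have "[(p - q) * v 1 + q * v lam = (p - q) * 0 + q * 1] (mod ?m)" using v by (intro cong_add cong_mult cong_refl)
      then have "[v ?y = (p - q) * 0 + q * 1] (mod ?m)" by (rule cong_trans[OF lin[OF v(1)]])
      then have "[\<chi> (gel ?y) = (p - q) * 0 + q * 1] (mod ?m)" by (rule cong_trans[OF gv[OF yG]])
      then have 1: "\<chi> (gel ?y) mod \<bar>?m\<bar> = q mod \<bar>?m\<bar>" unfolding mod_abs_eq_iff by simp
      have "[(p - q) * w 1 + q * w lam = (p - q) * 1 + q * 1] (mod 2)" using w1 wl by (intro cong_add cong_mult cong_refl)
      then have "[w ?y = (p - q) * 1 + q * 1] (mod 2)" by (rule cong_trans[OF lin[OF w(1)]])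
      then have "[\<psi> (gel ?y) = (p - q) * 1 + q * 1] (mod 2)" by (rule cong_trans[OF gw[OF yG]])
      then have 2: "\<psi> (gel ?y) mod \<bar>2\<bar> = p mod \<bar>2\<bar>" unfolding mod_abs_eq_iff by simp
      have "X (gel ?y) = h" unfolding X_def 1 2 pq(1) using Z_mod_simps(5)[OF pq(2)] Z_mod_simps(5)[OF pq(3)] by simp
      then show ?thesis using yG by blast
    qed
    fix y assume k: "\<And>z. z \<in> ab.Ker \<Longrightarrow> X (gel z) = \<one>\<^bsub>Z_mod 2 \<times>\<times> Z_mod ?m\<^esub>"
      and y: "y \<in> \<Gamma>" "X (gel y) = \<one>\<^bsub>Z_mod 2 \<times>\<times> Z_mod ?m\<^esub>"
    show "y \<in> ab.Ker"
    proof (rule ab.deg2_even[OF d e v _ w(1) w1 wl _ y(1)])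
      show "[v z = 0] (mod ?m)" "[w z = 0] (mod 2)" if "z \<in> ab.Ker" for z using k[OF that] one[OF ab.Ker_G[OF that]] by blast+
      show "[v y = 0] (mod ?m)" "[w y = 0] (mod 2)" using y one by blast+
    qed
  qed
qed

end

theorem corollary6p10:
  fixes lam l :: real and f :: "int poly"
  assumes "lam > 0" and "lam \<noteq> 1" and "algebraic lam"
    and "minimal_polynomial lam (map_poly of_int f)"
    and "l \<in> laurent_ring lam" and "l > 0"
  defines "Vab \<equiv> abelianisation (V_group (laurent_ring lam) (slope_group lam) l)"
  shows "(degree f = 1 \<longrightarrow>
            (even (poly f 1) \<longrightarrow> Vab \<cong> Z_mod 2) \<and>
            (odd (poly f 1) \<longrightarrow> trivial_group Vab)) \<and>
         (degree f = 2 \<and> coeff f 0 = 1 \<and> odd (coeff f 1) \<longrightarrow> Vab \<cong> integer_group) \<and>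
         (degree f = 2 \<and> coeff f 0 \<noteq> 1 \<longrightarrow>
            (even (poly f 1) \<longrightarrow> Vab \<cong> Z_mod 2 \<times>\<times> Z_mod (1 - coeff f 0)) \<and>
            (odd (poly f 1) \<longrightarrow> Vab \<cong> Z_mod (1 - coeff f 0))) \<and>
         (degree f = 3 \<and> coeff f 0 = -1 \<and> odd (coeff f 2 + coeff f 1) \<longrightarrow>
            Vab \<cong> Z_mod (coeff f 1 + coeff f 2))"
proof -
  interpret pl_poly lam l f by unfold_locales (fact assms)+
  \<comment> \<open>The odd case of degree two with modulus 1 - 1 = 0; here f(1) = 2 + a_1 is
    odd.\<close>
  have "Vab \<cong> integer_group" if d: "degree f = 2" "coeff f 0 = 1" "odd (coeff f 1)"
  proof -
    have "odd (poly f 1)" unfolding ab.deg2_coeff(2)[OF d(1)] using d by simp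
    moreover have "Z_mod 0 = integer_group" by (simp add: Z_mod_def integer_mod_group_def)
    ultimately show ?thesis using Vab_deg2_odd[OF d(1)] d(2) by (simp add: Vab_def)
  qed
  then show ?thesis unfolding Vab_def
    using Vab_deg1_odd Vab_deg1_even Vab_deg2_odd Vab_deg2_even Vab_deg3 by blast
qed

end
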